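(* The following decision problem is coNP-complete: given two ground ELPs $\Pi_1$ and $\Pi_2$, decide whether they are strongly equivalent, i.e. whether for every ground ELP $\Pi$ the programs $\Pi_1\cup\Pi$ and $\Pi_2\cup\Pi$ have the same set of candidate world views.
   Context: A literal over a set of atoms $\mathcal{A}$ is an atom $a\in\mathcal{A}$ or its default negation $\neg a$. A logic program (with double negation) is a pair $(\mathcal{A},\mathcal{R})$ with rules $a_1\vee\dots\vee a_l \leftarrow a_{l+1},\dots,a_m,\neg\ell_1,\dots,\neg\ell_n$. An interpretation $I\subseteq\mathcal{A}$ satisfies $a$ iff $a\in I$, satisfies $\neg \ell$ iff it does not satisfy $\ell$; it is a model of a rule if whenever it satisfies all body elements it contains some head atom. The GL-reduct $\Pi^I$ keeps, for each rule all of whose negated body elements are satisfied by $I$, the rule $\mathrm{head}\leftarrow$ (positive body atoms). $M$ is an answer set of $\Pi$ if $M$ is a model of $\Pi$ and no $M'\subsetneq M$ is a model of $\Pi^M$; $\mathrm{AS}(\Pi)$ is the set of answer sets. An epistemic literal is $\mathbf{not}\,\ell$ for a literal $\ell$. A ground ELP is $\Pi=(\mathcal{A},\mathcal{R})$ with rules $a_1\vee\dots\vee a_k \leftarrow \ell_1,\dots,\ell_m,\xi_1,\dots,\xi_j,\neg\xi_{j+1},\dots,\neg\xi_n$, with $a_i\in\mathcal{A}$, $\ell_i$ literals, $\xi_i$ epistemic literals over $\mathcal{A}$. The union is $(\mathcal{A}_1,\mathcal{R}_1)\cup(\mathcal{A}_2,\mathcal{R}_2)=(\mathcal{A}_1\cup\mathcal{A}_2,\mathcal{R}_1\cup\mathcal{R}_2)$.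 A candidate world interpretation (CWI) is a consistent set $I$ of literals over $\mathcal{A}$; $I^P=\{a: a\in I\}$, $I^N=\{a:\neg a\in I\}$, $I^U=\mathcal{A}\setminus(I^P\cup I^N)$. The epistemic reduct $\Pi^I$ replaces each $\mathbf{not}\,\ell$ by $\neg\ell$ if $\ell\in I$ and by $\top$ otherwise. $I$ is compatible with a set $\mathcal{I}$ of interpretations if $\mathcal{I}\neq\emptyset$, every $a\in I^P$ is in every $J\in\mathcal{I}$, no $a\in I^N$ is in any $J\in\mathcal{I}$, and each $a\in I^U$ is in some $J\in\mathcal{I}$ and not in some $J'\in\mathcal{I}$. $I$ is a candidate world view (CWV) of $\Pi$ iff $\mathrm{AS}(\Pi^I)$ is compatible with $I$. *)

theory Defs
  imports Main
begin

section \<open>Logic programs with nested negation\<close>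

text \<open>
  Body elements are nested negations of an atom or of \<open>Top\<close>. Literals and their negations only
  need depth two, but an epistemic reduct can also contain
  \<open>BNot Top\<close> and \<open>BNot (BNot (BNot (Atom a)))\<close>.
\<close>

datatype 'a body_exp = Top | Atom 'a | BNot "'a body_exp"

datatype 'a lp_rule = LP_Rule (lp_head: "'a list") (lp_body: "'a body_exp list")

type_synonym 'a lp = "'a set \<times> 'a lp_rule set"

fun sat :: "'a set \<Rightarrow> 'a body_exp \<Rightarrow> bool" where
  "sat I Top \<longleftrightarrow> True"
| "sat I (Atom a) \<longleftrightarrow> a \<in> I"
| "sat I (BNot e) \<longleftrightarrow> \<not> sat I e"

definition rule_model :: "'a set \<Rightarrow> 'a lp_rule \<Rightarrow> bool" where
  "rule_model I r \<longleftrightarrow>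
     ((\<forall>e \<in> set (lp_body r). sat I e) \<longrightarrow> (\<exists>a \<in> set (lp_head r). a \<in> I))"

definition lp_model :: "'a lp \<Rightarrow> 'a set \<Rightarrow> bool" where
  "lp_model P I \<longleftrightarrow> I \<subseteq> fst P \<and> (\<forall>r \<in> snd P. rule_model I r)"

fun is_Atom :: "'a body_exp \<Rightarrow> bool" where
  "is_Atom (Atom a) \<longleftrightarrow> True"
| "is_Atom _ \<longleftrightarrow> False"

definition gl_reduct :: "'a lp \<Rightarrow> 'a set \<Rightarrow> 'a lp" where
  "gl_reduct P I =
     (fst P,
      {LP_Rule (lp_head r) (filter is_Atom (lp_body r)) | r.
         r \<in> snd P \<and> (\<forall>e. BNot e \<in> set (lp_body r) \<longrightarrow> sat I (BNot e))})"

definition answer_sets :: "'a lp \<Rightarrow> 'a set set" where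
  "answer_sets P = {M. lp_model P M \<and> \<not> (\<exists>M'. M' \<subset> M \<and> lp_model (gl_reduct P M) M')}"


section \<open>Epistemic logic programs\<close>

datatype 'a literal = Pos 'a | Neg 'a

text \<open>
  \<open>Lit l\<close> is an objective literal, \<open>ENot l\<close> the epistemic literal \<open>not l\<close>,
  and \<open>NegENot l\<close> its default negation.
\<close>

datatype 'a body_elem = Lit "'a literal" | ENot "'a literal" | NegENot "'a literal"

datatype (rule_atoms: 'a) elp_rule = ELP_Rule (head: "'a list") (body: "'a body_elem list")

type_synonym 'a elp = "'a set \<times> 'a elp_rule set"

definition is_elp :: "'a elp \<Rightarrow> bool" where
  "is_elp P \<longleftrightarrow> (\<forall>r \<in> snd P. rule_atoms r \<subseteq> fst P)"

definition elp_union :: "'a elp \<Rightarrow> 'a elp \<Rightarrow> 'a elp" where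
  "elp_union P Q = (fst P \<union> fst Q, snd P \<union> snd Q)"

definition is_cwi :: "'a set \<Rightarrow> 'a literal set \<Rightarrow> bool" where
  "is_cwi A I \<longleftrightarrow> I \<subseteq> Pos ` A \<union> Neg ` A \<and> \<not> (\<exists>a. Pos a \<in> I \<and> Neg a \<in> I)"

definition cwi_pos :: "'a literal set \<Rightarrow> 'a set" where
  "cwi_pos I = {a. Pos a \<in> I}"

definition cwi_neg :: "'a literal set \<Rightarrow> 'a set" where
  "cwi_neg I = {a. Neg a \<in> I}"

definition cwi_undef :: "'a set \<Rightarrow> 'a literal set \<Rightarrow> 'a set" where
  "cwi_undef A I = A - (cwi_pos I \<union> cwi_neg I)"

fun lit_exp :: "'a literal \<Rightarrow> 'a body_exp" where
  "lit_exp (Pos a) = Atom a"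
| "lit_exp (Neg a) = BNot (Atom a)"

fun reduct_elem :: "'a literal set \<Rightarrow> 'a body_elem \<Rightarrow> 'a body_exp" where
  "reduct_elem I (Lit l) = lit_exp l"
| "reduct_elem I (ENot l) = (if l \<in> I then BNot (lit_exp l) else Top)"
| "reduct_elem I (NegENot l) = BNot (if l \<in> I then BNot (lit_exp l) else Top)"

definition epistemic_reduct :: "'a elp \<Rightarrow> 'a literal set \<Rightarrow> 'a lp" where
  "epistemic_reduct P I =
     (fst P, (\<lambda>r. LP_Rule (head r) (map (reduct_elem I) (body r))) ` snd P)"

definition compatible :: "'a set \<Rightarrow> 'a literal set \<Rightarrow> 'a set set \<Rightarrow> bool" where
  "compatible A I \<I> \<longleftrightarrow>
     \<I> \<noteq> {} \<and>
     (\<forall>a \<in> cwi_pos I. \<forall>J \<in> \<I>. a \<in> J) \<and>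
     (\<forall>a \<in> cwi_neg I. \<forall>J \<in> \<I>. a \<notin> J) \<and>
     (\<forall>a \<in> cwi_undef A I. (\<exists>J \<in> \<I>. a \<in> J) \<and> (\<exists>J' \<in> \<I>. a \<notin> J'))"

definition cwvs :: "'a elp \<Rightarrow> 'a literal set set" where
  "cwvs P = {I. is_cwi (fst P) I \<and> compatible (fst P) I (answer_sets (epistemic_reduct P I))}"

definition strongly_equivalent :: "'a elp \<Rightarrow> 'a elp \<Rightarrow> bool" where
  "strongly_equivalent P1 P2 \<longleftrightarrow>
     (\<forall>P. is_elp P \<longrightarrow> cwvs (elp_union P1 P) = cwvs (elp_union P2 P))"


section \<open>Deterministic multi-tape Turing machines\<close>

datatype dir = MoveLeft | Stay | MoveRight

record machine =
  tape_count :: nat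
  states :: "nat set"
  symbols :: "nat set"
  start_state :: nat
  accept_state :: nat
  reject_state :: nat
  delta :: "nat \<Rightarrow> nat list \<Rightarrow> nat \<times> (nat \<times> dir) list"

text \<open>
  Symbol \<open>0\<close> is the blank, \<open>1\<close> and \<open>2\<close> are the bits, and \<open>3\<close> separates a word
  from a certificate. A machine may use further symbols.
\<close>

definition wf_machine :: "machine \<Rightarrow> bool" where
  "wf_machine M \<longleftrightarrow>
     tape_count M \<ge> 1 \<and> finite (states M) \<and> finite (symbols M) \<and> {0, 1, 2, 3} \<subseteq> symbols M \<and>
     {start_state M, accept_state M, reject_state M} \<subseteq> states M \<and>
     accept_state M \<noteq> reject_state M \<and>
     (\<forall>q \<in> states M. \<forall>ss. length ss = tape_count M \<and> set ss \<subseteq> symbols M \<longrightarrow>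
        fst (delta M q ss) \<in> states M \<and>
        length (snd (delta M q ss)) = tape_count M \<and>
        fst ` set (snd (delta M q ss)) \<subseteq> symbols M)"

text \<open>A tape is two-way infinite; it is paired with its head position.\<close>

type_synonym tape = "(int \<Rightarrow> nat) \<times> int"
type_synonym config = "nat \<times> tape list"

definition tape_of :: "nat list \<Rightarrow> int \<Rightarrow> nat" where
  "tape_of ss = (\<lambda>i. if 0 \<le> i \<and> i < int (length ss) then ss ! nat i else 0)"

definition init_config :: "machine \<Rightarrow> nat list \<Rightarrow> config" where
  "init_config M ss =
     (start_state M, (tape_of ss, 0) # replicate (tape_count M - 1) (\<lambda>_. 0, 0))"

fun move :: "dir \<Rightarrow> int \<Rightarrow> int" where
  "move MoveLeft h = h - 1"
| "move Stay h = h"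
| "move MoveRight h = h + 1"

fun act :: "nat \<times> dir \<Rightarrow> tape \<Rightarrow> tape" where
  "act (s, d) (t, h) = (t(h := s), move d h)"

definition halting :: "machine \<Rightarrow> nat \<Rightarrow> bool" where
  "halting M q \<longleftrightarrow> q = accept_state M \<or> q = reject_state M"

definition step :: "machine \<Rightarrow> config \<Rightarrow> config" where
  "step M c =
     (if halting M (fst c) then c
      else let (q, as) = delta M (fst c) (map (\<lambda>(t, h). t h) (snd c))
           in (q, map2 act as (snd c)))"

definition run :: "machine \<Rightarrow> nat \<Rightarrow> nat list \<Rightarrow> config" where
  "run M n ss = (step M ^^ n) (init_config M ss)"


section \<open>Polynomial time and coNP-completeness\<close>

definition pbound :: "nat \<Rightarrow> nat \<Rightarrow> nat \<Rightarrow> nat" where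
  "pbound c d n = c * n ^ d + c"

definition bit_word :: "bool list \<Rightarrow> nat list" where
  "bit_word x = map (\<lambda>b. if b then 2 else 1) x"

text \<open>
  Halting configurations are fixed points of \<^term>\<open>step M\<close>, so the configuration reached at
  the time bound is the final one. The output is the content of the last tape.
\<close>

definition polytime_function :: "(bool list \<Rightarrow> bool list) \<Rightarrow> bool" where
  "polytime_function f \<longleftrightarrow>
     (\<exists>M c d. wf_machine M \<and>
        (\<forall>x. halting M (fst (run M (pbound c d (length x)) (bit_word x))) \<and>
             fst (last (snd (run M (pbound c d (length x)) (bit_word x)))) = tape_of (bit_word (f x))))"

definition verifier_input :: "bool list \<Rightarrow> bool list \<Rightarrow> nat list" where
  "verifier_input x w = bit_word x @ [3] @ bit_word w"

definition accepts :: "machine \<Rightarrow> nat list \<Rightarrow> bool" where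
  "accepts M ss \<longleftrightarrow> (\<exists>n. fst (run M n ss) = accept_state M)"

definition NP :: "bool list set set" where
  "NP =
     {L. \<exists>V c d c' d'. wf_machine V \<and>
        (\<forall>x w. halting V (fst (run V (pbound c d (length (verifier_input x w)))
                                  (verifier_input x w)))) \<and>
        (\<forall>x. x \<in> L \<longleftrightarrow>
             (\<exists>w. length w \<le> pbound c' d' (length x) \<and> accepts V (verifier_input x w)))}"

definition coNP :: "bool list set set" where
  "coNP = {L. - L \<in> NP}"

definition polytime_reducible :: "bool list set \<Rightarrow> bool list set \<Rightarrow> bool" where
  "polytime_reducible L L' \<longleftrightarrow> (\<exists>f. polytime_function f \<and> (\<forall>x. x \<in> L \<longleftrightarrow> f x \<in> L'))"

definition coNP_complete :: "bool list set \<Rightarrow> bool" where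
  "coNP_complete L \<longleftrightarrow> L \<in> coNP \<and> (\<forall>L' \<in> coNP. polytime_reducible L' L)"


section \<open>The strong equivalence problem as a language\<close>

text \<open>
  An instance lists the atoms and the rules of each of the two finite programs. Atoms are natural
  numbers written in binary, least significant bit first; every bit is preceded by
  \<^term>\<open>True\<close>, and \<^term>\<open>False\<close> ends the number. Lists are delimited in the same way.
\<close>

type_synonym fin_elp = "nat list \<times> nat elp_rule list"

definition elp_of :: "fin_elp \<Rightarrow> nat elp" where
  "elp_of p = (set (fst p), set (snd p))"

fun enc_nat :: "nat \<Rightarrow> bool list" where
  "enc_nat n = (if n = 0 then [False] else True # odd n # enc_nat (n div 2))"

declare enc_nat.simps [simp del]

fun enc_list :: "('a \<Rightarrow> bool list) \<Rightarrow> 'a list \<Rightarrow> bool list" where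
  "enc_list f [] = [False]"
| "enc_list f (x # xs) = True # f x @ enc_list f xs"

fun enc_literal :: "nat literal \<Rightarrow> bool list" where
  "enc_literal (Pos a) = True # enc_nat a"
| "enc_literal (Neg a) = False # enc_nat a"

fun enc_body_elem :: "nat body_elem \<Rightarrow> bool list" where
  "enc_body_elem (Lit l) = False # enc_literal l"
| "enc_body_elem (ENot l) = True # False # enc_literal l"
| "enc_body_elem (NegENot l) = True # True # enc_literal l"

definition enc_rule :: "nat elp_rule \<Rightarrow> bool list" where
  "enc_rule r = enc_list enc_nat (head r) @ enc_list enc_body_elem (body r)"

definition enc_elp :: "fin_elp \<Rightarrow> bool list" where
  "enc_elp p = enc_list enc_nat (fst p) @ enc_list enc_rule (snd p)"

definition enc_instance :: "fin_elp \<times> fin_elp \<Rightarrow> bool list" where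
  "enc_instance i = enc_elp (fst i) @ enc_elp (snd i)"

definition strong_equivalence_problem :: "bool list set" where
  "strong_equivalence_problem =
     {enc_instance (p1, p2) | p1 p2.
        is_elp (elp_of p1) \<and> is_elp (elp_of p2) \<and>
        strongly_equivalent (elp_of p1) (elp_of p2)}"

text \<open>The encoding is uniquely decodable, so every word stands for at most one instance.\<close>

definition prefix_code :: "('a \<Rightarrow> bool list) \<Rightarrow> bool" where
  "prefix_code f \<longleftrightarrow> (\<forall>x y s t. f x @ s = f y @ t \<longrightarrow> x = y \<and> s = t)"

lemma prefix_codeD: "prefix_code f \<Longrightarrow> f x @ s = f y @ t \<Longrightarrow> x = y \<and> s = t"
  unfolding prefix_code_def by blast

lemma prefix_code_nat: "prefix_code enc_nat"
proof -
  have "\<forall>y s t. enc_nat x @ s = enc_nat y @ t \<longrightarrow> x = y \<and> s = t" for x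
  proof (induction x rule: less_induct)
    case (less x)
    show ?case
    proof (intro allI impI)
      fix y s t
      assume eq: "enc_nat x @ s = enc_nat y @ t"
      show "x = y \<and> s = t"
      proof (cases "x = 0 \<or> y = 0")
        case True
        with eq show ?thesis
          by (auto simp: enc_nat.simps[of x] enc_nat.simps[of y] split: if_splits)
      next
        case False
        with eq have *: "odd x = odd y" "enc_nat (x div 2) @ s = enc_nat (y div 2) @ t"
          by (simp_all add: enc_nat.simps[of x] enc_nat.simps[of y])
        have "x div 2 < x" using False by simp
        with less.IH * have "x div 2 = y div 2" "s = t" by blast+
        moreover have "x mod 2 = y mod 2" using *(1) by presburger
        ultimately show ?thesis by (metis div_mult_mod_eq)
      qed
    qed
  qed
  then show ?thesis unfolding prefix_code_def by blast
qed

lemma prefix_code_list: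
  assumes "prefix_code f"
  shows "prefix_code (enc_list f)"
proof -
  have "enc_list f xs @ s = enc_list f ys @ t \<Longrightarrow> xs = ys \<and> s = t" for xs ys s t
  proof (induction xs arbitrary: ys)
    case Nil
    then show ?case by (cases ys) auto
  next
    case (Cons x xs)
    then obtain y ys' where ys: "ys = y # ys'" by (cases ys) auto
    with Cons.prems have "f x @ (enc_list f xs @ s) = f y @ (enc_list f ys' @ t)" by simp
    with assms have "x = y" "enc_list f xs @ s = enc_list f ys' @ t"
      unfolding prefix_code_def by blast+
    with Cons.IH ys show ?case by blast
  qed
  then show ?thesis unfolding prefix_code_def by blast
qed

lemma prefix_code_literal: "prefix_code enc_literal"
  unfolding prefix_code_def
proof (intro allI impI)
  fix x y s t
  assume "enc_literal x @ s = enc_literal y @ t"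
  then show "x = y \<and> s = t"
    by (cases x; cases y) (auto dest: prefix_codeD[OF prefix_code_nat])
qed

lemma prefix_code_body_elem: "prefix_code enc_body_elem"
  unfolding prefix_code_def
proof (intro allI impI)
  fix x y s t
  assume "enc_body_elem x @ s = enc_body_elem y @ t"
  then show "x = y \<and> s = t"
    by (cases x; cases y) (auto dest: prefix_codeD[OF prefix_code_literal])
qed

lemma prefix_code_rule: "prefix_code enc_rule"
  unfolding prefix_code_def
proof (intro allI impI)
  fix x y s t
  assume "enc_rule x @ s = enc_rule y @ t"
  then have "enc_list enc_nat (head x) @ (enc_list enc_body_elem (body x) @ s) =
             enc_list enc_nat (head y) @ (enc_list enc_body_elem (body y) @ t)"
    by (simp only: enc_rule_def append_assoc)
  note 1 = prefix_codeD[OF prefix_code_list[OF prefix_code_nat] this]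
  note 2 = prefix_codeD[OF prefix_code_list[OF prefix_code_body_elem] conjunct2[OF 1]]
  from 1 2 show "x = y \<and> s = t" by (cases x; cases y) simp
qed

lemma prefix_code_elp: "prefix_code enc_elp"
  unfolding prefix_code_def
proof (intro allI impI)
  fix x y s t
  assume "enc_elp x @ s = enc_elp y @ t"
  then have "enc_list enc_nat (fst x) @ (enc_list enc_rule (snd x) @ s) =
             enc_list enc_nat (fst y) @ (enc_list enc_rule (snd y) @ t)"
    by (simp only: enc_elp_def append_assoc)
  note 1 = prefix_codeD[OF prefix_code_list[OF prefix_code_nat] this]
  note 2 = prefix_codeD[OF prefix_code_list[OF prefix_code_rule] conjunct2[OF 1]]
  from 1 2 show "x = y \<and> s = t" by (simp add: prod_eq_iff)
qed

lemma inj_enc_instance: "inj enc_instance"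
proof (rule injI)
  fix x y
  assume "enc_instance x = enc_instance y"
  then have "enc_elp (fst x) @ (enc_elp (snd x) @ []) = enc_elp (fst y) @ (enc_elp (snd y) @ [])"
    by (simp only: enc_instance_def append_Nil2)
  note 1 = prefix_codeD[OF prefix_code_elp this]
  note 2 = prefix_codeD[OF prefix_code_elp conjunct2[OF 1]]
  from 1 2 show "x = y" by (simp add: prod_eq_iff)
qed

end

theory Submission
  imports Defs "HOL-Library.Countable"
begin

text \<open>
  Over a fixed candidate world interpretation \<open>I\<close>, an epistemic program is a disjunctive program with double
  negation, and its behaviour in all contexts is given by its here-and-there models \<open>(X, Y)\<close>. Two programs over
  the same atoms fail to be strongly equivalent iff some \<open>I\<close> and some \<open>(X, Y)\<close> distinguish them while \<open>I\<close> is
  compatible with a set of classical models \<open>(J, J)\<close> that a context can turn into answer sets. One such \<open>J\<close> for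
  each way of making an atom true or false suffices, so a witness has polynomial size; it is a certificate
  for non-equivalence that a Turing machine checks by scanning the instance once per world.

  For hardness, a verifier run is expressed by Horn rules about the tableau of the run, where the certificate
  is guessed by disjunction. The resulting program is compared with an inconsistent one: they are strongly
  equivalent iff it has no classical model, i.e. iff no certificate is accepted.
\<close>

section \<open>Here-and-there models of epistemic programs\<close>

text \<open>Two obstacles shape the proof. A context cannot prescribe a candidate world
  interpretation; it can only supply answer sets that realize it. A program without realizable
  worlds has no candidate world view in any context, and two such programs are equivalent whatever
  their rules do otherwise; so a witness must carry a nonempty family of worlds. Fresh switch atoms
  let a context offer worlds independently, and the status of a switch is what finally tells the
  programs apart. Atoms declared by one program only need their own argument: a world view is silent
  about an undeclared atom, but silence about a declared atom demands an answer set that contains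
  it.

  The second obstacle is that polynomial time refers to concrete multi-tape machines. The reduction
  and the verifier are therefore written in a small loop language whose compiler and cost bound are
  proved once. This dictates data formats: tableau atoms are named by unary blocks that loops can
  print, and the finite case analysis of the verifier is done by the control of the machine.\<close>

fun belem_val :: "'a literal set \<Rightarrow> 'a set \<Rightarrow> 'a set \<Rightarrow> 'a body_elem \<Rightarrow> bool" where
  "belem_val I X Y (Lit (Pos a)) \<longleftrightarrow> a \<in> X"
| "belem_val I X Y e \<longleftrightarrow> sat Y (reduct_elem I e)"

text \<open>The first conjunct makes \<open>Y\<close> a classical model; the second makes
  \<open>X\<close> a model of what the GL-reduct by \<open>Y\<close> leaves of the rule.\<close>

definition ht_rule :: "'a literal set \<Rightarrow> 'a set \<Rightarrow> 'a set \<Rightarrow> 'a elp_rule \<Rightarrow> bool" where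
  "ht_rule I X Y r \<longleftrightarrow>
     ((\<forall>e \<in> set (body r). belem_val I Y Y e) \<longrightarrow> (\<exists>h \<in> set (head r). h \<in> Y)) \<and>
     ((\<forall>e \<in> set (body r). belem_val I X Y e) \<longrightarrow> (\<exists>h \<in> set (head r). h \<in> X))"

definition ht_model :: "'a literal set \<Rightarrow> 'a elp_rule set \<Rightarrow> 'a set \<Rightarrow> 'a set \<Rightarrow> bool" where
  "ht_model I R X Y \<longleftrightarrow> (\<forall>r \<in> R. ht_rule I X Y r)"

text \<open>These are the equilibrium models of the epistemic reduct.\<close>

definition reduct_answer_sets :: "'a set \<Rightarrow> 'a elp_rule set \<Rightarrow> 'a literal set \<Rightarrow> 'a set set" where
  "reduct_answer_sets A R I =
     {M. M \<subseteq> A \<and> ht_model I R M M \<and> \<not> (\<exists>X. X \<subset> M \<and> ht_model I R X M)}"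

lemma belem_val_same: "belem_val I Y Y e \<longleftrightarrow> sat Y (reduct_elem I e)"
  by (cases "(I, Y, Y, e)" rule: belem_val.cases) auto

text \<open>Here-and-there negation looks at \<open>Y\<close> alone. After the epistemic reduct only
  a positive objective literal stands outside every negation, so it is the only element that depends
  on \<open>X\<close>; \<open>Top\<close> matches neither conjunct and is true.\<close>

lemma belem_val_reduct:
  "belem_val I X Y e \<longleftrightarrow>
     (\<forall>e'. reduct_elem I e = BNot e' \<longrightarrow> \<not> sat Y e') \<and> (\<forall>a. reduct_elem I e = Atom a \<longrightarrow> a \<in> X)"
  by (cases "(I, X, Y, e)" rule: belem_val.cases) auto

text \<open>The GL-reduct deletes a rule exactly when one of its negated elements fails in
  \<open>M\<close>, and then the here-and-there body fails as well; dropping \<open>Top\<close> by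
  the filter does no harm.\<close>

lemma answer_sets_epistemic_reduct:
  "answer_sets (epistemic_reduct (A, R) I) = reduct_answer_sets A R I"
proof -
  let ?r = "\<lambda>r. LP_Rule (head r) (map (reduct_elem I) (body r))"
  have 1: "rule_model Y (?r r) \<longleftrightarrow>
      ((\<forall>e \<in> set (body r). belem_val I Y Y e) \<longrightarrow> (\<exists>h \<in> set (head r). h \<in> Y))" for r Y
    by (simp add: rule_model_def belem_val_same)
  have fa: "(\<forall>e \<in> set (filter is_Atom xs). sat X e) \<longleftrightarrow> (\<forall>a. Atom a \<in> set xs \<longrightarrow> a \<in> X)"
    for xs and X :: "'a set"
  proof -
    have "is_Atom e \<longleftrightarrow> (\<exists>a. e = Atom a)" for e :: "'a body_exp" by (cases e) auto
    then show ?thesis by auto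
  qed
  have 2: "((\<forall>e. BNot e \<in> set (lp_body (?r r)) \<longrightarrow> sat Y (BNot e)) \<longrightarrow>
       rule_model X (LP_Rule (lp_head (?r r)) (filter is_Atom (lp_body (?r r)))))
     \<longleftrightarrow> ((\<forall>e \<in> set (body r). belem_val I X Y e) \<longrightarrow> (\<exists>h \<in> set (head r). h \<in> X))"
    (is "?L \<longleftrightarrow> ?R") for r X Y
  proof -
    have "(\<forall>e \<in> set (body r). belem_val I X Y e) \<longleftrightarrow>
       (\<forall>e. BNot e \<in> reduct_elem I ` set (body r) \<longrightarrow> \<not> sat Y e) \<and>
       (\<forall>a. Atom a \<in> reduct_elem I ` set (body r) \<longrightarrow> a \<in> X)"
      unfolding belem_val_reduct image_iff by metis
    then show ?thesis
      unfolding rule_model_def lp_rule.sel fa set_map by auto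
  qed
  have 3: "lp_model (epistemic_reduct (A, R) I) M \<longleftrightarrow> M \<subseteq> A \<and> ht_model I R M M" for M
    unfolding lp_model_def epistemic_reduct_def ht_model_def ht_rule_def by (simp add: 1)
  have 4: "lp_model (gl_reduct (epistemic_reduct (A, R) I) M) X \<longleftrightarrow> ht_model I R X M"
    if "M \<subseteq> A" "ht_model I R M M" "X \<subset> M" for X M
  proof -
    have "lp_model (gl_reduct (epistemic_reduct (A, R) I) M) X \<longleftrightarrow>
       (\<forall>r\<in>R. (\<forall>e. BNot e \<in> set (lp_body (?r r)) \<longrightarrow> sat M (BNot e)) \<longrightarrow>
       rule_model X (LP_Rule (lp_head (?r r)) (filter is_Atom (lp_body (?r r)))))"
    proof -
      have "snd (gl_reduct (epistemic_reduct (A, R) I) M) =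
          (\<lambda>r. LP_Rule (lp_head (?r r)) (filter is_Atom (lp_body (?r r)))) `
          {r \<in> R. \<forall>e. BNot e \<in> set (lp_body (?r r)) \<longrightarrow> sat M (BNot e)}"
        unfolding gl_reduct_def epistemic_reduct_def by (auto simp only: snd_conv)
      moreover have "X \<subseteq> fst (gl_reduct (epistemic_reduct (A, R) I) M)"
        using that(1,3) by (auto simp: gl_reduct_def epistemic_reduct_def)
      ultimately show ?thesis unfolding lp_model_def by (simp del: lp_rule.sel sat.simps) blast
    qed
    also have "\<dots> \<longleftrightarrow> (\<forall>r\<in>R. (\<forall>e \<in> set (body r). belem_val I X M e) \<longrightarrow> (\<exists>h \<in> set (head r). h \<in> X))"
      by (simp only: 2)
    also have "\<dots> \<longleftrightarrow> ht_model I R X M"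
      using that(2) unfolding ht_model_def ht_rule_def by blast
    finally show ?thesis .
  qed
  have "lp_model (epistemic_reduct (A, R) I) M \<and>
      \<not> (\<exists>X. X \<subset> M \<and> lp_model (gl_reduct (epistemic_reduct (A, R) I) M) X) \<longleftrightarrow>
      M \<subseteq> A \<and> ht_model I R M M \<and> \<not> (\<exists>X. X \<subset> M \<and> ht_model I R X M)" for M
  proof (cases "M \<subseteq> A \<and> ht_model I R M M")
    case True
    then have "(\<exists>X. X \<subset> M \<and> lp_model (gl_reduct (epistemic_reduct (A, R) I) M) X) \<longleftrightarrow>
        (\<exists>X. X \<subset> M \<and> ht_model I R X M)"
      by (intro ex_cong1 conj_cong refl 4) auto
    with True 3[of M] show ?thesis by simp
  qed (use 3 in blast)
  then show ?thesis unfolding answer_sets_def reduct_answer_sets_def by simp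
qed

lemma ht_rule_cong:
  assumes "rule_atoms r \<subseteq> A"
    and I: "\<And>a. a \<in> A \<Longrightarrow> (Pos a \<in> I \<longleftrightarrow> Pos a \<in> I') \<and> (Neg a \<in> I \<longleftrightarrow> Neg a \<in> I')"
    and X: "X \<inter> A = X' \<inter> A" and Y: "Y \<inter> A = Y' \<inter> A"
  shows "ht_rule I X Y r = ht_rule I' X' Y' r"
proof -
  have X': "a \<in> X \<longleftrightarrow> a \<in> X'" and Y': "a \<in> Y \<longleftrightarrow> a \<in> Y'" if "a \<in> A" for a
    using that X Y by (metis IntD1 IntI)+
  have h: "set (head r) \<subseteq> A" and b: "e \<in> set (body r) \<Longrightarrow> set_body_elem e \<subseteq> A" for e
    using assms(1) by (cases r; auto)+
  have s: "sat Y (reduct_elem I e) = sat Y' (reduct_elem I' e)" if "set_body_elem e \<subseteq> A" for e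
  proof (cases e)
    case (Lit l) then show ?thesis using that Y' by (cases l) auto
  next
    case (ENot l) then show ?thesis using that Y' I by (cases l) auto
  next
    case (NegENot l) then show ?thesis using that Y' I by (cases l) auto
  qed
  have v: "belem_val I X Y e = belem_val I' X' Y' e" if "set_body_elem e \<subseteq> A" for e
    using that s[OF that] X' by (cases "(I, X, Y, e)" rule: belem_val.cases) auto
  have v': "belem_val I Y Y e = belem_val I' Y' Y' e" if "set_body_elem e \<subseteq> A" for e
    using s[OF that] by (simp add: belem_val_same)
  show ?thesis unfolding ht_rule_def using b v v' X' Y' subsetD[OF h]
    by (intro arg_cong2[of _ _ _ _ "(\<and>)"] arg_cong2[of _ _ _ _ "(\<longrightarrow>)"] ball_cong bex_cong refl) auto
qed

lemma ht_model_cong: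
  assumes "is_elp (A, R)"
    and "\<And>a. a \<in> A \<Longrightarrow> (Pos a \<in> I \<longleftrightarrow> Pos a \<in> I') \<and> (Neg a \<in> I \<longleftrightarrow> Neg a \<in> I')"
    and "X \<inter> A = X' \<inter> A" and "Y \<inter> A = Y' \<inter> A"
  shows "ht_model I R X Y = ht_model I' R X' Y'"
  unfolding ht_model_def using ht_rule_cong[OF _ assms(2-4)] assms(1)
  by (simp add: is_elp_def)

lemma ht_model_Un: "ht_model I (R \<union> S) X Y \<longleftrightarrow> ht_model I R X Y \<and> ht_model I S X Y"
  unfolding ht_model_def by blast

lemma ht_model_same: "ht_model I R X Y \<Longrightarrow> ht_model I R Y Y"
  unfolding ht_model_def ht_rule_def by blast

section \<open>World interpretations determined by their worlds\<close>

definition status :: "'a set \<Rightarrow> 'a set set \<Rightarrow> 'a literal set" where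
  "status A \<J> = Pos ` {a \<in> A. \<forall>J \<in> \<J>. a \<in> J} \<union> Neg ` {a \<in> A. \<forall>J \<in> \<J>. a \<notin> J}"

lemma Pos_status [simp]: "Pos a \<in> status A \<J> \<longleftrightarrow> a \<in> A \<and> (\<forall>J \<in> \<J>. a \<in> J)"
  and Neg_status [simp]: "Neg a \<in> status A \<J> \<longleftrightarrow> a \<in> A \<and> (\<forall>J \<in> \<J>. a \<notin> J)"
  unfolding status_def by auto

text \<open>A nonempty family of worlds is compatible with exactly one interpretation, so the
  interpretation never has to be guessed. Nonemptiness gives consistency: over the empty family
  \<open>status\<close> contains both literals of every atom.\<close>

lemma compatible_iff_status:
  "is_cwi A I \<and> compatible A I \<J> \<longleftrightarrow> \<J> \<noteq> {} \<and> I = status A \<J>"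
proof
  assume L: "is_cwi A I \<and> compatible A I \<J>"
  have "l \<in> I \<longleftrightarrow> l \<in> status A \<J>" for l
    using L unfolding is_cwi_def compatible_def cwi_pos_def cwi_neg_def cwi_undef_def
    by (cases l) (fastforce+)
  with L show "\<J> \<noteq> {} \<and> I = status A \<J>" unfolding compatible_def by blast
next
  assume "\<J> \<noteq> {} \<and> I = status A \<J>"
  then show "is_cwi A I \<and> compatible A I \<J>"
    unfolding is_cwi_def compatible_def cwi_pos_def cwi_neg_def cwi_undef_def
    by (auto simp: status_def)
qed

lemma cwvs_iff:
  "I \<in> cwvs (A, R) \<longleftrightarrow> reduct_answer_sets A R I \<noteq> {} \<and> I = status A (reduct_answer_sets A R I)"
  unfolding cwvs_def using compatible_iff_status
  by (auto simp: answer_sets_epistemic_reduct)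

text \<open>
  An option \<open>(X, Y)\<close> is switched on by a fresh atom \<open>v\<close>. It forces the classical part
  to be \<open>Y\<close> and leaves \<open>X\<close> as the only smaller candidate, so \<open>Y\<close> together with its switch becomes
  an answer set exactly when \<open>(X, Y)\<close> is not a here-and-there model of the context (or \<open>X = Y\<close>).
\<close>
definition option_rules :: "'a set \<Rightarrow> 'a \<Rightarrow> 'a set \<Rightarrow> 'a set \<Rightarrow> 'a elp_rule set" where
  "option_rules B v X Y =
     (\<lambda>a. ELP_Rule [a] [Lit (Pos v)]) ` X
   \<union> (\<lambda>a. ELP_Rule [] [Lit (Pos v), Lit (Pos a)]) ` (B - Y)
   \<union> (\<lambda>(b, c). ELP_Rule [b] [Lit (Pos v), Lit (Pos c)]) ` ((Y - X) \<times> (Y - X))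
   \<union> (\<lambda>c. ELP_Rule [] [Lit (Pos v), Lit (Neg c)]) ` (Y - X)"

text \<open>The disjunctive fact turns some switch on, and minimality leaves only one on, so each
  option contributes at most one answer set of its own.\<close>

definition menu_rules :: "'a set \<Rightarrow> ('a set \<times> 'a set \<Rightarrow> 'a) \<Rightarrow> ('a set \<times> 'a set) list \<Rightarrow> 'a elp_rule set" where
  "menu_rules B w os = insert (ELP_Rule (map w os) []) (\<Union>(X, Y) \<in> set os. option_rules B (w (X, Y)) X Y)"

lemma is_elp_menu_rules:
  assumes "\<And>X Y. (X, Y) \<in> set os \<Longrightarrow> X \<subseteq> Y \<and> Y \<subseteq> B"
  shows "is_elp (B \<union> w ` set os, menu_rules B w os)"
proof -
  have 1: "rule_atoms r \<subseteq> insert v B" if "r \<in> option_rules B v X Y" "X \<subseteq> Y" "Y \<subseteq> B" for r v X Y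
    using that unfolding option_rules_def by auto
  have 2: "rule_atoms r \<subseteq> B \<union> w ` set os" if "r \<in> option_rules B (w (X, Y)) X Y" "(X, Y) \<in> set os" for r X Y
  proof -
    have "insert (w (X, Y)) B \<subseteq> B \<union> w ` set os" using that by blast
    with 1[OF that(1)] assms[OF that(2)] show ?thesis by blast
  qed
  have 3: "rule_atoms (ELP_Rule (map w os) []) \<subseteq> B \<union> w ` set os" by auto
  show ?thesis unfolding is_elp_def menu_rules_def using 2 3 by fastforce
qed

text \<open>With \<open>v\<close> on, the constraints on \<open>B - Y\<close> and the negated
  members of \<open>Y - X\<close> pin \<open>V\<close> to \<open>Y\<close> on \<open>B\<close>.
  Negation is not evaluated in \<open>U\<close>, where the mutual implications within
  \<open>Y - X\<close> only say that all of \<open>Y - X\<close> is present or none of it.\<close>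

lemma ht_model_option_rules:
  assumes "X \<subseteq> Y" "Y \<subseteq> B" "U \<subseteq> V"
  shows "ht_model I (option_rules B v X Y) U V \<longleftrightarrow>
    (v \<in> V \<longrightarrow> V \<inter> B = Y) \<and> (v \<in> U \<longrightarrow> U \<inter> B = X \<or> U \<inter> B = Y)"
proof -
  have "ht_model I (option_rules B v X Y) U V \<longleftrightarrow>
     (\<forall>a\<in>X. (v \<in> V \<longrightarrow> a \<in> V) \<and> (v \<in> U \<longrightarrow> a \<in> U)) \<and>
     (\<forall>a\<in>B - Y. \<not> (v \<in> V \<and> a \<in> V) \<and> \<not> (v \<in> U \<and> a \<in> U)) \<and>
     (\<forall>b\<in>Y - X. \<forall>c\<in>Y - X. (v \<in> V \<and> c \<in> V \<longrightarrow> b \<in> V) \<and> (v \<in> U \<and> c \<in> U \<longrightarrow> b \<in> U)) \<and>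
     (\<forall>c\<in>Y - X. \<not> (v \<in> V \<and> c \<notin> V) \<and> \<not> (v \<in> U \<and> c \<notin> V))"
  proof -
    have "(\<forall>r \<in> (\<lambda>(b, c). ELP_Rule [b] [Lit (Pos v), Lit (Pos c)]) ` ((Y - X) \<times> (Y - X)). ht_rule I U V r)
       \<longleftrightarrow> (\<forall>b\<in>Y - X. \<forall>c\<in>Y - X. ht_rule I U V (ELP_Rule [b] [Lit (Pos v), Lit (Pos c)]))" by fast
    then show ?thesis unfolding ht_model_def option_rules_def ball_Un
      by (simp add: ht_rule_def)
  qed
  moreover have "(\<forall>a\<in>X. a \<in> V) \<and> (\<forall>a\<in>B - Y. a \<notin> V) \<and> (\<forall>c\<in>Y - X. c \<in> V) \<longleftrightarrow> V \<inter> B = Y"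
    using assms(1,2) by (intro iffI) (auto 0 3)
  moreover have "(\<forall>a\<in>X. a \<in> U) \<and> (\<forall>a\<in>B - Y. a \<notin> U) \<and> (\<forall>b\<in>Y - X. \<forall>c\<in>Y - X. c \<in> U \<longrightarrow> b \<in> U) \<longleftrightarrow>
      U \<inter> B = X \<or> U \<inter> B = Y" if V: "V \<inter> B = Y"
  proof -
    have UY: "U \<inter> B \<subseteq> Y" using V assms(3) by auto
    show ?thesis
    proof (cases "U \<inter> (Y - X) = {}")
      case True
      then show ?thesis using UY assms(1,2) by (intro iffI) auto
    next
      case False
      then show ?thesis using UY assms(1,2) by (intro iffI) (auto 0 4)
    qed
  qed
  moreover have "v \<in> U \<longrightarrow> v \<in> V" using assms(3) by blast
  ultimately show ?thesis by (cases "v \<in> V"; cases "v \<in> U"; cases "V \<inter> B = Y") (simp_all; blast)+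
qed

lemma ht_model_menu_rules:
  assumes os: "\<And>X Y. (X, Y) \<in> set os \<Longrightarrow> X \<subseteq> Y \<and> Y \<subseteq> B" and UV: "U \<subseteq> V"
  shows "ht_model I (menu_rules B w os) U V \<longleftrightarrow>
    (\<exists>p \<in> set os. w p \<in> U) \<and>
    (\<forall>(X, Y) \<in> set os. (w (X, Y) \<in> V \<longrightarrow> V \<inter> B = Y) \<and>
       (w (X, Y) \<in> U \<longrightarrow> U \<inter> B = X \<or> U \<inter> B = Y))"
proof -
  have 1: "ht_model I (menu_rules B w os) U V \<longleftrightarrow>
      ht_rule I U V (ELP_Rule (map w os) []) \<and>
      (\<forall>p \<in> set os. ht_model I (option_rules B (w p) (fst p) (snd p)) U V)"
    unfolding ht_model_def menu_rules_def by auto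
  have 2: "ht_rule I U V (ELP_Rule (map w os) []) \<longleftrightarrow> (\<exists>p \<in> set os. w p \<in> U)"
    using UV unfolding ht_rule_def by auto
  have 3: "ht_model I (option_rules B (w p) (fst p) (snd p)) U V \<longleftrightarrow>
      (w p \<in> V \<longrightarrow> V \<inter> B = snd p) \<and> (w p \<in> U \<longrightarrow> U \<inter> B = fst p \<or> U \<inter> B = snd p)"
    if "p \<in> set os" for p
    using os[of "fst p" "snd p"] that by (intro ht_model_option_rules UV) auto
  show ?thesis unfolding 1 2 using 3 by (simp add: split_beta)
qed

text \<open>Below \<open>insert (w (X, Y)) Y\<close> the menu admits a single smaller candidate,
  namely \<open>X\<close> with the same switch. Hence stability depends only on whether
  \<open>R\<close> accepts \<open>(X, Y)\<close>, and for \<open>X = Y\<close> there is nothing to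
  reject.\<close>

lemma reduct_answer_sets_menu:
  assumes R: "is_elp (B, R)" and os: "\<And>X Y. (X, Y) \<in> set os \<Longrightarrow> X \<subseteq> Y \<and> Y \<subseteq> B"
    and inj: "inj_on w (set os)" and fresh: "w ` set os \<inter> B = {}"
  shows "reduct_answer_sets (B \<union> w ` set os) (R \<union> menu_rules B w os) I =
     {insert (w (X, Y)) Y | X Y. (X, Y) \<in> set os \<and> ht_model I R Y Y \<and> (X = Y \<or> \<not> ht_model I R X Y)}"
    (is "?L = ?R")
proof -
  have R': "ht_model I R X Y = ht_model I R (X \<inter> B) (Y \<inter> B)" for X Y
    by (rule ht_model_cong[OF R]) auto
  have menu: "ht_model I (menu_rules B w os) U V \<longleftrightarrow>
    (\<exists>p \<in> set os. w p \<in> U) \<and>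
    (\<forall>(X, Y) \<in> set os. (w (X, Y) \<in> V \<longrightarrow> V \<inter> B = Y) \<and>
       (w (X, Y) \<in> U \<longrightarrow> U \<inter> B = X \<or> U \<inter> B = Y))" if "U \<subseteq> V" for U V
    using os that by (rule ht_model_menu_rules)
  have cap: "insert (w p) Y \<inter> B = Y" "w q \<in> insert (w p) Y \<longleftrightarrow> q = p"
    if "p \<in> set os" "q \<in> set os" "Y \<subseteq> B" for p q Y
    using that fresh inj by (auto dest: inj_onD)
  have "M \<in> ?R" if "M \<in> ?L" for M
  proof -
    from that have sub: "M \<subseteq> B \<union> w ` set os" and h: "ht_model I R M M" "ht_model I (menu_rules B w os) M M"
      and min: "\<And>X. X \<subset> M \<Longrightarrow> ht_model I R X M \<Longrightarrow> ht_model I (menu_rules B w os) X M \<Longrightarrow> False"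
      unfolding reduct_answer_sets_def ht_model_Un by blast+
    from h(2) obtain X Y where p: "(X, Y) \<in> set os" "w (X, Y) \<in> M" and MY: "M \<inter> B = Y"
      unfolding menu[OF order_refl] by fastforce
    from os[OF p(1)] have XY: "X \<subseteq> Y" "Y \<subseteq> B" by auto
    let ?N = "\<lambda>Z. insert (w (X, Y)) Z"
    have NM: "ht_model I (menu_rules B w os) (?N Z) M" if Z: "Z = X \<or> Z = Y" for Z
    proof -
      have ZY: "Z \<subseteq> B" "?N Z \<subseteq> M" using Z XY MY p(2) by auto
      have "\<forall>(X', Y') \<in> set os. (w (X', Y') \<in> M \<longrightarrow> M \<inter> B = Y') \<and>
         (w (X', Y') \<in> ?N Z \<longrightarrow> ?N Z \<inter> B = X' \<or> ?N Z \<inter> B = Y')"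
      proof (clarify, rename_tac X' Y')
        fix X' Y' assume q: "(X', Y') \<in> set os"
        have "w (X', Y') \<in> M \<longrightarrow> M \<inter> B = Y'" using h(2) q unfolding menu[OF order_refl] by blast
        moreover have "w (X', Y') \<in> ?N Z \<longrightarrow> X' = X \<and> Y' = Y" using cap(2)[OF p(1) q ZY(1)] by blast
        ultimately show "(w (X', Y') \<in> M \<longrightarrow> M \<inter> B = Y') \<and>
            (w (X', Y') \<in> ?N Z \<longrightarrow> ?N Z \<inter> B = X' \<or> ?N Z \<inter> B = Y')"
          using cap(1)[OF p(1) p(1) ZY(1)] Z by blast
      qed
      then show ?thesis unfolding menu[OF ZY(2)] using p(1) by blast
    qed
    have RN: "ht_model I R (?N Z) M = ht_model I R Z Y" if "Z = X \<or> Z = Y" for Z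
      using R'[of "?N Z" M] MY cap(1)[OF p(1) p(1), of Z] that XY by auto
    have Y: "ht_model I R Y Y" using R'[of M M] h(1) MY by simp
    \<comment> \<open>Keeping only one of the active switches still gives a here-and-there model, so
      minimality excludes any second switch.\<close>
    have "?N Y \<subseteq> M" using p(2) MY by auto
    with min[of "?N Y"] RN[of Y] Y NM[of Y] have M: "M = ?N Y" by blast
    have "X = Y \<or> \<not> ht_model I R X Y"
    proof (rule ccontr)
      assume "\<not> (X = Y \<or> \<not> ht_model I R X Y)"
      moreover from this have "?N X \<subset> M" using XY M fresh p(1) by blast
      ultimately show False using min[of "?N X"] RN[of X] NM[of X] by blast
    qed
    with M Y p(1) show ?thesis by blast
  qed
  moreover have "insert (w (X, Y)) Y \<in> ?L"
    if p: "(X, Y) \<in> set os" and Y: "ht_model I R Y Y" and XY': "X = Y \<or> \<not> ht_model I R X Y" for X Y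
  proof -
    let ?M = "insert (w (X, Y)) Y"
    from os[OF p(1)] have XY: "X \<subseteq> Y" "Y \<subseteq> B" by auto
    have "ht_model I R ?M ?M" using R'[of ?M ?M] cap(1)[OF p p XY(2)] Y by simp
    moreover have "ht_model I (menu_rules B w os) ?M ?M"
      unfolding menu[OF order_refl]
    proof (intro conjI, goal_cases)
      case 1
      show ?case using p by blast
    next
      case 2
      show ?case
      proof (clarify, rename_tac X' Y')
        fix X' Y' assume q: "(X', Y') \<in> set os"
        have "w (X', Y') \<in> ?M \<longrightarrow> X' = X \<and> Y' = Y" using cap(2)[OF p q XY(2)] by blast
        then show "(w (X', Y') \<in> ?M \<longrightarrow> ?M \<inter> B = Y') \<and>
            (w (X', Y') \<in> ?M \<longrightarrow> ?M \<inter> B = X' \<or> ?M \<inter> B = Y')"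
          using cap(1)[OF p p XY(2)] by blast
      qed
    qed
    moreover have False if U: "U \<subset> ?M" "ht_model I R U ?M" "ht_model I (menu_rules B w os) U ?M" for U
    proof -
      have U': "U \<subseteq> ?M" using U by blast
      obtain q where q: "q \<in> set os" "w q \<in> U" using U(3) unfolding menu[OF U'] by blast
      then have "q = (X, Y)" using cap(2)[OF p _ XY(2), of q] U' by blast
      with q have wU: "w (X, Y) \<in> U" by simp
      have "\<forall>(X, Y) \<in> set os. w (X, Y) \<in> U \<longrightarrow> U \<inter> B = X \<or> U \<inter> B = Y"
        using U(3) unfolding menu[OF U'] by auto
      with p wU have "U \<inter> B = X \<or> U \<inter> B = Y" by auto
      moreover have "U \<inter> B \<noteq> Y" using U(1) wU by blast
      ultimately have "U \<inter> B = X" "X \<noteq> Y" by auto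
      moreover have "ht_model I R (U \<inter> B) Y" using U(2) R'[of U ?M] cap(1)[OF p p XY(2)] by simp
      ultimately show False using XY' by blast
    qed
    ultimately show ?thesis unfolding reduct_answer_sets_def ht_model_Un using p XY(2) by blast
  qed
  ultimately show ?thesis by blast
qed

text \<open>The sets in \<J> are the worlds that realize \<open>I\<close>; as classical models of
  the first program they can be made answer sets of it by a context. The last conjunct is the
  separation: once such worlds exist, different atom sets are enough. The notion is asymmetric and
  is always used in both orders.\<close>

definition witness :: "'a elp \<Rightarrow> 'a elp \<Rightarrow> 'a set set \<Rightarrow> 'a set \<Rightarrow> 'a set \<Rightarrow> bool" where
  "witness P1 P2 \<J> X Y \<longleftrightarrow>
     (let A = fst P1 \<union> fst P2; I = status A \<J> in
       \<J> \<noteq> {} \<and> \<J> \<subseteq> Pow A \<and> X \<subseteq> Y \<and> Y \<subseteq> A \<and>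
       (\<forall>J \<in> \<J>. ht_model I (snd P1) J J) \<and> ht_model I (snd P1) X Y \<and>
       (fst P1 \<noteq> fst P2 \<or> \<not> ht_model I (snd P2) X Y \<or> (\<exists>J \<in> \<J>. \<not> ht_model I (snd P2) J J)))"

lemma witness_if_cwvs_differ:
  assumes 1: "is_elp (A1, R1)" and 2: "is_elp (A2, R2)"
    and I: "I \<in> cwvs (A1 \<union> B, R1 \<union> S)" "I \<notin> cwvs (A2 \<union> B, R2 \<union> S)"
  shows "\<exists>\<J> X Y. witness (A1, R1) (A2, R2) \<J> X Y \<or> witness (A2, R2) (A1, R1) \<J> X Y"
proof -
  define AS where "AS = reduct_answer_sets (A1 \<union> B) (R1 \<union> S) I"
  let ?Z = "A2 - (A1 \<union> B)"
  \<comment> \<open>An atom of \<open>A2\<close> that neither \<open>A1\<close> nor the context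
    declares is absent from \<open>I\<close>, so it must come out undetermined. Each answer set is
    therefore taken both without and with \<open>?Z\<close>; \<open>R1\<close> cannot see the
    difference.\<close>
  define \<J> where "\<J> = (\<lambda>J. J \<inter> (A1 \<union> A2)) ` AS \<union> (\<lambda>J. J \<inter> (A1 \<union> A2) \<union> ?Z) ` AS"
  let ?I = "status (A1 \<union> A2) \<J>"
  have ne: "AS \<noteq> {}" and Ieq: "I = status (A1 \<union> B) AS" using I(1) by (simp_all add: cwvs_iff AS_def)
  have sub: "J \<subseteq> A1 \<union> B" if "J \<in> AS" for J using that by (simp add: reduct_answer_sets_def AS_def)
  have all_J: "(\<forall>J \<in> \<J>. P J) \<longleftrightarrow> (\<forall>M \<in> AS. P (M \<inter> (A1 \<union> A2)) \<and> P (M \<inter> (A1 \<union> A2) \<union> ?Z))" for P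
    unfolding \<J>_def ball_Un ball_simps(9) by (rule ball_conj_distrib[symmetric])
  have II: "(Pos a \<in> ?I \<longleftrightarrow> Pos a \<in> I) \<and> (Neg a \<in> ?I \<longleftrightarrow> Neg a \<in> I)" if "a \<in> A1 \<union> A2" for a
  proof (cases "a \<in> ?Z")
    case True
    then have "Pos a \<notin> I" "Neg a \<notin> I" unfolding Ieq by simp_all
    moreover have "a \<notin> M" if "M \<in> AS" for M using sub[OF that] True by blast
    ultimately show ?thesis using ne True by (simp add: all_J)
  next
    case False
    with that have "a \<in> A1 \<union> B" by blast
    with that show ?thesis unfolding Ieq by (simp add: all_J)
  qed
  have J: "ht_model ?I R1 J J" if "J \<in> \<J>" for J
  proof -
    have "\<forall>J \<in> \<J>. \<exists>M \<in> AS. J \<inter> A1 = M \<inter> A1" unfolding all_J by blast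
    with that obtain M where M: "M \<in> AS" "J \<inter> A1 = M \<inter> A1" by blast
    then have "ht_model I R1 M M" unfolding AS_def reduct_answer_sets_def ht_model_Un by blast
    moreover have "ht_model ?I R1 J J = ht_model I R1 M M"
      using II M(2) by (intro ht_model_cong[OF 1]) auto
    ultimately show ?thesis by simp
  qed
  have base: "\<J> \<noteq> {}" "\<J> \<subseteq> Pow (A1 \<union> A2)" using ne unfolding \<J>_def by auto
  show ?thesis
  proof (cases "A1 = A2")
    case False
    from base obtain J0 where "J0 \<in> \<J>" by blast
    with False base J have "witness (A1, R1) (A2, R2) \<J> J0 J0"
      by (auto simp: witness_def Let_def)
    then show ?thesis by blast
  next
    case eq: True
    show ?thesis
    proof (rule ccontr)
      assume no: "\<not> ?thesis"
      have imp: "ht_model ?I R2 X Y" if "X \<subseteq> Y" "Y \<subseteq> A1 \<union> A2" "ht_model ?I R1 X Y" for X Y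
      proof (rule ccontr)
        assume "\<not> ht_model ?I R2 X Y"
        then have "witness (A1, R1) (A2, R2) \<J> X Y"
          unfolding witness_def Let_def fst_conv snd_conv using base J that by blast
        then show False using no by blast
      qed
      show False
      proof (cases "\<exists>X Y. X \<subseteq> Y \<and> Y \<subseteq> A1 \<union> A2 \<and> ht_model ?I R2 X Y \<and> \<not> ht_model ?I R1 X Y")
        case True
        then obtain X Y where XY: "X \<subseteq> Y" "Y \<subseteq> A1 \<union> A2" "ht_model ?I R2 X Y" "\<not> ht_model ?I R1 X Y" by blast
        \<comment> \<open>The inclusion already obtained makes the worlds classical models of
          \<open>R2\<close> too, so the same family serves for the reversed witness.\<close>
        moreover have "\<forall>J \<in> \<J>. ht_model ?I R2 J J" using imp J base by blast
        ultimately have "witness (A2, R2) (A1, R1) \<J> X Y"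
          unfolding witness_def Let_def fst_conv snd_conv Un_commute[of A2 A1] using base by blast
        then show False using no by blast
      next
        case False
        with imp have same: "ht_model ?I R1 X Y = ht_model ?I R2 X Y"
          if "X \<subseteq> Y" "Y \<subseteq> A1 \<union> A2" for X Y using that by blast
        \<comment> \<open>Without a witness both programs have the same here-and-there models under
          \<open>I\<close>, hence the same answer sets in this context, against the choice of
          \<open>I\<close>.\<close>
        have "ht_model I R1 X Y = ht_model I R2 X Y" if "X \<subseteq> Y" for X Y
        proof -
          have "ht_model I R1 X Y = ht_model ?I R1 (X \<inter> (A1 \<union> A2)) (Y \<inter> (A1 \<union> A2))"
            using II by (intro ht_model_cong[OF 1]) auto
          also have "\<dots> = ht_model ?I R2 (X \<inter> (A1 \<union> A2)) (Y \<inter> (A1 \<union> A2))"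
            using that by (intro same) auto
          also have "\<dots> = ht_model I R2 X Y"
            using II by (intro ht_model_cong[OF 2]) auto
          finally show ?thesis .
        qed
        then have "AS = reduct_answer_sets (A2 \<union> B) (R2 \<union> S) I"
          unfolding AS_def reduct_answer_sets_def ht_model_Un eq
          by (intro Collect_cong conj_cong arg_cong[of _ _ Not] ex_cong1 refl) auto
        with I eq show False by (simp add: cwvs_iff AS_def)
      qed
    qed
  qed
qed

text \<open>Removing \<open>Z\<close> keeps \<open>R\<close> satisfied by \<open>inv\<close>, and
  \<open>S\<close> does not mention \<open>Z\<close>, so an answer set meeting \<open>Z\<close>
  would not be minimal.\<close>

lemma reduct_answer_sets_avoid:
  assumes M: "M \<in> reduct_answer_sets A (R \<union> S) I" and S: "is_elp (B, S)" and Z: "Z \<inter> B = {}"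
    and inv: "\<And>X Y. X \<subseteq> Y \<Longrightarrow> Y \<subseteq> A \<Longrightarrow> ht_model I R X Y \<Longrightarrow> ht_model I R (X - Z) Y"
  shows "M \<inter> Z = {}"
proof (rule ccontr)
  assume "M \<inter> Z \<noteq> {}"
  then have "M - Z \<subset> M" by blast
  moreover have "ht_model I R (M - Z) M"
    using M inv[of M M] unfolding reduct_answer_sets_def ht_model_Un by blast
  moreover have "ht_model I S (M - Z) M = ht_model I S M M"
    using Z by (intro ht_model_cong[OF S]) auto
  ultimately show False using M unfolding reduct_answer_sets_def ht_model_Un by blast
qed

section \<open>Contexts that separate two programs\<close>

lemma fresh_switches:
  fixes B :: "nat set"
  assumes "finite B" "finite C"
  shows "\<exists>w :: nat set \<times> nat set \<Rightarrow> nat. inj_on w C \<and> w ` C \<inter> B = {}"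
proof -
  obtain f :: "nat set \<times> nat set \<Rightarrow> nat" where f: "inj_on f C"
    using finite_imp_inj_to_nat_seg[OF assms(2)] by auto
  have "b < Suc (Max B)" if "b \<in> B" for b using assms(1) that by (simp add: le_imp_less_Suc)
  then have "inj_on (\<lambda>p. f p + Suc (Max B)) C \<and> (\<lambda>p. f p + Suc (Max B)) ` C \<inter> B = {}"
    using f by (auto simp: inj_on_def)
  then show ?thesis by blast
qed

text \<open>Adding its own fresh switch to every world does not change the traces on
  \<open>B\<close>. The switches record which options were realized: those outside \<J> are false
  throughout, those of \<J> are not.\<close>

lemma status_menu:
  assumes w: "w ` W \<inter> B = {}" "inj_on w W" and sub: "(\<lambda>J. (J, J)) ` \<J> \<subseteq> W" "\<J> \<subseteq> Pow B" and ne: "\<J> \<noteq> {}"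
    and K: "K = status (B \<union> w ` W) ((\<lambda>J. insert (w (J, J)) J) ` \<J>)"
  shows "a \<in> B \<Longrightarrow> (Pos a \<in> K \<longleftrightarrow> Pos a \<in> status B \<J>) \<and> (Neg a \<in> K \<longleftrightarrow> Neg a \<in> status B \<J>)"
    and "p \<in> W \<Longrightarrow> p \<notin> (\<lambda>J. (J, J)) ` \<J> \<Longrightarrow> Neg (w p) \<in> K"
    and "J \<in> \<J> \<Longrightarrow> Neg (w (J, J)) \<notin> K"
proof -
  assume a: "a \<in> B"
  then have "a \<noteq> w (J, J)" if "J \<in> \<J>" for J using w(1) sub(1) that by blast
  then show "(Pos a \<in> K \<longleftrightarrow> Pos a \<in> status B \<J>) \<and> (Neg a \<in> K \<longleftrightarrow> Neg a \<in> status B \<J>)"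
    using a unfolding K by auto
next
  assume p: "p \<in> W" "p \<notin> (\<lambda>J. (J, J)) ` \<J>"
  have "w p \<notin> insert (w (J, J)) J" if "J \<in> \<J>" for J
  proof -
    have "w p \<notin> B" using p(1) w(1) by blast
    moreover have "w p \<noteq> w (J, J)" using inj_onD[OF w(2), of p "(J, J)"] p sub(1) that by blast
    ultimately show ?thesis using sub(2) that by blast
  qed
  then show "Neg (w p) \<in> K" unfolding K using p(1) by simp
next
  assume "J \<in> \<J>"
  then show "Neg (w (J, J)) \<notin> K" unfolding K by auto
qed

text \<open>The menu offers every world as the option \<open>(J, J)\<close>, and \<open>K\<close> is
  the interpretation that results when exactly these options are realized. It remains to arrange
  that precisely one of the two programs realizes exactly them.\<close>

lemma not_SE_if_pair_differs:
  fixes A1 A2 :: "nat set"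
  defines "A \<equiv> A1 \<union> A2"
  assumes fin: "finite A1" "finite A2" and 1: "is_elp (A1, R1)" and 2: "is_elp (A2, R2)"
    and ne: "\<J> \<noteq> {}" and sub: "\<J> \<subseteq> Pow A" and I: "I = status A \<J>"
    and J1: "\<And>J. J \<in> \<J> \<Longrightarrow> ht_model I R1 J J"
    and XY: "X \<subseteq> Y" "Y \<subseteq> A" "ht_model I R1 X Y" "\<not> ht_model I R2 X Y"
  shows "\<not> strongly_equivalent (A1, R1) (A2, R2)"
proof -
  have finA: "finite A" using fin by (simp add: A_def)
  have finJ: "finite \<J>" using sub finA by (simp add: finite_subset)
  have elps: "is_elp (A, R1)" "is_elp (A, R2)" using 1 2 by (auto simp: is_elp_def A_def)
  text \<open>The extra option is present in exactly one of the two families of answer sets, unless a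
    realizing set itself separates the programs; then it is left out.\<close>
  define extra where "extra = (if \<exists>J \<in> \<J>. \<not> ht_model I R2 J J then {}
    else if ht_model I R2 Y Y then {(X, Y)} else {(Y, Y)})"
  define W where "W = (\<lambda>J. (J, J)) ` \<J> \<union> extra"
  have finW: "finite W" unfolding W_def extra_def using finJ by simp
  then obtain os where os: "set os = W" using finite_list by blast
  obtain w where w: "inj_on w W" "w ` W \<inter> A = {}" using fresh_switches[OF finA finW] by blast
  have W: "X \<subseteq> Y \<and> Y \<subseteq> A" if "(X, Y) \<in> set os" for X Y
    using that sub XY(1,2) unfolding os W_def extra_def by (auto split: if_splits)
  let ?S = "menu_rules A w os"
  let ?P = "(A \<union> w ` W, ?S)"
  define K where "K = status (A \<union> w ` W) ((\<lambda>J. insert (w (J, J)) J) ` \<J>)"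
  have "(\<lambda>J. (J, J)) ` \<J> \<subseteq> W" unfolding W_def by blast
  note K = status_menu[OF w(2,1) this sub ne K_def]
  have KI: "ht_model K R X Y = ht_model I R X Y" if "is_elp (A, R)" for R X Y
    using K(1) unfolding I by (intro ht_model_cong[OF that]) auto
  define AS where "AS R = {insert (w (X, Y)) Y | X Y. (X, Y) \<in> W \<and> ht_model I R Y Y \<and> (X = Y \<or> \<not> ht_model I R X Y)}" for R
  have AS: "reduct_answer_sets (A \<union> w ` W) (R \<union> ?S) K = AS R" if "is_elp (A, R)" for R
  proof -
    have "reduct_answer_sets (A \<union> w ` set os) (R \<union> ?S) K =
       {insert (w (X, Y)) Y | X Y. (X, Y) \<in> set os \<and> ht_model K R Y Y \<and> (X = Y \<or> \<not> ht_model K R X Y)}"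
      by (rule reduct_answer_sets_menu[OF that W]) (use w os in auto)
    then show ?thesis unfolding AS_def KI[OF that] os .
  qed
  \<comment> \<open>The context declares all of \<open>A\<close>, so both unions have the same atoms
    and a difference can only come from the rules.\<close>
  have cw: "K \<in> cwvs (elp_union (Ai, R) ?P) \<longleftrightarrow> AS R \<noteq> {} \<and> K = status (A \<union> w ` W) (AS R)"
    if "is_elp (A, R)" "Ai = A1 \<or> Ai = A2" for Ai R
  proof -
    have "Ai \<union> (A \<union> w ` W) = A \<union> w ` W" using that(2) unfolding A_def by blast
    then show ?thesis unfolding elp_union_def fst_conv snd_conv cwvs_iff by (simp add: AS[OF that(1)])
  qed
  let ?J = "(\<lambda>J. insert (w (J, J)) J) ` \<J>"
  have AS_J: "AS R = ?J" if "\<forall>J \<in> \<J>. ht_model I R J J"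
    "\<And>X Y. (X, Y) \<in> extra \<Longrightarrow> \<not> (ht_model I R Y Y \<and> (X = Y \<or> \<not> ht_model I R X Y))" for R
    using that unfolding AS_def W_def by blast
  have AS_extra: "K \<noteq> status (A \<union> w ` W) (AS R)"
    if "(X, Y) \<in> extra" "ht_model I R Y Y" "X = Y \<or> \<not> ht_model I R X Y" "(X, Y) \<notin> (\<lambda>J. (J, J)) ` \<J>" for R X Y
  proof -
    have "insert (w (X, Y)) Y \<in> AS R" using that unfolding AS_def W_def by blast
    then have "Neg (w (X, Y)) \<notin> status (A \<union> w ` W) (AS R)" by auto
    moreover have "Neg (w (X, Y)) \<in> K" using K(2)[OF _ that(4)] that(1) unfolding W_def by blast
    ultimately show ?thesis by blast
  qed
  have Y1: "ht_model I R1 Y Y" using ht_model_same[OF XY(3)] .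
  have K_J: "AS R = ?J \<Longrightarrow> AS R \<noteq> {} \<and> K = status (A \<union> w ` W) (AS R)" for R
    using ne unfolding K_def by simp
  have "(AS R1 \<noteq> {} \<and> K = status (A \<union> w ` W) (AS R1)) \<noteq> (AS R2 \<noteq> {} \<and> K = status (A \<union> w ` W) (AS R2))"
  proof (cases "\<exists>J \<in> \<J>. \<not> ht_model I R2 J J")
    case True
    then obtain J where J: "J \<in> \<J>" "\<not> ht_model I R2 J J" by blast
    \<comment> \<open>\<open>R2\<close> rejects the world \<open>J\<close>, so under
      \<open>R2\<close> the switch of \<open>J\<close> is false in all answer sets, which
      \<open>K\<close> does not say.\<close>
    have ex: "extra = {}" using True by (simp add: extra_def)
    have "AS R1 = ?J" using J1 ex by (intro AS_J) auto
    moreover have "K \<noteq> status (A \<union> w ` W) (AS R2)"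
    proof -
      have "w (J, J) \<notin> M" if M: "M \<in> AS R2" for M
      proof -
        from M obtain J' where J': "J' \<in> \<J>" "M = insert (w (J', J')) J'" "ht_model I R2 J' J'"
          unfolding AS_def W_def ex by blast
        have "w (J, J) \<noteq> w (J', J')" using inj_onD[OF w(1), of "(J, J)" "(J', J')"] J J' unfolding W_def by blast
        moreover have "w (J, J) \<notin> J'" using J(1) J'(1) sub w(2) unfolding W_def by blast
        ultimately show ?thesis using J'(2) by blast
      qed
      moreover have "w (J, J) \<in> A \<union> w ` W" using J(1) unfolding W_def by blast
      ultimately have "Neg (w (J, J)) \<in> status (A \<union> w ` W) (AS R2)" by simp
      with K(3)[OF J(1)] show ?thesis by blast
    qed
    ultimately show ?thesis using K_J by blast
  next
    case False
    show ?thesis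
    proof (cases "ht_model I R2 Y Y")
      case True
      \<comment> \<open>Under \<open>R1\<close> the smaller \<open>X\<close> destroys the stability
        of \<open>Y\<close>; under \<open>R2\<close> it does not, and the extra switch becomes true
        in some answer set.\<close>
      then have ex: "extra = {(X, Y)}" using False by (simp add: extra_def)
      have "X \<noteq> Y" using True XY by blast
      then have "AS R1 = ?J" using J1 XY ex by (intro AS_J) auto
      moreover have "K \<noteq> status (A \<union> w ` W) (AS R2)"
        using True XY \<open>X \<noteq> Y\<close> ex by (intro AS_extra[of X Y]) auto
      ultimately show ?thesis using K_J by blast
    next
      case Y2: False
      \<comment> \<open>Here \<open>Y\<close> is a classical model for \<open>R1\<close> only, so
        the roles swap: \<open>K\<close> fits the second program.\<close>
      then have ex: "extra = {(Y, Y)}" using False by (simp add: extra_def)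
      have "AS R2 = ?J" using False Y2 ex by (intro AS_J) auto
      moreover have "K \<noteq> status (A \<union> w ` W) (AS R1)"
        using Y1 Y2 False ex by (intro AS_extra[of Y Y]) auto
      ultimately show ?thesis using K_J by blast
    qed
  qed
  then have "cwvs (elp_union (A1, R1) ?P) \<noteq> cwvs (elp_union (A2, R2) ?P)"
    using cw[OF elps(1), of A1] cw[OF elps(2), of A2] by blast
  moreover have "is_elp (A \<union> w ` set os, ?S)" by (rule is_elp_menu_rules[OF W])
  then have "is_elp ?P" unfolding os .
  ultimately show ?thesis unfolding strongly_equivalent_def by blast
qed

text \<open>In a context that does not declare the extra atoms, \<open>K\<close> is silent about
  them. For the second program, which declares them, silence would require an answer set containing
  \<open>a\<close>. But equivalence forces both programs to have the same here-and-there models, so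
  \<open>R2\<close> ignores the extra atoms and minimality makes them false.\<close>

lemma not_SE_if_extra_atom:
  fixes A1 A2 :: "nat set"
  defines "A \<equiv> A1 \<union> A2"
  assumes fin: "finite A1" "finite A2" and 1: "is_elp (A1, R1)" and 2: "is_elp (A2, R2)"
    and ne: "\<J> \<noteq> {}" and sub: "\<J> \<subseteq> Pow A" and I: "I = status A \<J>"
    and J1: "\<And>J. J \<in> \<J> \<Longrightarrow> ht_model I R1 J J" and a: "a \<in> A2 - A1"
  shows "\<not> strongly_equivalent (A1, R1) (A2, R2)"
proof
  assume SE: "strongly_equivalent (A1, R1) (A2, R2)"
  let ?Z = "A2 - A1"
  define \<G> where "\<G> = (\<lambda>J. J \<inter> A1) ` \<J>"
  \<comment> \<open>Copies with and without \<open>?Z\<close> leave the extra atoms undetermined, in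
    accordance with a \<open>K\<close> that does not mention them.\<close>
  define \<H> where "\<H> = \<G> \<union> (\<lambda>J. J \<union> ?Z) ` \<G>"
  let ?H = "status A \<H>"
  have subs: "\<G> \<noteq> {}" "\<G> \<subseteq> Pow A1" "\<H> \<noteq> {}" "\<H> \<subseteq> Pow A"
    using ne unfolding \<G>_def \<H>_def A_def by auto
  have all_H: "(\<forall>J \<in> \<H>. P J) \<longleftrightarrow> (\<forall>M \<in> \<G>. P M \<and> P (M \<union> ?Z))" for P
    unfolding \<H>_def ball_Un ball_simps(9) by (rule ball_conj_distrib[symmetric])
  have HI: "(Pos b \<in> ?H \<longleftrightarrow> Pos b \<in> I) \<and> (Neg b \<in> ?H \<longleftrightarrow> Neg b \<in> I)" if "b \<in> A1" for b
    using that unfolding I Pos_status Neg_status all_H \<G>_def ball_simps(9) A_def by simp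
  have H1: "ht_model ?H R1 J J" if "J \<in> \<H>" for J
  proof -
    have "\<forall>J \<in> \<H>. \<exists>M \<in> \<J>. J \<inter> A1 = M \<inter> A1" unfolding all_H unfolding \<G>_def by blast
    with that obtain M where M: "M \<in> \<J>" "J \<inter> A1 = M \<inter> A1" by blast
    have "ht_model ?H R1 J J = ht_model I R1 M M"
      using HI M(2) by (intro ht_model_cong[OF 1]) auto
    then show ?thesis using J1[OF M(1)] by simp
  qed
  have SE': "strongly_equivalent (A2, R2) (A1, R1)" using SE unfolding strongly_equivalent_def by metis
  \<comment> \<open>Assumed equivalence turns the previous lemma around: no pair separates the
    programs under \<open>?H\<close>, in either direction.\<close>
  have imp: "ht_model ?H R2 X Y" if "X \<subseteq> Y" "Y \<subseteq> A" "ht_model ?H R1 X Y" for X Y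
  proof (rule ccontr)
    assume "\<not> ht_model ?H R2 X Y"
    from not_SE_if_pair_differs[OF fin 1 2 subs(3) subs(4)[unfolded A_def] _ H1 that(1) that(2)[unfolded A_def] that(3) this]
    show False using SE by (simp add: A_def)
  qed
  have imp2: "ht_model ?H R1 X Y" if "X \<subseteq> Y" "Y \<subseteq> A" "ht_model ?H R2 X Y" for X Y
  proof (rule ccontr)
    assume n: "\<not> ht_model ?H R1 X Y"
    have A': "A = A2 \<union> A1" unfolding A_def by blast
    have "ht_model ?H R2 J J" if "J \<in> \<H>" for J using imp[of J J] H1[OF that] subs(4) that by blast
    from not_SE_if_pair_differs[OF fin(2,1) 2 1 subs(3) subs(4)[unfolded A'] _ this that(1) that(2)[unfolded A'] that(3) n]
    show False using SE' by (simp add: A')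
  qed
  define W where "W = (\<lambda>J. (J, J)) ` \<G>"
  have fins: "finite A" "finite W"
    using fin subs(2) unfolding A_def W_def by (auto intro: finite_subset)
  then obtain os where os: "set os = W" using finite_list by blast
  obtain w where w: "inj_on w W" "w ` W \<inter> A = {}" using fresh_switches[OF fins] by blast
  \<comment> \<open>The menu is built over \<open>A1\<close> only, so that this context leaves
    \<open>?Z\<close> undeclared.\<close>
  let ?S = "menu_rules A1 w os"
  let ?P = "(A1 \<union> w ` W, ?S)"
  have W: "X \<subseteq> Y \<and> Y \<subseteq> A1" if "(X, Y) \<in> set os" for X Y
    using that subs(2) unfolding os W_def by auto
  have "is_elp (A1 \<union> w ` set os, ?S)" by (rule is_elp_menu_rules[OF W])
  then have P: "is_elp ?P" unfolding os .
  let ?G = "(\<lambda>J. insert (w (J, J)) J) ` \<G>"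
  define K where "K = status (A1 \<union> w ` W) ?G"
  have wA1: "w ` W \<inter> A1 = {}" using w(2) unfolding A_def by blast
  have "(\<lambda>J. (J, J)) ` \<G> \<subseteq> W" unfolding W_def by blast
  note K = status_menu[OF wA1 w(1) this subs(2,1) K_def]
  have KI: "(Pos b \<in> K \<longleftrightarrow> Pos b \<in> ?H) \<and> (Neg b \<in> K \<longleftrightarrow> Neg b \<in> ?H)" if b: "b \<in> A" for b
  proof (cases "b \<in> A1")
    case True
    show ?thesis unfolding K(1)[OF True, THEN conjunct1] K(1)[OF True, THEN conjunct2]
      using True b unfolding Pos_status Neg_status all_H by simp
  next
    case False
    then have "b \<in> ?Z" using b unfolding A_def by blast
    then have "b \<notin> A1 \<union> w ` W" using w(2) unfolding A_def by blast
    then have "Pos b \<notin> K" "Neg b \<notin> K" unfolding K_def by auto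
    moreover have "Pos b \<notin> ?H" "Neg b \<notin> ?H"
      using subs(1,2) \<open>b \<in> ?Z\<close> unfolding Pos_status Neg_status all_H by blast+
    ultimately show ?thesis by blast
  qed
  have "reduct_answer_sets (A1 \<union> w ` W) (R1 \<union> ?S) K = ?G"
  proof -
    have "ht_model K R1 J J" if "J \<in> \<G>" for J
    proof -
      have "ht_model K R1 J J = ht_model ?H R1 J J"
        using KI by (intro ht_model_cong[OF 1]) (auto simp: A_def)
      then show ?thesis using H1[of J] that unfolding \<H>_def by blast
    qed
    moreover have "reduct_answer_sets (A1 \<union> w ` set os) (R1 \<union> ?S) K =
       {insert (w (X, Y)) Y | X Y. (X, Y) \<in> set os \<and> ht_model K R1 Y Y \<and> (X = Y \<or> \<not> ht_model K R1 X Y)}"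
      by (rule reduct_answer_sets_menu[OF 1 W]) (use w wA1 os in auto)
    ultimately show ?thesis unfolding os unfolding W_def by blast
  qed
  then have "K \<in> cwvs (elp_union (A1, R1) ?P)"
    using subs(1) unfolding elp_union_def fst_conv snd_conv cwvs_iff Un_assoc[symmetric] Un_absorb K_def by simp
  moreover have "K \<notin> cwvs (elp_union (A2, R2) ?P)"
  proof
    let ?B = "A2 \<union> (A1 \<union> w ` W)"
    let ?AS = "reduct_answer_sets ?B (R2 \<union> ?S) K"
    assume "K \<in> cwvs (elp_union (A2, R2) ?P)"
    then have Keq: "K = status ?B ?AS"
      unfolding elp_union_def fst_conv snd_conv cwvs_iff by blast
    \<comment> \<open>Deleting \<open>?Z\<close> from the smaller component can be done by passing
      from \<open>R2\<close> to \<open>R1\<close>, which does not mention \<open>?Z\<close>, and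
      back.\<close>
    have "M \<inter> ?Z = {}" if "M \<in> ?AS" for M
    proof (rule reduct_answer_sets_avoid[OF that P])
      show "?Z \<inter> (A1 \<union> w ` W) = {}" using w(2) unfolding A_def by blast
      fix X Y assume XY: "X \<subseteq> Y" "Y \<subseteq> ?B" "ht_model K R2 X Y"
      have r: "ht_model K R2 X' Y = ht_model ?H R2 (X' \<inter> A) (Y \<inter> A)" for X'
        using KI by (intro ht_model_cong[OF 2]) (auto simp: A_def)
      have "ht_model ?H R1 (X \<inter> A) (Y \<inter> A)" using XY r[of X] by (intro imp2) auto
      moreover have "ht_model ?H R1 ((X - ?Z) \<inter> A) (Y \<inter> A) = ht_model ?H R1 (X \<inter> A) (Y \<inter> A)"
        by (intro ht_model_cong[OF 1]) (auto simp: A_def)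
      ultimately have "ht_model ?H R2 ((X - ?Z) \<inter> A) (Y \<inter> A)" using XY by (intro imp) auto
      then show "ht_model K R2 (X - ?Z) Y" unfolding r .
    qed
    then have "Neg a \<in> status ?B ?AS" using a by auto
    moreover have "Neg a \<notin> K" using a w(2) unfolding K_def A_def by auto
    ultimately show False using Keq by simp
  qed
  ultimately show False using SE P unfolding strongly_equivalent_def by blast
qed

lemma not_SE_if_witness:
  fixes P1 P2 :: "nat elp"
  assumes fin: "finite (fst P1)" "finite (fst P2)" and 1: "is_elp P1" and 2: "is_elp P2"
    and w: "witness P1 P2 \<J> X Y"
  shows "\<not> strongly_equivalent P1 P2"
proof
  assume SE: "strongly_equivalent P1 P2"
  obtain A1 R1 A2 R2 where P: "P1 = (A1, R1)" "P2 = (A2, R2)" by (cases P1, cases P2) blast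
  note fin = fin[unfolded P fst_conv] and 1 = 1[unfolded P] and 2 = 2[unfolded P] and SE = SE[unfolded P]
  let ?A = "A1 \<union> A2"
  let ?I = "status ?A \<J>"
  have w: "\<J> \<noteq> {}" "\<J> \<subseteq> Pow ?A" "X \<subseteq> Y" "Y \<subseteq> ?A" "\<And>J. J \<in> \<J> \<Longrightarrow> ht_model ?I R1 J J" "ht_model ?I R1 X Y"
    and d: "A1 \<noteq> A2 \<or> \<not> ht_model ?I R2 X Y \<or> (\<exists>J \<in> \<J>. \<not> ht_model ?I R2 J J)"
    using w unfolding witness_def Let_def P fst_conv snd_conv by blast+
  have pair: "ht_model ?I R2 U V" if "U \<subseteq> V" "V \<subseteq> ?A" "ht_model ?I R1 U V" for U V
    using not_SE_if_pair_differs[OF fin 1 2 w(1,2) refl _ that] w(5) SE by blast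
  have X2: "ht_model ?I R2 X Y" using pair[OF w(3,4,6)] .
  have J2: "ht_model ?I R2 J J" if "J \<in> \<J>" for J
    using pair[of J J] w(2) w(5)[OF that] that by blast
  with d X2 have "A1 \<noteq> A2" by blast
  then consider a where "a \<in> A2 - A1" | a where "a \<in> A1 - A2" by blast
  then show False
  proof cases
    case 1
    from not_SE_if_extra_atom[OF fin \<open>is_elp (A1, R1)\<close> \<open>is_elp (A2, R2)\<close> w(1,2) refl _ this] w(5) SE
    show False by blast
  next
    case 2
    have "\<not> strongly_equivalent (A2, R2) (A1, R1)"
      using not_SE_if_extra_atom[OF fin(2,1) \<open>is_elp (A2, R2)\<close> \<open>is_elp (A1, R1)\<close> w(1) _ refl _ 2] w(2) J2
      unfolding Un_commute[of A2 A1] by blast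
    then show False using SE unfolding strongly_equivalent_def by metis
  qed
qed

text \<open>This replaces the quantifier over all contexts by a search for finite data. Finite atom
  sets of natural numbers leave room for the switches of a separating context.\<close>

theorem strongly_equivalent_iff_no_witness:
  fixes P1 P2 :: "nat elp"
  assumes fin: "finite (fst P1)" "finite (fst P2)" and 1: "is_elp P1" and 2: "is_elp P2"
  shows "\<not> strongly_equivalent P1 P2 \<longleftrightarrow> (\<exists>\<J> X Y. witness P1 P2 \<J> X Y \<or> witness P2 P1 \<J> X Y)"
proof
  assume "\<not> strongly_equivalent P1 P2"
  then obtain P I where P: "is_elp P" and "I \<in> cwvs (elp_union P1 P) \<longleftrightarrow> I \<notin> cwvs (elp_union P2 P)"
    unfolding strongly_equivalent_def by blast
  moreover obtain A1 R1 A2 R2 B S where "P1 = (A1, R1)" "P2 = (A2, R2)" "P = (B, S)"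
    by (cases P1, cases P2, cases P) blast
  ultimately show "\<exists>\<J> X Y. witness P1 P2 \<J> X Y \<or> witness P2 P1 \<J> X Y"
    using witness_if_cwvs_differ[of A1 R1 A2 R2 I B S] witness_if_cwvs_differ[of A2 R2 A1 R1 I B S] 1 2
    by (auto simp: elp_union_def)
next
  assume "\<exists>\<J> X Y. witness P1 P2 \<J> X Y \<or> witness P2 P1 \<J> X Y"
  then show "\<not> strongly_equivalent P1 P2"
    using not_SE_if_witness[OF fin 1 2] not_SE_if_witness[OF fin(2,1) 2 1]
    unfolding strongly_equivalent_def by metis
qed

section \<open>Structured programs for Turing machines\<close>

text \<open>
  The states of the compiled machine are the finitely many programs that can remain to be executed
  (as in Brzozowski derivatives of regular expressions), so no labels or jumps are needed.
\<close>

datatype mcom = MSkip | MReject | MAct nat "nat \<Rightarrow> nat" dir | MSeq mcom mcom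
  | MCase nat "nat \<Rightarrow> mcom" | MWhile nat "nat \<Rightarrow> mcom"

primrec mdelta :: "mcom \<Rightarrow> (nat \<Rightarrow> nat) \<Rightarrow> mcom \<times> (nat \<Rightarrow> nat \<times> dir)" where
  "mdelta MSkip v = (MSkip, \<lambda>i. (v i, Stay))"
| "mdelta MReject v = (MReject, \<lambda>i. (v i, Stay))"
| "mdelta (MAct r f d) v = (MSkip, (\<lambda>i. (v i, Stay))(r := (f (v r), d)))"
| "mdelta (MSeq a b) v =
     (if a = MSkip then (b, \<lambda>i. (v i, Stay)) else (MSeq (fst (mdelta a v)) b, snd (mdelta a v)))"
| "mdelta (MCase r f) v = (f (v r), \<lambda>i. (v i, Stay))"
| "mdelta (MWhile r f) v =
     (if v r = 0 then MSkip else MSeq (f (v r)) (MWhile r f), \<lambda>i. (v i, Stay))"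

definition scanned :: "(nat \<Rightarrow> tape) \<Rightarrow> nat \<Rightarrow> nat" where
  "scanned T i = fst (T i) (snd (T i))"

definition mstep :: "mcom \<times> (nat \<Rightarrow> tape) \<Rightarrow> mcom \<times> (nat \<Rightarrow> tape)" where
  "mstep C = (fst (mdelta (fst C) (scanned (snd C))),
              \<lambda>i. act (snd (mdelta (fst C) (scanned (snd C))) i) (snd C i))"

text \<open>As \<open>MSkip\<close> is a fixed point of \<open>mstep\<close>, \<open>n\<close> is an
  upper bound on the running time rather than the exact time.\<close>

definition exec :: "nat \<Rightarrow> mcom \<Rightarrow> (nat \<Rightarrow> tape) \<Rightarrow> (nat \<Rightarrow> tape) \<Rightarrow> bool" where
  "exec n c T T' \<longleftrightarrow> (mstep ^^ n) (c, T) = (MSkip, T')"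

lemma act_idle [simp]: "act (fst T (snd T), Stay) T = T"
  by (cases T) auto

lemma act_scanned [simp]: "act (scanned T i, Stay) (T i) = T i"
  by (simp add: scanned_def)

lemma mstep_final [simp]: "mstep (MSkip, T) = (MSkip, T)" "mstep (MReject, T) = (MReject, T)"
  by (simp_all add: mstep_def)

lemma funpow_mstep_final [simp]:
  "(mstep ^^ n) (MSkip, T) = (MSkip, T)" "(mstep ^^ n) (MReject, T) = (MReject, T)"
  by (induction n) simp_all

lemma exec_mono: "exec n c T T' \<Longrightarrow> n \<le> m \<Longrightarrow> exec m c T T'"
  unfolding exec_def using funpow_add[of "m - n" n mstep] by simp

lemma exec_MSkip: "exec 0 MSkip T T"
  by (simp add: exec_def)

lemma exec_MAct: "exec 1 (MAct r f d) T (T(r := act (f (scanned T r), d) (T r)))"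
  by (auto simp: exec_def mstep_def)

lemma mstep_MSeq:
  "mstep (MSeq a b, T) =
     (if a = MSkip then (b, T) else (MSeq (fst (mstep (a, T))) b, snd (mstep (a, T))))"
  by (simp add: mstep_def)

lemma exec_Suc: "exec (Suc n) c T T' \<longleftrightarrow> exec n (fst (mstep (c, T))) (snd (mstep (c, T))) T'"
  unfolding exec_def funpow_Suc_right o_def by simp

text \<open>The additional step is the handover from \<open>MSeq MSkip b\<close> to
  \<open>b\<close>.\<close>

lemma exec_MSeq: "exec n a T T1 \<Longrightarrow> exec m b T1 T2 \<Longrightarrow> exec (n + m + 1) (MSeq a b) T T2"
proof (induction n arbitrary: a T)
  case 0
  then have "a = MSkip" "T = T1" by (simp_all add: exec_def)
  with 0 show ?case by (simp add: exec_Suc mstep_MSeq)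
next
  case (Suc n)
  show ?case
  proof (cases "a = MSkip")
    case True
    with Suc.prems(1) have "T = T1" by (simp add: exec_def del: funpow.simps)
    with True Suc.prems(2) have "exec (m + 1) (MSeq a b) T T2"
      by (simp add: exec_Suc mstep_MSeq)
    then show ?thesis by (rule exec_mono) simp
  next
    case False
    with Suc show ?thesis by (simp add: exec_Suc mstep_MSeq)
  qed
qed

lemma exec_MCase: "exec n (f (scanned T r)) T T' \<Longrightarrow> exec (Suc n) (MCase r f) T T'"
  by (simp add: exec_Suc mstep_def)

lemma exec_MWhile_stop: "scanned T r = 0 \<Longrightarrow> exec 1 (MWhile r f) T T"
  by (simp add: exec_def mstep_def)

text \<open>Of the two additional steps, one unfolds the loop and one is the handover after the
  body.\<close>

lemma exec_MWhile_step:
  assumes "scanned T r \<noteq> 0" "exec n (f (scanned T r)) T T1" "exec m (MWhile r f) T1 T2"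
  shows "exec (n + m + 2) (MWhile r f) T T2"
proof -
  have "mstep (MWhile r f, T) = (MSeq (f (scanned T r)) (MWhile r f), T)"
    using assms(1) by (simp add: mstep_def)
  then show ?thesis using exec_MSeq[OF assms(2,3)] by (simp add: exec_Suc)
qed

primrec mcom_ok :: "nat \<Rightarrow> nat \<Rightarrow> mcom \<Rightarrow> bool" where
  "mcom_ok k B MSkip \<longleftrightarrow> True"
| "mcom_ok k B MReject \<longleftrightarrow> True"
| "mcom_ok k B (MAct r f d) \<longleftrightarrow> r < k \<and> (\<forall>s < B. f s < B)"
| "mcom_ok k B (MSeq a b) \<longleftrightarrow> mcom_ok k B a \<and> mcom_ok k B b"
| "mcom_ok k B (MCase r f) \<longleftrightarrow> r < k \<and> (\<forall>s < B. mcom_ok k B (f s))"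
| "mcom_ok k B (MWhile r f) \<longleftrightarrow> r < k \<and> (\<forall>s < B. 0 < s \<longrightarrow> mcom_ok k B (f s))"

text \<open>The branches are functions on all numbers, but only symbols below \<open>B\<close> are
  ever read; restricting the unions to them keeps this set of remaining programs finite.\<close>

primrec reach :: "nat \<Rightarrow> mcom \<Rightarrow> mcom set" where
  "reach B MSkip = {MSkip}"
| "reach B MReject = {MReject}"
| "reach B (MAct r f d) = {MAct r f d, MSkip}"
| "reach B (MSeq a b) = (\<lambda>a'. MSeq a' b) ` reach B a \<union> reach B b"
| "reach B (MCase r f) = insert (MCase r f) (\<Union>s<B. reach B (f s))"
| "reach B (MWhile r f) =
     insert (MWhile r f) (insert MSkip (\<Union>s\<in>{0<..<B}. (\<lambda>a. MSeq a (MWhile r f)) ` reach B (f s)))"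

lemma finite_reach: "finite (reach B c)"
  by (induction c) auto

lemma reach_refl: "c \<in> reach B c"
  by (induction c) auto

lemma mdelta_reach:
  "c \<in> reach B c0 \<Longrightarrow> mcom_ok k B c0 \<Longrightarrow> (\<And>i. i < k \<Longrightarrow> v i < B) \<Longrightarrow> fst (mdelta c v) \<in> reach B c0"
proof (induction c0 arbitrary: c)
  case (MSeq a b)
  then show ?case using reach_refl[of b B] by (auto split: if_splits)
next
  case (MCase r f)
  then have "v r < B" by simp
  from MCase.prems consider "c = MCase r f" | s where "s < B" "c \<in> reach B (f s)" by auto
  then show ?case
  proof cases
    case 1
    then show ?thesis using \<open>v r < B\<close> reach_refl[of "f (v r)" B] by auto
  next
    case 2
    then have "fst (mdelta c v) \<in> reach B (f s)"
      using MCase.IH[OF rangeI] MCase.prems by auto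
    then show ?thesis using 2 by auto
  qed
next
  case (MWhile r f)
  then have "v r < B" by simp
  from MWhile.prems consider "c = MWhile r f" | "c = MSkip"
    | s a where "0 < s" "s < B" "a \<in> reach B (f s)" "c = MSeq a (MWhile r f)" by auto
  then show ?case
  proof cases
    case 1
    then show ?thesis using \<open>v r < B\<close> reach_refl[of "f (v r)" B] by auto
  next
    case 3
    then have "fst (mdelta a v) \<in> reach B (f s)"
      using MWhile.IH[OF rangeI] MWhile.prems by auto
    then show ?thesis using 3 by auto
  qed auto
qed auto

lemma mcom_ok_mdelta:
  assumes "mcom_ok k B c" "\<And>i. i < k \<Longrightarrow> v i < B"
  shows "mcom_ok k B (fst (mdelta c v))" "i < k \<Longrightarrow> fst (snd (mdelta c v) i) < B"
  using assms by (induction c) auto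

lemma mcom_ok_reach: "c \<in> reach B c0 \<Longrightarrow> mcom_ok k B c0 \<Longrightarrow> mcom_ok k B c"
proof (induction c0 arbitrary: c)
  case (MCase r f)
  then show ?case using MCase.IH[OF rangeI] by auto
next
  case (MWhile r f)
  then show ?case using MWhile.IH[OF rangeI] by auto
qed auto

text \<open>A machine sees only its \<open>k\<close> tapes, while \<open>mdelta\<close> reads an
  infinite family; a program that is \<open>mcom_ok\<close> cannot tell the difference.\<close>

lemma mdelta_cong:
  assumes "mcom_ok k B c" "\<And>i. i < k \<Longrightarrow> v i = v' i"
  shows "fst (mdelta c v) = fst (mdelta c v')" "i < k \<Longrightarrow> snd (mdelta c v) i = snd (mdelta c v') i"
  using assms by (induction c) auto

definition initial_tapes :: "nat list \<Rightarrow> nat \<Rightarrow> tape" where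
  "initial_tapes ss = (\<lambda>_. (\<lambda>_. 0, 0))(0 := (tape_of ss, 0))"

text \<open>The states are numbers for the programs reachable from \<open>c0\<close>, with
  \<open>MSkip\<close> as accepting and \<open>MReject\<close> as rejecting state. A machine step is
  then an \<open>mstep\<close> cut down to \<open>k\<close> tapes.\<close>

lemma machine_of_mcom:
  assumes ok: "mcom_ok k B c0" and k: "k \<ge> 1" and B: "B \<ge> 4"
  shows "\<exists>M. wf_machine M \<and> (\<forall>ss n. set ss \<subseteq> {..<B} \<longrightarrow>
    (let C = (mstep ^^ n) (c0, initial_tapes ss) in
      (fst (run M n ss) = accept_state M \<longleftrightarrow> fst C = MSkip) \<and>
      (fst (run M n ss) = reject_state M \<longleftrightarrow> fst C = MReject) \<and>
      snd (run M n ss) = map (snd C) [0..<k]))"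
proof -
  define S where "S = insert MSkip (insert MReject (reach B c0))"
  have "finite S" unfolding S_def by (simp add: finite_reach)
  then obtain e :: "mcom \<Rightarrow> nat" where e: "inj_on e S"
    using finite_imp_inj_to_nat_seg[of S] by blast
  let ?dec = "inv_into S e"
  let ?v = "\<lambda>ss i. if i < k then ss ! i else (0::nat)"
  define M where "M = \<lparr>tape_count = k, states = e ` S, symbols = {..<B},
    start_state = e c0, accept_state = e MSkip, reject_state = e MReject,
    delta = (\<lambda>q ss. (e (fst (mdelta (?dec q) (?v ss))), map (snd (mdelta (?dec q) (?v ss))) [0..<k]))\<rparr>"
  have dec [simp]: "c \<in> S \<Longrightarrow> ?dec (e c) = c" for c using e by simp
  have okS: "mcom_ok k B c" if "c \<in> S" for c
    using that ok mcom_ok_reach[of c B c0 k] unfolding S_def by auto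
  have S_step: "fst (mdelta c v) \<in> S" if "c \<in> S" "\<And>i. i < k \<Longrightarrow> v i < B" for c v
    using that mdelta_reach[OF _ ok, of c v] unfolding S_def by auto
  have S: "MSkip \<in> S" "MReject \<in> S" "c0 \<in> S" unfolding S_def using reach_refl by auto
  have eq: "e c = e c' \<longleftrightarrow> c = c'" if "c \<in> S" "c' \<in> S" for c c'
    using e that by (auto dest: inj_onD)
  have "wf_machine M"
    unfolding wf_machine_def
  proof (intro conjI ballI allI impI)
    fix q ss assume "q \<in> states M" "length ss = tape_count M \<and> set ss \<subseteq> symbols M"
    then obtain c where c: "c \<in> S" "q = e c" and ss: "length ss = k" "set ss \<subseteq> {..<B}"
      by (auto simp: M_def)
    have v: "?v ss i < B" if "i < k" for i using that ss by (auto dest: nth_mem)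
    show "fst (delta M q ss) \<in> states M" using S_step[OF c(1) v] c by (simp add: M_def)
    show "length (snd (delta M q ss)) = tape_count M" by (simp add: M_def)
    show "fst ` set (snd (delta M q ss)) \<subseteq> symbols M"
      using mcom_ok_mdelta(2)[OF okS[OF c(1)] v] c by (auto simp: M_def)
  qed (use k B S \<open>finite S\<close> eq in \<open>auto simp: M_def\<close>)
  moreover
  \<comment> \<open>The bound on all tape symbols belongs to the invariant: it is what keeps the
    next program inside \<open>S\<close>.\<close>
  have inv: "fst C \<in> S \<and> (\<forall>i<k. \<forall>j. fst (snd C i) j < B) \<and> run M n ss = (e (fst C), map (snd C) [0..<k])"
    if ss: "set ss \<subseteq> {..<B}" and C: "C = (mstep ^^ n) (c0, initial_tapes ss)" for n ss C
    using C
  proof (induction n arbitrary: C)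
    case 0
    have "map (initial_tapes ss) [0..<k] = (tape_of ss, 0) # replicate (k - 1) (\<lambda>_. 0, 0)"
      using k by (intro nth_equalityI) (auto simp: initial_tapes_def nth_Cons')
    moreover have "tape_of ss j < B" for j
    proof -
      have "nat j < length ss \<Longrightarrow> ss ! nat j < B" using ss nth_mem by blast
      then show ?thesis using B by (simp add: tape_of_def nat_less_iff)
    qed
    ultimately have "init_config M ss = (e c0, map (initial_tapes ss) [0..<k])"
      "\<forall>i<k. \<forall>j. fst (initial_tapes ss i) j < B"
      using B by (simp_all add: init_config_def M_def initial_tapes_def)
    then show ?case using 0 S by (simp add: run_def)
  next
    case (Suc n)
    define C' where "C' = (mstep ^^ n) (c0, initial_tapes ss)"
    obtain c T where cT: "C' = (c, T)" by fastforce
    from Suc.IH[OF C'_def] have c: "c \<in> S" and T: "\<And>i j. i < k \<Longrightarrow> fst (T i) j < B"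
      and r: "run M n ss = (e c, map T [0..<k])" unfolding cT by auto
    have C: "C = mstep (c, T)" using Suc.prems C'_def cT by simp
    define us where "us = map (\<lambda>(t, h). t h) (map T [0..<k])"
    let ?w = "?v us"
    have v: "scanned T i < B" "?w i = scanned T i" if "i < k" for i
      using that T[OF that] by (auto simp: us_def scanned_def split_beta)
    have 1: "fst C \<in> S" unfolding C mstep_def using S_step[OF c v(1)] by simp
    have 2: "\<forall>i<k. \<forall>j. fst (snd C i) j < B"
    proof (intro allI impI)
      fix i j assume i: "i < k"
      obtain s d where sd: "snd (mdelta c (scanned T)) i = (s, d)" by fastforce
      have "s < B" using mcom_ok_mdelta(2)[OF okS[OF c], of "scanned T" i] v(1) i sd by simp
      then show "fst (snd C i) j < B" unfolding C mstep_def using T[OF i, of j] sd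
        by (cases "T i") (auto split: if_splits)
    qed
    have h: "halting M (e c) \<longleftrightarrow> c = MSkip \<or> c = MReject"
      unfolding halting_def using eq c S by (simp add: M_def)
    have 3: "step M (e c, map T [0..<k]) = (e (fst C), map (snd C) [0..<k])"
    proof (cases "c = MSkip \<or> c = MReject")
      case True
      then show ?thesis using h unfolding step_def C by auto
    next
      case False
      have cong: "fst (mdelta c ?w) = fst (mdelta c (scanned T))"
        "i < k \<Longrightarrow> snd (mdelta c ?w) i = snd (mdelta c (scanned T)) i" for i
        using mdelta_cong[OF okS[OF c], of ?w "scanned T"] v(2) by blast+
      have "delta M (e c) us =
        (e (fst (mdelta c ?w)), map (snd (mdelta c ?w)) [0..<k])"
        using c by (simp add: M_def)
      then show ?thesis using h False cong unfolding step_def C mstep_def snd_conv fst_conv us_def[symmetric]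
        by (auto intro!: nth_equalityI)
    qed
    show ?case using 1 2 3 r by (simp add: run_def)
  qed
  have "(let C = (mstep ^^ n) (c0, initial_tapes ss) in
      (fst (run M n ss) = accept_state M \<longleftrightarrow> fst C = MSkip) \<and>
      (fst (run M n ss) = reject_state M \<longleftrightarrow> fst C = MReject) \<and>
      snd (run M n ss) = map (snd C) [0..<k])" if "set ss \<subseteq> {..<B}" for ss n
    using inv[OF that refl, of n] eq S unfolding Let_def by (auto simp: M_def)
  ultimately show ?thesis by blast
qed

section \<open>Loop programs over registers\<close>

text \<open>
  A register holds a word. \<open>Case r f\<close> passes the first symbol (\<open>0\<close> if there is none) to \<open>f\<close>;
  \<open>For r f\<close> runs \<open>f s\<close> for every symbol \<open>s\<close> of the register, which \<open>f s\<close> must not touch.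
\<close>

datatype com = Skip | Push nat nat | Pop nat | Clear nat | Seq com com (infixr \<open>;;\<close> 60)
  | Case nat "nat \<Rightarrow> com" | For nat "nat \<Rightarrow> com"

type_synonym regs = "nat \<Rightarrow> nat list"

definition first :: "nat list \<Rightarrow> nat" where
  "first xs = (case xs of [] \<Rightarrow> 0 | x # _ \<Rightarrow> x)"

lemma first_simps [simp]: "first [] = 0" "first (x # xs) = x"
  by (simp_all add: first_def)

primrec ev :: "com \<Rightarrow> regs \<Rightarrow> regs" where
  "ev Skip \<sigma> = \<sigma>"
| "ev (Push r s) \<sigma> = \<sigma>(r := s # \<sigma> r)"
| "ev (Pop r) \<sigma> = \<sigma>(r := tl (\<sigma> r))"
| "ev (Clear r) \<sigma> = \<sigma>(r := [])"
| "ev (a ;; b) \<sigma> = ev b (ev a \<sigma>)"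
| "ev (Case r f) \<sigma> = ev (f (first (\<sigma> r))) \<sigma>"
| "ev (For r f) \<sigma> = fold (\<lambda>s. ev (f s)) (\<sigma> r) \<sigma>"

fun fold_cost :: "(nat \<Rightarrow> regs \<Rightarrow> regs) \<Rightarrow> (nat \<Rightarrow> regs \<Rightarrow> nat) \<Rightarrow> nat list \<Rightarrow> regs \<Rightarrow> nat" where
  "fold_cost e g [] \<sigma> = 0"
| "fold_cost e g (s # xs) \<sigma> = g s \<sigma> + fold_cost e g xs (e s \<sigma>)"

text \<open>A push is two moves and a handover, and clearing takes 3 steps per symbol. A loop spends
  4 steps per symbol besides its body (move, handover, unfolding, handover) and 3 per symbol on
  rewinding; the final 7 collects the two exit tests, two moves and three handovers.\<close>

primrec cost :: "com \<Rightarrow> regs \<Rightarrow> nat" where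
  "cost Skip \<sigma> = 0"
| "cost (Push r s) \<sigma> = 3"
| "cost (Pop r) \<sigma> = 1"
| "cost (Clear r) \<sigma> = 3 * length (\<sigma> r) + 1"
| "cost (a ;; b) \<sigma> = cost a \<sigma> + cost b (ev a \<sigma>) + 1"
| "cost (Case r f) \<sigma> = Suc (cost (f (first (\<sigma> r))) \<sigma>)"
| "cost (For r f) \<sigma> =
     fold_cost (\<lambda>s. ev (f s)) (\<lambda>s. cost (f s)) (\<sigma> r) \<sigma> + 7 * length (\<sigma> r) + 7"

text \<open>Register \<open>out\<close> is the output tape; it is write-only and grows to the right.\<close>
primrec compile :: "nat \<Rightarrow> com \<Rightarrow> mcom" where
  "compile out Skip = MSkip"
| "compile out (Push r s) =
     (if r = out then MAct r (\<lambda>_. s) MoveRight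
      else MSeq (MAct r (\<lambda>x. x) MoveLeft) (MAct r (\<lambda>_. s) Stay))"
| "compile out (Pop r) = MAct r (\<lambda>_. 0) MoveRight"
| "compile out (Clear r) = MWhile r (\<lambda>_. MAct r (\<lambda>_. 0) MoveRight)"
| "compile out (a ;; b) = MSeq (compile out a) (compile out b)"
| "compile out (Case r f) = MCase r (\<lambda>s. compile out (f s))"
| "compile out (For r f) =
     MSeq (MWhile r (\<lambda>s. MSeq (compile out (f s)) (MAct r (\<lambda>x. x) MoveRight)))
       (MSeq (MAct r (\<lambda>x. x) MoveLeft)
         (MSeq (MWhile r (\<lambda>_. MAct r (\<lambda>x. x) MoveLeft)) (MAct r (\<lambda>x. x) MoveRight)))"

text \<open>\<open>F\<close> is the set of registers of the enclosing loops.\<close>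
primrec wf_com :: "nat \<Rightarrow> nat \<Rightarrow> nat \<Rightarrow> nat set \<Rightarrow> com \<Rightarrow> bool" where
  "wf_com k B out F Skip \<longleftrightarrow> True"
| "wf_com k B out F (Push r s) \<longleftrightarrow> r < k \<and> r \<notin> F \<and> 0 < s \<and> s < B"
| "wf_com k B out F (Pop r) \<longleftrightarrow> r < k \<and> r \<notin> F \<and> r \<noteq> out"
| "wf_com k B out F (Clear r) \<longleftrightarrow> r < k \<and> r \<notin> F \<and> r \<noteq> out"
| "wf_com k B out F (a ;; b) \<longleftrightarrow> wf_com k B out F a \<and> wf_com k B out F b"
| "wf_com k B out F (Case r f) \<longleftrightarrow> r < k \<and> r \<notin> F \<and> r \<noteq> out \<and> (\<forall>s<B. wf_com k B out F (f s))"
| "wf_com k B out F (For r f) \<longleftrightarrow> r < k \<and> r \<notin> F \<and> r \<noteq> out \<and>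
     (\<forall>s<B. 0 < s \<longrightarrow> wf_com k B out (insert r F) (f s))"

text \<open>The blank 0 is excluded because it marks the end of a register on its tape.\<close>

definition regs_ok :: "nat \<Rightarrow> regs \<Rightarrow> bool" where
  "regs_ok B \<sigma> \<longleftrightarrow> (\<forall>r. set (\<sigma> r) \<subseteq> {0<..<B})"

lemma regs_okD: "regs_ok B \<sigma> \<Longrightarrow> s \<in> set (\<sigma> r) \<Longrightarrow> 0 < s \<and> s < B"
  unfolding regs_ok_def by fastforce

lemma first_less: "regs_ok B \<sigma> \<Longrightarrow> 0 < B \<Longrightarrow> first (\<sigma> r) < B"
  using regs_okD[of B \<sigma> "first (\<sigma> r)" r] by (cases "\<sigma> r") auto

lemma fold_inv:
  assumes "P \<sigma>" "\<And>s \<sigma>. s \<in> set xs \<Longrightarrow> P \<sigma> \<Longrightarrow> P (e s \<sigma>)"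
  shows "P (fold e xs \<sigma>)"
  using assms by (induction xs arbitrary: \<sigma>) auto

lemma ev_regs_ok:
  "wf_com k B out F c \<Longrightarrow> 0 < B \<Longrightarrow> regs_ok B \<sigma> \<Longrightarrow> regs_ok B (ev c \<sigma>)"
proof (induction c arbitrary: F \<sigma>)
  case (Push r s)
  then show ?case by (auto simp: regs_ok_def)
next
  case (Pop r)
  then have "set (\<sigma> r) \<subseteq> {0<..<B}" by (simp add: regs_ok_def)
  then have "set (tl (\<sigma> r)) \<subseteq> {0<..<B}" by (cases "\<sigma> r") auto
  with Pop show ?case by (auto simp: regs_ok_def)
next
  case (Clear r)
  then show ?case by (auto simp: regs_ok_def)
next
  case (Seq a b)
  then show ?case by auto
next
  case (Case r f)
  then show ?case using first_less[of B \<sigma> r] by auto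
next
  case (For r f)
  have "regs_ok B (fold (\<lambda>s. ev (f s)) (\<sigma> r) \<sigma>)"
  proof (rule fold_inv[where P = "regs_ok B"])
    fix s \<tau> assume "s \<in> set (\<sigma> r)" "regs_ok B \<tau>"
    moreover from this have "0 < s \<and> s < B" using For.prems(3) regs_okD by blast
    ultimately show "regs_ok B (ev (f s) \<tau>)"
      using For.IH[OF rangeI _ For.prems(2)] For.prems(1) by auto
  qed (use For in simp)
  then show ?case by simp
qed simp

lemma ev_frame: "wf_com k B out F c \<Longrightarrow> 0 < B \<Longrightarrow> regs_ok B \<sigma> \<Longrightarrow> r \<in> F \<Longrightarrow> ev c \<sigma> r = \<sigma> r"
proof (induction c arbitrary: F \<sigma>)
  case (Seq a b)
  then show ?case using ev_regs_ok[of k B out F a \<sigma>] by auto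
next
  case (Case q f)
  then show ?case using first_less[of B \<sigma> q] by auto
next
  case (For q f)
  have "fold (\<lambda>s. ev (f s)) (\<sigma> q) \<sigma> r = \<sigma> r \<and> regs_ok B (fold (\<lambda>s. ev (f s)) (\<sigma> q) \<sigma>)"
  proof (rule fold_inv[where P = "\<lambda>\<tau>. \<tau> r = \<sigma> r \<and> regs_ok B \<tau>"])
    fix s \<tau> assume *: "s \<in> set (\<sigma> q)" "\<tau> r = \<sigma> r \<and> regs_ok B \<tau>"
    then have "0 < s \<and> s < B" using For.prems(3) regs_okD by blast
    then have wf: "wf_com k B out (insert q F) (f s)" using For.prems(1) by simp
    have "ev (f s) \<tau> r = \<tau> r" using For.IH[OF rangeI wf For.prems(2)] * For.prems(4) by blast
    then show "ev (f s) \<tau> r = \<sigma> r \<and> regs_ok B (ev (f s) \<tau>)"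
      using * ev_regs_ok[OF wf For.prems(2)] by auto
  qed (use For in simp)
  then show ?case by simp
qed auto

lemma ev_frame_For:
  assumes "wf_com k B out F (For r f)" "0 < B" "regs_ok B \<sigma>"
  shows "ev (For r f) \<sigma> r = \<sigma> r"
proof -
  have "fold (\<lambda>s. ev (f s)) (\<sigma> r) \<sigma> r = \<sigma> r \<and> regs_ok B (fold (\<lambda>s. ev (f s)) (\<sigma> r) \<sigma>)"
  proof (rule fold_inv[where P = "\<lambda>\<tau>. \<tau> r = \<sigma> r \<and> regs_ok B \<tau>"])
    fix s \<tau> assume *: "s \<in> set (\<sigma> r)" "\<tau> r = \<sigma> r \<and> regs_ok B \<tau>"
    then have "0 < s \<and> s < B" using assms(3) regs_okD by blast
    then have "wf_com k B out (insert r F) (f s)" using assms(1) by simp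
    then show "ev (f s) \<tau> r = \<sigma> r \<and> regs_ok B (ev (f s) \<tau>)"
      using ev_frame[of k B out "insert r F" "f s" \<tau> r] ev_regs_ok[of k B out "insert r F" "f s" \<tau>] * assms(2) by auto
  qed (use assms in simp)
  then show ?thesis by simp
qed

lemma mcom_ok_compile: "wf_com k B out F c \<Longrightarrow> 0 < B \<Longrightarrow> mcom_ok k B (compile out c)"
proof (induction c arbitrary: F)
  case (Case r f)
  then show ?case using Case.IH[OF rangeI] by auto
next
  case (For r f)
  then have "mcom_ok k B (compile out (f s))" if "s < B" "s > 0" for s
    using For.IH[OF rangeI] that by auto
  with For.prems show ?case by simp
qed auto

text \<open>The head is on the first symbol and all cells outside the word are blank, which is why
  popping and clearing erase. The output tape has its head behind the last symbol, so pushing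
  appends there and the register is the reverse of the tape.\<close>

definition repr :: "nat \<Rightarrow> nat \<Rightarrow> nat list \<Rightarrow> tape \<Rightarrow> bool" where
  "repr out r xs t \<longleftrightarrow>
     (if r = out then t = (tape_of (rev xs), int (length xs))
      else fst t = (\<lambda>j. tape_of xs (j - snd t)))"

lemma tape_of_Cons: "tape_of (x # xs) j = (if j = 0 then x else tape_of xs (j - 1))"
  by (auto simp: tape_of_def nth_Cons nat_diff_distrib split: nat.splits)

lemma tape_of_append1: "tape_of (xs @ [x]) = (tape_of xs)(int (length xs) := x)"
  by (rule ext) (auto simp: tape_of_def nth_append)

lemma tape_of_0: "tape_of xs 0 = first xs"
  by (cases xs) (auto simp: tape_of_def)

lemma tape_of_neg: "j < 0 \<Longrightarrow> tape_of xs j = 0"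
  by (simp add: tape_of_def)

lemma repr_scanned: "repr out r (\<sigma> r) (T r) \<Longrightarrow> r \<noteq> out \<Longrightarrow> scanned T r = first (\<sigma> r)"
  by (simp add: repr_def scanned_def tape_of_0)

lemma repr_tl:
  assumes "repr out r xs t" "r \<noteq> out"
  shows "repr out r (tl xs) (act (0, MoveRight) t)"
proof -
  obtain a b where t: "t = (a, b)" by fastforce
  have a: "a = (\<lambda>j. tape_of xs (j - b))" using assms t by (simp add: repr_def)
  have "(if j = h then 0 else tape_of xs (j - h)) = tape_of (tl xs) (j - (h + 1))" for j h
    by (cases xs) (auto simp: tape_of_Cons algebra_simps, auto simp: tape_of_def)
  from this[of _ b] show ?thesis using assms(2) unfolding repr_def t a by (simp add: fun_upd_def)
qed

lemma repr_Cons: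
  "repr out r xs t \<Longrightarrow> r \<noteq> out \<Longrightarrow> repr out r (s # xs) (act (s, Stay) (act (x, MoveLeft) t))"
  if "x = fst t (snd t)"
proof -
  assume "repr out r xs t" "r \<noteq> out"
  then show ?thesis using that by (cases t) (auto simp: repr_def fun_eq_iff tape_of_Cons algebra_simps)
qed

lemma exec_clear:
  "repr out r xs (T r) \<Longrightarrow> r \<noteq> out \<Longrightarrow> 0 \<notin> set xs \<Longrightarrow>
   \<exists>t. exec (3 * length xs + 1) (MWhile r (\<lambda>_. MAct r (\<lambda>_. 0) MoveRight)) T (T(r := t)) \<and> repr out r [] t"
proof (induction xs arbitrary: T)
  case Nil
  then have "scanned T r = 0" by (simp add: repr_def scanned_def tape_of_def)
  then show ?case using exec_MWhile_stop[of T r] Nil by (intro exI[of _ "T r"]) auto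
next
  case (Cons x xs)
  let ?T = "T(r := act (0, MoveRight) (T r))"
  have "scanned T r = x" using Cons.prems by (simp add: repr_def scanned_def tape_of_0)
  moreover have "repr out r xs (?T r)" using repr_tl[OF Cons.prems(1,2)] by simp
  then obtain t where "exec (3 * length xs + 1) (MWhile r (\<lambda>_. MAct r (\<lambda>_. 0) MoveRight)) ?T (?T(r := t))"
    and t: "repr out r [] t" using Cons by fastforce
  moreover have "exec 1 (MAct r (\<lambda>_. 0) MoveRight) T ?T" using exec_MAct[of r "\<lambda>_. 0" MoveRight T] by simp
  ultimately have "exec (1 + (3 * length xs + 1) + 2) (MWhile r (\<lambda>_. MAct r (\<lambda>_. 0) MoveRight)) T (?T(r := t))"
    using Cons.prems(3) by (intro exec_MWhile_step) auto
  then have "exec (3 * length (x # xs) + 1) (MWhile r (\<lambda>_. MAct r (\<lambda>_. 0) MoveRight)) T (?T(r := t))"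
    by (rule exec_mono) simp
  then show ?case using t unfolding fun_upd_upd by blast
qed

lemma exec_move: "exec 1 (MAct r (\<lambda>x. x) d) T (T(r := (fst (T r), move d (snd (T r)))))"
  using exec_MAct[of r "\<lambda>x. x" d T] by (cases "T r") (simp add: scanned_def)

text \<open>The scan to the left stops at the blank just before the word, at position
  \<open>h - 1\<close>.\<close>

lemma exec_rewind:
  assumes "t = (\<lambda>j. tape_of xs (j - h))" "0 \<notin> set xs"
  shows "n \<le> length xs \<Longrightarrow> T r = (t, h + int n - 1) \<Longrightarrow>
    exec (3 * n + 1) (MWhile r (\<lambda>_. MAct r (\<lambda>x. x) MoveLeft)) T (T(r := (t, h - 1)))"
proof (induction n arbitrary: T)
  case 0
  then have "scanned T r = 0" "T(r := (t, h - 1)) = T" using assms by (auto simp: scanned_def tape_of_neg)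
  then show ?case using exec_MWhile_stop[of T r] by simp
next
  case (Suc n)
  let ?T = "T(r := (t, h + int n - 1))"
  have "scanned T r = xs ! n" using Suc.prems assms(1) by (simp add: scanned_def tape_of_def)
  then have ne: "scanned T r \<noteq> 0" using assms(2) Suc.prems(1) by (metis Suc_le_lessD nth_mem)
  have "exec 1 (MAct r (\<lambda>x. x) MoveLeft) T ?T"
    using exec_move[of r MoveLeft T] Suc.prems(2) by simp
  moreover have "exec (3 * n + 1) (MWhile r (\<lambda>_. MAct r (\<lambda>x. x) MoveLeft)) ?T (?T(r := (t, h - 1)))"
    using Suc.prems(1) by (intro Suc.IH) auto
  ultimately have "exec (1 + (3 * n + 1) + 2) (MWhile r (\<lambda>_. MAct r (\<lambda>x. x) MoveLeft)) T (?T(r := (t, h - 1)))"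
    using ne by (intro exec_MWhile_step) auto
  then have "exec (3 * Suc n + 1) (MWhile r (\<lambda>_. MAct r (\<lambda>x. x) MoveLeft)) T (?T(r := (t, h - 1)))"
    by (rule exec_mono) simp
  then show ?case unfolding fun_upd_upd .
qed

text \<open>Registers in \<open>F\<close> are exempt from \<open>repr\<close> because running loops
  have displaced their heads; instead their tapes must come back unchanged.\<close>

theorem exec_compile:
  "wf_com k B out F c \<Longrightarrow> 0 < B \<Longrightarrow> regs_ok B \<sigma> \<Longrightarrow> (\<And>r. r \<notin> F \<Longrightarrow> repr out r (\<sigma> r) (T r)) \<Longrightarrow>
   \<exists>T'. exec (cost c \<sigma>) (compile out c) T T' \<and> (\<forall>r. r \<notin> F \<longrightarrow> repr out r (ev c \<sigma> r) (T' r)) \<and>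
        (\<forall>r \<in> F. T' r = T r)"
proof (induction c arbitrary: F \<sigma> T)
  case Skip
  then show ?case using exec_MSkip[of T] by (intro exI[of _ T]) auto
next
  case (Push r s)
  then have r: "r \<notin> F" "repr out r (\<sigma> r) (T r)" by auto
  show ?case
  proof (cases "r = out")
    case True
    let ?T = "T(r := act (s, MoveRight) (T r))"
    have "repr out r (s # \<sigma> r) (?T r)" using r(2) True by (simp add: repr_def tape_of_append1)
    moreover have "exec 1 (MAct r (\<lambda>_. s) MoveRight) T ?T" using exec_MAct[of r "\<lambda>_. s" MoveRight T] by simp
    then have "exec 3 (MAct r (\<lambda>_. s) MoveRight) T ?T" by (rule exec_mono) simp
    then have "exec (cost (Push r s) \<sigma>) (compile out (Push r s)) T ?T"
      unfolding compile.simps cost.simps if_P[OF True] .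
    moreover have "\<forall>q. q \<notin> F \<longrightarrow> repr out q (ev (Push r s) \<sigma> q) (?T q)" "\<forall>q\<in>F. ?T q = T q"
      using Push.prems(4) r(1) calculation(1) by auto
    ultimately show ?thesis by blast
  next
    case False
    let ?T1 = "T(r := (fst (T r), snd (T r) - 1))"
    let ?T = "?T1(r := act (s, Stay) (?T1 r))"
    have "exec 1 (MAct r (\<lambda>x. x) MoveLeft) T ?T1" using exec_move[of r MoveLeft T] by simp
    moreover have "exec 1 (MAct r (\<lambda>_. s) Stay) ?T1 ?T" using exec_MAct[of r "\<lambda>_. s" Stay ?T1] by simp
    ultimately have "exec (1 + 1 + 1) (MSeq (MAct r (\<lambda>x. x) MoveLeft) (MAct r (\<lambda>_. s) Stay)) T ?T"
      by (rule exec_MSeq)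
    moreover have "repr out r (s # \<sigma> r) (?T r)"
      using repr_Cons[OF refl r(2) False, of s] by (cases "T r") simp
    moreover have "exec (cost (Push r s) \<sigma>) (compile out (Push r s)) T ?T"
      using calculation(1) unfolding compile.simps cost.simps if_not_P[OF False] by (rule exec_mono) simp
    moreover have "\<forall>q. q \<notin> F \<longrightarrow> repr out q (ev (Push r s) \<sigma> q) (?T q)" "\<forall>q\<in>F. ?T q = T q"
      using Push.prems(4) r(1) calculation(2) by auto
    ultimately show ?thesis by blast
  qed
next
  case (Pop r)
  let ?T = "T(r := act (0, MoveRight) (T r))"
  have "exec 1 (MAct r (\<lambda>_. 0) MoveRight) T ?T" using exec_MAct[of r "\<lambda>_. 0" MoveRight T] by simp
  moreover have "repr out r (tl (\<sigma> r)) (?T r)" using repr_tl[of out r "\<sigma> r" "T r"] Pop by simp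
  then have "\<forall>q. q \<notin> F \<longrightarrow> repr out q (ev (Pop r) \<sigma> q) (?T q)" "\<forall>q\<in>F. ?T q = T q"
    using Pop.prems by auto
  ultimately show ?case unfolding cost.simps compile.simps by blast
next
  case (Clear r)
  have "0 \<notin> set (\<sigma> r)" using regs_okD[OF Clear.prems(3)] by blast
  then obtain t where "exec (3 * length (\<sigma> r) + 1) (MWhile r (\<lambda>_. MAct r (\<lambda>_. 0) MoveRight)) T (T(r := t))"
    "repr out r [] t" using exec_clear[of out r "\<sigma> r" T] Clear by auto
  moreover from this(2) have "\<forall>q. q \<notin> F \<longrightarrow> repr out q (ev (Clear r) \<sigma> q) ((T(r := t)) q)"
    "\<forall>q\<in>F. (T(r := t)) q = T q" using Clear.prems by auto
  ultimately show ?case unfolding cost.simps compile.simps by blast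
next
  case (Seq a b)
  from Seq.prems(1) have wf: "wf_com k B out F a" "wf_com k B out F b" by auto
  from Seq.IH(1)[OF wf(1) Seq.prems(2-4)] obtain T1 where 1: "exec (cost a \<sigma>) (compile out a) T T1"
    "\<And>r. r \<notin> F \<Longrightarrow> repr out r (ev a \<sigma> r) (T1 r)" "\<And>r. r \<in> F \<Longrightarrow> T1 r = T r" by blast
  from Seq.IH(2)[OF wf(2) Seq.prems(2) ev_regs_ok[OF wf(1) Seq.prems(2,3)] 1(2)] obtain T2 where
    2: "exec (cost b (ev a \<sigma>)) (compile out b) T1 T2"
    "\<And>r. r \<notin> F \<Longrightarrow> repr out r (ev b (ev a \<sigma>) r) (T2 r)" "\<And>r. r \<in> F \<Longrightarrow> T2 r = T1 r" by blast
  show ?case using exec_MSeq[OF 1(1) 2(1)] 1(3) 2(2,3) by (intro exI[of _ T2]) auto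
next
  case (Case r f)
  have s: "scanned T r = first (\<sigma> r)" using Case.prems repr_scanned[of out r \<sigma> T] by auto
  have wf: "wf_com k B out F (f (first (\<sigma> r)))" using Case.prems first_less[of B \<sigma> r] by auto
  from Case.IH[OF rangeI wf Case.prems(2-4)] obtain T1 where
    "exec (cost (f (first (\<sigma> r))) \<sigma>) (compile out (f (first (\<sigma> r)))) T T1"
    "\<forall>q. q \<notin> F \<longrightarrow> repr out q (ev (f (first (\<sigma> r))) \<sigma> q) (T1 q)" "\<forall>q \<in> F. T1 q = T q" by blast
  then show ?case using exec_MCase[of _ "\<lambda>s. compile out (f s)" T r T1] by (intro exI[of _ T1]) (auto simp: s)
next
  case (For r f)
  obtain t h where Tr: "T r = (t, h)" by fastforce
  let ?xs = "\<sigma> r"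
  have t: "t = (\<lambda>j. tape_of ?xs (j - h))" using For.prems(1) For.prems(4)[of r] Tr by (auto simp: repr_def)
  have nz: "0 \<notin> set ?xs" using regs_okD[OF For.prems(3)] by blast
  let ?W = "MWhile r (\<lambda>s. MSeq (compile out (f s)) (MAct r (\<lambda>x. x) MoveRight))"
  \<comment> \<open>Invariant of the forward pass: \<open>pre\<close> has been processed and the
    head of \<open>r\<close> stands right behind it.\<close>
  have loop: "\<exists>T'. exec (fold_cost (\<lambda>s. ev (f s)) (\<lambda>s. cost (f s)) ys \<tau> + 4 * length ys + 1) ?W U T' \<and>
      (\<forall>q. q \<notin> insert r F \<longrightarrow> repr out q (fold (\<lambda>s. ev (f s)) ys \<tau> q) (T' q)) \<and>
      (\<forall>q \<in> F. T' q = U q) \<and> T' r = (t, h + int (length ?xs))"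
    if "?xs = pre @ ys" "regs_ok B \<tau>" "U r = (t, h + int (length pre))"
      "\<And>q. q \<notin> insert r F \<Longrightarrow> repr out q (\<tau> q) (U q)" for pre ys \<tau> U
    using that
  proof (induction ys arbitrary: pre \<tau> U)
    case Nil
    then have "scanned U r = 0" by (simp add: scanned_def t tape_of_def)
    with Nil show ?case using exec_MWhile_stop[of U r] by (intro exI[of _ U]) auto
  next
    case (Cons s ys)
    have sc: "scanned U r = s" using Cons.prems(1,3) by (simp add: scanned_def t tape_of_def)
    have "s \<in> set ?xs" using Cons.prems(1) by simp
    then have s: "0 < s" "s < B" using regs_okD[OF For.prems(3)] by auto
    then have wf: "wf_com k B out (insert r F) (f s)" using For.prems(1) by simp
    from For.IH[OF rangeI wf For.prems(2) Cons.prems(2,4)] obtain T1 where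
      1: "exec (cost (f s) \<tau>) (compile out (f s)) U T1"
      "\<And>q. q \<notin> insert r F \<Longrightarrow> repr out q (ev (f s) \<tau> q) (T1 q)"
      "\<And>q. q \<in> insert r F \<Longrightarrow> T1 q = U q" by blast
    let ?T2 = "T1(r := (t, h + int (length (pre @ [s]))))"
    have "exec 1 (MAct r (\<lambda>x. x) MoveRight) T1 ?T2"
      using exec_move[of r MoveRight T1] 1(3)[of r] Cons.prems(3) by (simp add: algebra_simps)
    from exec_MSeq[OF 1(1) this] have 2: "exec (cost (f s) \<tau> + 2)
      (MSeq (compile out (f (scanned U r))) (MAct r (\<lambda>x. x) MoveRight)) U ?T2" by (simp add: sc)
    have "\<exists>T'. exec (fold_cost (\<lambda>s. ev (f s)) (\<lambda>s. cost (f s)) ys (ev (f s) \<tau>) + 4 * length ys + 1) ?W ?T2 T' \<and>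
      (\<forall>q. q \<notin> insert r F \<longrightarrow> repr out q (fold (\<lambda>s. ev (f s)) ys (ev (f s) \<tau>) q) (T' q)) \<and>
      (\<forall>q \<in> F. T' q = ?T2 q) \<and> T' r = (t, h + int (length ?xs))"
      using Cons.prems(1) ev_regs_ok[OF wf For.prems(2) Cons.prems(2)] 1(2)
      by (intro Cons.IH[of "pre @ [s]"]) auto
    then obtain T' where T': "exec (fold_cost (\<lambda>s. ev (f s)) (\<lambda>s. cost (f s)) ys (ev (f s) \<tau>) + 4 * length ys + 1) ?W ?T2 T'"
      "\<And>q. q \<notin> insert r F \<Longrightarrow> repr out q (fold (\<lambda>s. ev (f s)) ys (ev (f s) \<tau>) q) (T' q)"
      "\<And>q. q \<in> F \<Longrightarrow> T' q = ?T2 q" "T' r = (t, h + int (length ?xs))" by blast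
    have "exec ((cost (f s) \<tau> + 2) + (fold_cost (\<lambda>s. ev (f s)) (\<lambda>s. cost (f s)) ys (ev (f s) \<tau>) + 4 * length ys + 1) + 2) ?W U T'"
      using exec_MWhile_step[OF _ 2 T'(1)] sc s by blast
    then have "exec (fold_cost (\<lambda>s. ev (f s)) (\<lambda>s. cost (f s)) (s # ys) \<tau> + 4 * length (s # ys) + 1) ?W U T'"
      by (rule exec_mono) simp
    moreover have "T' q = U q" if "q \<in> F" for q
    proof -
      have "q \<noteq> r" using that For.prems(1) by auto
      then show ?thesis using T'(3)[OF that] 1(3)[of q] that by simp
    qed
    ultimately show ?case using T'(2,4) by auto
  qed
  from loop[of "[]" ?xs \<sigma> T] For.prems Tr obtain T1 where
    1: "exec (fold_cost (\<lambda>s. ev (f s)) (\<lambda>s. cost (f s)) ?xs \<sigma> + 4 * length ?xs + 1) ?W T T1"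
    "\<And>q. q \<notin> insert r F \<Longrightarrow> repr out q (fold (\<lambda>s. ev (f s)) ?xs \<sigma> q) (T1 q)"
    "\<And>q. q \<in> F \<Longrightarrow> T1 q = T q" "T1 r = (t, h + int (length ?xs))" by auto
  let ?T2 = "T1(r := (t, h + int (length ?xs) - 1))"
  let ?T3 = "?T2(r := (t, h - 1))"
  let ?T4 = "?T3(r := (t, h))"
  have 2: "exec 1 (MAct r (\<lambda>x. x) MoveLeft) T1 ?T2" using exec_move[of r MoveLeft T1] 1(4) by simp
  have 3: "exec (3 * length ?xs + 1) (MWhile r (\<lambda>_. MAct r (\<lambda>x. x) MoveLeft)) ?T2 ?T3"
    by (rule exec_rewind[OF t nz]) simp_all
  have 4: "exec 1 (MAct r (\<lambda>x. x) MoveRight) ?T3 ?T4" using exec_move[of r MoveRight ?T3] by simp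
  from exec_MSeq[OF 1(1) exec_MSeq[OF 2 exec_MSeq[OF 3 4]]]
  have "exec (cost (For r f) \<sigma>) (compile out (For r f)) T ?T4"
    by (auto elim: exec_mono)
  moreover have "repr out q (ev (For r f) \<sigma> q) (?T4 q)" if "q \<notin> F" for q
  proof (cases "q = r")
    case True
    have "ev (For r f) \<sigma> r = \<sigma> r" using ev_frame_For[OF For.prems(1-3)] .
    then show ?thesis using True t For.prems(1) by (simp add: repr_def)
  next
    case False
    then show ?thesis using 1(2)[of q] that by simp
  qed
  moreover have "?T4 q = T q" if "q \<in> F" for q
    using 1(3)[OF that] For.prems(1) that by auto
  ultimately show ?case by blast
qed

section \<open>Polynomial cost by tiers\<close>

text \<open>
  Every register gets a tier, and a loop over a register may only push to registers of lower tier.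
  Then the number of pushes to tiers \<open>\<ge> i\<close> is polynomial in the sizes of the registers of
  tiers \<open>> i\<close> and the number of pushes to them, so all sizes and the running time are polynomial.
\<close>

primrec tiered :: "(nat \<Rightarrow> nat) \<Rightarrow> nat \<Rightarrow> com \<Rightarrow> bool" where
  "tiered tier m Skip \<longleftrightarrow> True"
| "tiered tier m (Push r s) \<longleftrightarrow> tier r < m"
| "tiered tier m (Pop r) \<longleftrightarrow> True"
| "tiered tier m (Clear r) \<longleftrightarrow> True"
| "tiered tier m (a ;; b) \<longleftrightarrow> tiered tier m a \<and> tiered tier m b"
| "tiered tier m (Case r f) \<longleftrightarrow> (\<forall>s. tiered tier m (f s))"
| "tiered tier m (For r f) \<longleftrightarrow> (\<forall>s. tiered tier (min m (tier r)) (f s))"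

definition size_from :: "nat \<Rightarrow> (nat \<Rightarrow> nat) \<Rightarrow> nat \<Rightarrow> regs \<Rightarrow> nat" where
  "size_from k tier i \<sigma> = (\<Sum>r<k. if i \<le> tier r then length (\<sigma> r) else 0)"

primrec pushes :: "(nat \<Rightarrow> nat) \<Rightarrow> nat \<Rightarrow> com \<Rightarrow> regs \<Rightarrow> nat" where
  "pushes tier i Skip \<sigma> = 0"
| "pushes tier i (Push r s) \<sigma> = (if i \<le> tier r then 1 else 0)"
| "pushes tier i (Pop r) \<sigma> = 0"
| "pushes tier i (Clear r) \<sigma> = 0"
| "pushes tier i (a ;; b) \<sigma> = pushes tier i a \<sigma> + pushes tier i b (ev a \<sigma>)"
| "pushes tier i (Case r f) \<sigma> = pushes tier i (f (first (\<sigma> r))) \<sigma>"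
| "pushes tier i (For r f) \<sigma> = fold_cost (\<lambda>s. ev (f s)) (\<lambda>s. pushes tier i (f s)) (\<sigma> r) \<sigma>"

text \<open>This is the degree of the bounding polynomial. The 2 in a sequence pays for
  \<open>pow_add_le\<close>, the 2 in a loop for its length and overhead, and the sum over all
  branches dominates each of them.\<close>

primrec weight :: "nat \<Rightarrow> com \<Rightarrow> nat" where
  "weight B Skip = 1"
| "weight B (Push r s) = 1"
| "weight B (Pop r) = 1"
| "weight B (Clear r) = 1"
| "weight B (a ;; b) = weight B a + weight B b + 2"
| "weight B (Case r f) = (\<Sum>s<B. weight B (f s)) + 1"
| "weight B (For r f) = (\<Sum>s<B. weight B (f s)) + 2"

lemma length_le_size_from: "r < k \<Longrightarrow> i \<le> tier r \<Longrightarrow> length (\<sigma> r) \<le> size_from k tier i \<sigma>"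
  unfolding size_from_def
  using member_le_sum[of r "{..<k}" "\<lambda>r. if i \<le> tier r then length (\<sigma> r) else 0"] by simp

lemma size_from_update:
  "length xs \<le> length (\<sigma> r) + n \<Longrightarrow> (n = 0 \<or> i \<le> tier r \<Longrightarrow> n \<le> m) \<Longrightarrow>
   size_from k tier i (\<sigma>(r := xs)) \<le> size_from k tier i \<sigma> + m"
proof -
  assume a: "length xs \<le> length (\<sigma> r) + n" "(n = 0 \<or> i \<le> tier r \<Longrightarrow> n \<le> m)"
  have "size_from k tier i (\<sigma>(r := xs)) \<le> (\<Sum>q<k. (if i \<le> tier q then length (\<sigma> q) else 0) + (if q = r then m else 0))"
    unfolding size_from_def using a by (intro sum_mono) auto
  also have "\<dots> \<le> size_from k tier i \<sigma> + m"
    unfolding size_from_def by (simp add: sum.distrib)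
  finally show ?thesis .
qed

lemma size_from_ev: "size_from k tier i (ev c \<sigma>) \<le> size_from k tier i \<sigma> + pushes tier i c \<sigma>"
proof (induction c arbitrary: \<sigma>)
  case (Push r s)
  show ?case unfolding ev.simps pushes.simps by (rule size_from_update[where n = 1]) auto
next
  case (Pop r)
  show ?case unfolding ev.simps pushes.simps by (rule size_from_update[where n = 0]) auto
next
  case (Clear r)
  show ?case unfolding ev.simps pushes.simps by (rule size_from_update[where n = 0]) auto
next
  case (Seq a b)
  show ?case using Seq(1)[of \<sigma>] Seq(2)[of "ev a \<sigma>"] by simp
next
  case (Case r f)
  show ?case using Case[OF rangeI] by simp
next
  case (For r f)
  have "size_from k tier i (fold (\<lambda>s. ev (f s)) xs \<sigma>) \<le> size_from k tier i \<sigma> +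
     fold_cost (\<lambda>s. ev (f s)) (\<lambda>s. pushes tier i (f s)) xs \<sigma>" for xs
  proof (induction xs arbitrary: \<sigma>)
    case (Cons s xs)
    show ?case using Cons[of "ev (f s) \<sigma>"] For[OF rangeI, of s \<sigma>] by simp
  qed simp
  then show ?case by simp
qed simp

lemma pushes_0: "tiered tier m c \<Longrightarrow> m \<le> i \<Longrightarrow> pushes tier i c \<sigma> = 0"
proof (induction c arbitrary: \<sigma> m)
  case (Case r f)
  then show ?case using Case.IH[OF rangeI, of m] by simp
next
  case (For r f)
  have "fold_cost (\<lambda>s. ev (f s)) (\<lambda>s. pushes tier i (f s)) xs \<sigma> = 0" for xs
  proof (induction xs arbitrary: \<sigma>)
    case (Cons s xs)
    have "pushes tier i (f s) \<sigma> = 0"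
      using For.prems by (intro For.IH[OF rangeI, of "min m (tier r)"]) auto
    then show ?case using Cons by simp
  qed simp
  then show ?case by simp
qed auto

text \<open>The present size plus the pushes still to come never grows along the loop, by
  \<open>size_from_ev\<close>; so one \<open>N\<close> serves all iterations and each costs at most
  \<open>D\<close>.\<close>

lemma fold_cost_bound:
  assumes body: "\<And>s \<sigma>. s \<in> set xs \<Longrightarrow> regs_ok B \<sigma> \<Longrightarrow> size_from k tier j \<sigma> + pushes tier j (f s) \<sigma> + 2 \<le> N \<Longrightarrow> g s \<sigma> \<le> D"
    and ok: "\<And>s \<sigma>. s \<in> set xs \<Longrightarrow> regs_ok B \<sigma> \<Longrightarrow> regs_ok B (ev (f s) \<sigma>)"
    and \<sigma>: "regs_ok B \<sigma>"
    and N: "size_from k tier j \<sigma> + fold_cost (\<lambda>s. ev (f s)) (\<lambda>s. pushes tier j (f s)) xs \<sigma> + 2 \<le> N"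
  shows "fold_cost (\<lambda>s. ev (f s)) g xs \<sigma> \<le> length xs * D"
  using assms
proof (induction xs arbitrary: \<sigma>)
  case (Cons s xs)
  have "g s \<sigma> \<le> D" using Cons.prems(3,4) by (intro Cons.prems(1)) auto
  moreover have "fold_cost (\<lambda>s. ev (f s)) g xs (ev (f s) \<sigma>) \<le> length xs * D"
  proof (rule Cons.IH)
    show "size_from k tier j (ev (f s) \<sigma>) + fold_cost (\<lambda>s. ev (f s)) (\<lambda>s. pushes tier j (f s)) xs (ev (f s) \<sigma>) + 2 \<le> N"
      using Cons.prems(4) size_from_ev[of k tier j "f s" \<sigma>] by simp
  qed (use Cons.prems in auto)
  ultimately show ?case by simp
qed simp

lemma pow_add_le:
  assumes "2 \<le> (N::nat)"
  shows "N ^ a + N ^ b + 1 \<le> N ^ (a + b + 2)"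
proof -
  have ab: "1 \<le> N ^ a" "1 \<le> N ^ b" using assms by simp_all
  then have "N ^ a \<le> N ^ a * N ^ b" "N ^ b \<le> N ^ a * N ^ b" "1 \<le> N ^ a * N ^ b" by simp_all
  then have "N ^ a + N ^ b + 1 \<le> 4 * (N ^ a * N ^ b)" by linarith
  also have "\<dots> \<le> N ^ 2 * (N ^ a * N ^ b)"
    using power_mono[OF assms, of 2] by (intro mult_right_mono) simp_all
  finally show ?thesis by (simp add: power_add algebra_simps power2_eq_square)
qed

lemma weight_le_sum: "s < B \<Longrightarrow> weight B (f s) \<le> (\<Sum>s<B. weight B (f s))"
  by (intro member_le_sum) auto

text \<open>A loop over a register of tier at most \<open>i\<close> pushes nothing to tier
  \<open>i\<close> or above. Any other loop register is counted in \<open>size_from\<close> at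
  \<open>Suc i\<close>, hence is looped over at most \<open>N\<close> times.\<close>

lemma pushes_bound:
  "tiered tier m c \<Longrightarrow> wf_com k B out F c \<Longrightarrow> 0 < B \<Longrightarrow> regs_ok B \<sigma> \<Longrightarrow>
   size_from k tier (Suc i) \<sigma> + pushes tier (Suc i) c \<sigma> + 2 \<le> N \<Longrightarrow> pushes tier i c \<sigma> \<le> N ^ weight B c"
proof (induction c arbitrary: m F \<sigma>)
  case (Seq a b)
  have "size_from k tier (Suc i) (ev a \<sigma>) + pushes tier (Suc i) b (ev a \<sigma>) + 2 \<le> N"
    using size_from_ev[of k tier "Suc i" a \<sigma>] Seq.prems(5) by simp
  then have "pushes tier i b (ev a \<sigma>) \<le> N ^ weight B b"
    using Seq.prems ev_regs_ok[of k B out F a \<sigma>] by (intro Seq.IH(2)[of m F]) auto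
  moreover have "pushes tier i a \<sigma> \<le> N ^ weight B a"
    using Seq.prems by (intro Seq.IH(1)[of m F]) auto
  ultimately show ?case using pow_add_le[of N "weight B a" "weight B b"] Seq.prems(5) by simp
next
  case (Case r f)
  let ?s = "first (\<sigma> r)"
  have s: "?s < B" using first_less Case.prems by auto
  have "pushes tier i (f ?s) \<sigma> \<le> N ^ weight B (f ?s)"
    using Case.prems s by (intro Case.IH[OF rangeI, of m _ F]) auto
  also have "\<dots> \<le> N ^ weight B (Case r f)"
    using weight_le_sum[OF s, of f] Case.prems(5) by (intro power_increasing) auto
  finally show ?case by simp
next
  case (For r f)
  show ?case
  proof (cases "tier r \<le> i")
    case True
    have "min (min m (tier r)) (tier r) = min m (tier r)" by simp
    then have t: "tiered tier (min m (tier r)) (For r f)" using For.prems(1) by (simp only: tiered.simps simp_thms)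
    have "pushes tier i (For r f) \<sigma> = 0" using True by (intro pushes_0[OF t]) simp
    then show ?thesis by simp
  next
    case False
    let ?D = "N ^ (\<Sum>s<B. weight B (f s))"
    have N: "2 \<le> N" using For.prems(5) by simp
    have "fold_cost (\<lambda>s. ev (f s)) (\<lambda>s. pushes tier i (f s)) (\<sigma> r) \<sigma> \<le> length (\<sigma> r) * ?D"
    proof (rule fold_cost_bound[where B = B and j = "Suc i" and N = N and k = k and tier = tier])
      fix s \<tau> assume s: "s \<in> set (\<sigma> r)" and \<tau>: "regs_ok B \<tau>"
      have sB: "0 < s \<and> s < B" using regs_okD[OF For.prems(4) s] .
      then have wf: "wf_com k B out (insert r F) (f s)" using For.prems(2) by simp
      then show "regs_ok B (ev (f s) \<tau>)" using ev_regs_ok For.prems(3) \<tau> by blast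
      assume "size_from k tier (Suc i) \<tau> + pushes tier (Suc i) (f s) \<tau> + 2 \<le> N"
      then have "pushes tier i (f s) \<tau> \<le> N ^ weight B (f s)"
        using For.prems \<tau> wf by (intro For.IH[OF rangeI, of "min m (tier r)" _ "insert r F"]) auto
      also have "\<dots> \<le> ?D" using weight_le_sum[of s B f] sB N by (intro power_increasing) auto
      finally show "pushes tier i (f s) \<tau> \<le> ?D" .
    qed (use For.prems in auto)
    also have "length (\<sigma> r) \<le> N"
      using length_le_size_from[of r k "Suc i" tier \<sigma>] For.prems(2,5) False by simp
    then have "length (\<sigma> r) * ?D \<le> N * ?D" by (rule mult_right_mono) simp
    also have "\<dots> \<le> N ^ weight B (For r f)" using N by simp
    finally show ?thesis by simp
  qed
qed (auto split: if_splits)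

text \<open>At tier 0 all registers count, so every loop has length below \<open>N\<close>; the
  factor 8 absorbs the constant overheads of \<open>cost\<close>.\<close>

lemma cost_bound:
  "wf_com k B out F c \<Longrightarrow> 0 < B \<Longrightarrow> regs_ok B \<sigma> \<Longrightarrow>
   size_from k tier 0 \<sigma> + pushes tier 0 c \<sigma> + 2 \<le> N \<Longrightarrow> cost c \<sigma> \<le> 8 * N ^ weight B c"
proof (induction c arbitrary: F \<sigma>)
  case (Clear r)
  then show ?case using length_le_size_from[of r k 0 tier \<sigma>] by simp
next
  case (Seq a b)
  have "size_from k tier 0 (ev a \<sigma>) + pushes tier 0 b (ev a \<sigma>) + 2 \<le> N"
    using size_from_ev[of k tier 0 a \<sigma>] Seq.prems(4) by simp
  then have "cost b (ev a \<sigma>) \<le> 8 * N ^ weight B b"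
    using Seq.prems ev_regs_ok[of k B out F a \<sigma>] by (intro Seq.IH(2)[of F]) auto
  moreover have "cost a \<sigma> \<le> 8 * N ^ weight B a"
    using Seq.prems by (intro Seq.IH(1)[of F]) auto
  ultimately show ?case using pow_add_le[of N "weight B a" "weight B b"] Seq.prems(4) by simp
next
  case (Case r f)
  let ?s = "first (\<sigma> r)"
  have s: "?s < B" using first_less Case.prems by auto
  have "cost (f ?s) \<sigma> \<le> 8 * N ^ weight B (f ?s)"
    using Case.prems s by (intro Case.IH[OF rangeI, of F]) auto
  also have "\<dots> \<le> 8 * N ^ (\<Sum>s<B. weight B (f s))"
    using weight_le_sum[OF s, of f] Case.prems(4) by (intro mult_left_mono power_increasing) auto
  finally have "cost (Case r f) \<sigma> \<le> 8 * N ^ (\<Sum>s<B. weight B (f s)) + 1" by simp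
  also have "\<dots> \<le> 8 * (2 * N ^ (\<Sum>s<B. weight B (f s)))" using Case.prems(4) by simp
  also have "\<dots> \<le> 8 * (N * N ^ (\<Sum>s<B. weight B (f s)))" using Case.prems(4) by simp
  finally show ?case by simp
next
  case (For r f)
  let ?D = "N ^ (\<Sum>s<B. weight B (f s))"
  have N: "2 \<le> N" using For.prems(4) by simp
  have "fold_cost (\<lambda>s. ev (f s)) (\<lambda>s. cost (f s)) (\<sigma> r) \<sigma> \<le> length (\<sigma> r) * (8 * ?D)"
  proof (rule fold_cost_bound[where B = B and j = 0 and N = N and k = k and tier = tier])
    fix s \<tau> assume s: "s \<in> set (\<sigma> r)" and \<tau>: "regs_ok B \<tau>"
    have sB: "0 < s \<and> s < B" using regs_okD[OF For.prems(3) s] .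
    then have wf: "wf_com k B out (insert r F) (f s)" using For.prems(1) by simp
    then show "regs_ok B (ev (f s) \<tau>)" using ev_regs_ok For.prems(2) \<tau> by blast
    assume "size_from k tier 0 \<tau> + pushes tier 0 (f s) \<tau> + 2 \<le> N"
    then have "cost (f s) \<tau> \<le> 8 * N ^ weight B (f s)"
      using For.prems \<tau> wf by (intro For.IH[OF rangeI, of "insert r F"]) auto
    also have "\<dots> \<le> 8 * ?D" using weight_le_sum[of s B f] sB N by (intro mult_left_mono power_increasing) auto
    finally show "cost (f s) \<tau> \<le> 8 * ?D" .
  qed (use For.prems in auto)
  moreover have len: "length (\<sigma> r) + 2 \<le> N"
    using length_le_size_from[of r k 0 tier \<sigma>] For.prems(1,4) by simp
  have D: "1 \<le> ?D" using N by simp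
  have "7 * length (\<sigma> r) + 7 \<le> (length (\<sigma> r) + 1) * (8 * ?D)"
    using mult_le_mono[of 7 "8 * ?D" "length (\<sigma> r) + 1" "length (\<sigma> r) + 1"] D by (simp add: algebra_simps)
  ultimately have "cost (For r f) \<sigma> \<le> (2 * (length (\<sigma> r) + 1)) * (8 * ?D)"
    by (simp add: algebra_simps)
  also have "\<dots> \<le> (N * N) * (8 * ?D)" using len N by (intro mult_right_mono mult_mono) auto
  finally show ?case by (simp add: algebra_simps)
qed auto

lemma Suc_power_le_pbound: "a * Suc n ^ d \<le> pbound (a * 2 ^ d) d n"
proof (cases "n = 0")
  case False
  then have "Suc n ^ d \<le> (2 * n) ^ d" by (intro power_mono) auto
  then have "a * Suc n ^ d \<le> a * (2 * n) ^ d" by (rule mult_left_mono) simp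
  also have "\<dots> = a * 2 ^ d * n ^ d" by (simp add: power_mult_distrib)
  finally show ?thesis unfolding pbound_def by linarith
next
  case True
  have "a * 1 \<le> a * 2 ^ d" by (rule mult_left_mono) simp_all
  then have "a * Suc n ^ d \<le> a * 2 ^ d" using True by (simp only: power_one One_nat_def[symmetric])
  then show ?thesis unfolding pbound_def by linarith
qed

text \<open>Downward induction on the tier: nothing is pushed to tier \<open>m\<close> or above, and
  each lower tier raises the polynomial of the tier above it to a fixed power. The number of tiers
  is constant, so the degree is too.\<close>

lemma tiered_pushes_poly:
  assumes "wf_com k B out {} c" "tiered tier m c" "0 < B"
  shows "\<exists>a d. \<forall>\<sigma>. regs_ok B \<sigma> \<longrightarrow> pushes tier i c \<sigma> \<le> a * Suc (size_from k tier 0 \<sigma>) ^ d"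
proof (induction "m - i" arbitrary: i)
  case 0
  then show ?case using pushes_0[OF assms(2)] by (intro exI[of _ 0]) auto
next
  case (Suc j)
  then have "j = m - Suc i" by simp
  from Suc.hyps(1)[OF this] obtain a d where ad:
    "regs_ok B \<sigma> \<Longrightarrow> pushes tier (Suc i) c \<sigma> \<le> a * Suc (size_from k tier 0 \<sigma>) ^ d" for \<sigma> by blast
  have "pushes tier i c \<sigma> \<le> (a + 3) ^ weight B c * Suc (size_from k tier 0 \<sigma>) ^ ((d + 1) * weight B c)"
    if ok: "regs_ok B \<sigma>" for \<sigma>
  proof -
    let ?n = "size_from k tier 0 \<sigma>"
    have "size_from k tier (Suc i) \<sigma> \<le> ?n" unfolding size_from_def by (intro sum_mono) auto
    moreover have "Suc ?n ^ d \<le> Suc ?n ^ (d + 1)" "Suc ?n \<le> Suc ?n ^ (d + 1)"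
      by (rule power_increasing, simp_all only: le_add1 self_le_power)
    then have "a * Suc ?n ^ d \<le> a * Suc ?n ^ (d + 1)" by (intro mult_left_mono) auto
    ultimately have "size_from k tier (Suc i) \<sigma> + pushes tier (Suc i) c \<sigma> + 2 \<le> (a + 3) * Suc ?n ^ (d + 1)"
      using ad[OF ok] \<open>Suc ?n \<le> Suc ?n ^ (d + 1)\<close> unfolding add_mult_distrib by linarith
    from pushes_bound[OF assms(2,1,3) ok this]
    show ?thesis by (simp only: power_mult_distrib power_mult)
  qed
  then show ?case by blast
qed

theorem tiered_cost_poly:
  assumes "wf_com k B out {} c" "tiered tier m c" "0 < B"
  shows "\<exists>a d. \<forall>\<sigma>. regs_ok B \<sigma> \<longrightarrow> cost c \<sigma> \<le> pbound a d (size_from k tier 0 \<sigma>)"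
proof -
  obtain a d where ad: "regs_ok B \<sigma> \<Longrightarrow> pushes tier 0 c \<sigma> \<le> a * Suc (size_from k tier 0 \<sigma>) ^ d" for \<sigma>
    using tiered_pushes_poly[OF assms, of 0] by blast
  have "cost c \<sigma> \<le> 8 * (a + 3) ^ weight B c * Suc (size_from k tier 0 \<sigma>) ^ ((d + 1) * weight B c)"
    if ok: "regs_ok B \<sigma>" for \<sigma>
  proof -
    let ?n = "size_from k tier 0 \<sigma>"
    have "Suc ?n ^ d \<le> Suc ?n ^ (d + 1)" "Suc ?n \<le> Suc ?n ^ (d + 1)"
      by (rule power_increasing, simp_all only: le_add1 self_le_power)
    then have "a * Suc ?n ^ d \<le> a * Suc ?n ^ (d + 1)" by (intro mult_left_mono) auto
    then have "?n + pushes tier 0 c \<sigma> + 2 \<le> (a + 3) * Suc ?n ^ (d + 1)"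
      using ad[OF ok] \<open>Suc ?n \<le> Suc ?n ^ (d + 1)\<close> unfolding add_mult_distrib by linarith
    from cost_bound[OF assms(1,3) ok this]
    show ?thesis by (simp only: power_mult_distrib power_mult mult.assoc)
  qed
  then show ?thesis using Suc_power_le_pbound order_trans by blast
qed

section \<open>Machines from programs\<close>

definition input_regs :: "nat list \<Rightarrow> regs" where
  "input_regs ss = (\<lambda>_. [])(0 := ss)"

lemma input_regs_simps [simp]:
  "input_regs ss 0 = ss" "r \<noteq> 0 \<Longrightarrow> input_regs ss r = []"
  by (simp_all add: input_regs_def)

lemma size_from_input_regs: "0 < k \<Longrightarrow> size_from k tier 0 (input_regs ss) = length ss"
proof -
  assume "0 < k"
  have "size_from k tier 0 (input_regs ss) = (\<Sum>r<k. if r = 0 then length ss else 0)"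
    unfolding size_from_def by (intro sum.cong) (auto simp: input_regs_def)
  then show ?thesis using \<open>0 < k\<close> by simp
qed

lemma regs_ok_input_regs: "set ss \<subseteq> {0<..<B} \<Longrightarrow> regs_ok B (input_regs ss)"
  by (auto simp: regs_ok_def input_regs_def)

lemma repr_initial_tapes: "out \<noteq> 0 \<Longrightarrow> repr out r (input_regs ss r) (initial_tapes ss r)"
  by (auto simp: repr_def initial_tapes_def input_regs_def tape_of_def fun_eq_iff)

lemma set_bit_word: "set (bit_word x) \<subseteq> {1, 2}"
  by (auto simp: bit_word_def)

theorem polytime_functionI:
  assumes wf: "wf_com (Suc out) B out {} c" and t: "tiered tier m c" and out: "out \<noteq> 0" and B: "4 \<le> B"
    and f: "\<And>x. ev c (input_regs (bit_word x)) out = rev (bit_word (f x))"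
  shows "polytime_function f"
proof -
  obtain a d where ad: "\<And>\<sigma>. regs_ok B \<sigma> \<Longrightarrow> cost c \<sigma> \<le> pbound a d (size_from (Suc out) tier 0 \<sigma>)"
    using tiered_cost_poly[OF wf t] B by auto
  have "mcom_ok (Suc out) B (compile out c)" using mcom_ok_compile[OF wf] B by simp
  from machine_of_mcom[OF this _ B] obtain M where M: "wf_machine M" and
    run: "\<And>ss n C. set ss \<subseteq> {..<B} \<Longrightarrow> C = (mstep ^^ n) (compile out c, initial_tapes ss) \<Longrightarrow>
      (fst (run M n ss) = accept_state M \<longleftrightarrow> fst C = MSkip) \<and>
      snd (run M n ss) = map (snd C) [0..<Suc out]" unfolding Let_def by auto
  have "halting M (fst (run M (pbound a d (length x)) (bit_word x))) \<and>
      fst (last (snd (run M (pbound a d (length x)) (bit_word x)))) = tape_of (bit_word (f x))" for x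
  proof -
    have sub: "set (bit_word x) \<subseteq> {0<..<B}" "set (bit_word x) \<subseteq> {..<B}" using set_bit_word[of x] B by auto
    note ok = regs_ok_input_regs[OF sub(1)]
    from exec_compile[OF wf _ ok repr_initial_tapes[OF out]] B obtain T where
      T: "exec (cost c (input_regs (bit_word x))) (compile out c) (initial_tapes (bit_word x)) T"
      "repr out out (ev c (input_regs (bit_word x)) out) (T out)" by auto
    have "exec (pbound a d (length x)) (compile out c) (initial_tapes (bit_word x)) T"
      using exec_mono[OF T(1)] ad[OF ok] by (simp add: size_from_input_regs bit_word_def)
    then have "(MSkip, T) = (mstep ^^ pbound a d (length x)) (compile out c, initial_tapes (bit_word x))"
      by (simp add: exec_def)
    from run[OF sub(2) this] show ?thesis using T(2) f[of x] by (simp add: halting_def repr_def)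
  qed
  then show ?thesis using M unfolding polytime_function_def by blast
qed

text \<open>Emptiness of register \<open>r\<close> decides between \<open>MSkip\<close> and
  \<open>MReject\<close>, which the machine turns into acceptance and rejection.\<close>

theorem verifierI:
  assumes wf: "wf_com (Suc out) B out {} c" and t: "tiered tier m c" and out: "out \<noteq> 0" and B: "4 \<le> B"
    and r: "r < out"
  shows "\<exists>V a d. wf_machine V \<and>
    (\<forall>x w. halting V (fst (run V (pbound a d (length (verifier_input x w))) (verifier_input x w)))) \<and>
    (\<forall>x w. accepts V (verifier_input x w) \<longleftrightarrow> ev c (input_regs (verifier_input x w)) r \<noteq> [])"
proof -
  let ?c = "MSeq (compile out c) (MCase r (\<lambda>s. if s = 0 then MReject else MSkip))"
  obtain a d where ad: "\<And>\<sigma>. regs_ok B \<sigma> \<Longrightarrow> cost c \<sigma> \<le> pbound a d (size_from (Suc out) tier 0 \<sigma>)"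
    using tiered_cost_poly[OF wf t] B by auto
  have "mcom_ok (Suc out) B ?c" using mcom_ok_compile[OF wf] B r by simp
  from machine_of_mcom[OF this _ B] obtain V where V: "wf_machine V" and
    run: "\<And>ss n C. set ss \<subseteq> {..<B} \<Longrightarrow> C = (mstep ^^ n) (?c, initial_tapes ss) \<Longrightarrow>
      (fst (run V n ss) = accept_state V \<longleftrightarrow> fst C = MSkip) \<and>
      (fst (run V n ss) = reject_state V \<longleftrightarrow> fst C = MReject)" unfolding Let_def by auto
  have key: "halting V (fst (run V n ss)) \<and>
      (fst (run V n ss) = accept_state V \<longleftrightarrow> ev c (input_regs ss) r \<noteq> [])"
    if ss: "ss = verifier_input x w" and n: "pbound (a + 2) d (length ss) \<le> n" for ss x w n
  proof -
    have sub: "set ss \<subseteq> {0<..<B}" "set ss \<subseteq> {..<B}"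
      using set_bit_word[of x] set_bit_word[of w] B unfolding ss verifier_input_def by auto
    note ok = regs_ok_input_regs[OF sub(1)]
    let ?\<sigma> = "ev c (input_regs ss)"
    from exec_compile[OF wf _ ok repr_initial_tapes[OF out]] B obtain T where
      T: "exec (cost c (input_regs ss)) (compile out c) (initial_tapes ss) T" "repr out r (?\<sigma> r) (T r)" by auto
    have sc: "scanned T r = first (?\<sigma> r)" using repr_scanned[of out r ?\<sigma> T, OF T(2)] r by simp
    let ?d = "if first (?\<sigma> r) = 0 then MReject else MSkip"
    have "(mstep ^^ (cost c (input_regs ss) + 1)) (compile out c, initial_tapes ss) = (MSkip, T)"
      using T(1) by (simp add: exec_def)
    \<comment> \<open>\<open>exec\<close> speaks only of runs ending in \<open>MSkip\<close>, so a
      rejecting run must be followed exactly. Hence the first time at which the body reaches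
      \<open>MSkip\<close> is used below.\<close>
    have seq: "(mstep ^^ Suc k) (MSeq a b, U) = (b, T)"
      if "(mstep ^^ k) (a, U) = (MSkip, T)" "\<And>j. j < k \<Longrightarrow> fst ((mstep ^^ j) (a, U)) \<noteq> MSkip" for k a b U
      using that
    proof (induction k arbitrary: a U)
      case 0
      then show ?case by (simp add: mstep_MSeq)
    next
      case (Suc k)
      have "a \<noteq> MSkip" using Suc.prems(2)[of 0] by simp
      moreover have "(mstep ^^ Suc k) (MSeq (fst (mstep (a, U))) b, snd (mstep (a, U))) = (b, T)"
      proof (rule Suc.IH)
        show "(mstep ^^ k) (fst (mstep (a, U)), snd (mstep (a, U))) = (MSkip, T)"
          using Suc.prems(1) unfolding funpow_Suc_right o_def by simp
        show "fst ((mstep ^^ j) (fst (mstep (a, U)), snd (mstep (a, U)))) \<noteq> MSkip" if "j < k" for j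
          using Suc.prems(2)[of "Suc j"] that unfolding funpow_Suc_right o_def by simp
      qed
      ultimately show ?case unfolding funpow_Suc_right[of "Suc k"] o_def by (simp add: mstep_MSeq del: funpow.simps)
    qed
    define k where "k = (LEAST k. fst ((mstep ^^ k) (compile out c, initial_tapes ss)) = MSkip)"
    have k1: "fst ((mstep ^^ cost c (input_regs ss)) (compile out c, initial_tapes ss)) = MSkip"
      using T(1) by (simp add: exec_def)
    have k: "fst ((mstep ^^ k) (compile out c, initial_tapes ss)) = MSkip" "k \<le> cost c (input_regs ss)"
      "\<And>j. j < k \<Longrightarrow> fst ((mstep ^^ j) (compile out c, initial_tapes ss)) \<noteq> MSkip"
      unfolding k_def using k1 by (auto intro: LeastI Least_le dest: not_less_Least)
    have "exec k (compile out c) (initial_tapes ss) (snd ((mstep ^^ k) (compile out c, initial_tapes ss)))"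
      using k(1) by (simp add: exec_def prod_eq_iff)
    from exec_mono[OF this k(2)] T(1) have "snd ((mstep ^^ k) (compile out c, initial_tapes ss)) = T"
      by (simp add: exec_def)
    with k(1) have "(mstep ^^ k) (compile out c, initial_tapes ss) = (MSkip, T)" by (simp add: prod_eq_iff)
    from seq[OF this k(3)] have "(mstep ^^ Suc k) (?c, initial_tapes ss) = (MCase r (\<lambda>s. if s = 0 then MReject else MSkip), T)" .
    then have 1: "(mstep ^^ Suc (Suc k)) (?c, initial_tapes ss) = (?d, T)"
      by (simp add: mstep_def sc)
    have "size_from (Suc out) tier 0 (input_regs ss) = length ss" by (simp add: size_from_input_regs)
    \<comment> \<open>Handover and final test take one step each, which explains the summand in
      \<open>a + 2\<close>.\<close>
    then have "Suc (Suc k) \<le> n" using n k(2) ad[OF ok] by (simp add: pbound_def algebra_simps)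
    then obtain j where n: "n = j + Suc (Suc k)" using le_iff_add add.commute by metis
    have "(mstep ^^ n) (?c, initial_tapes ss) = (mstep ^^ j) (?d, T)"
      unfolding n funpow_add o_apply 1 ..
    then have "(?d, T) = (mstep ^^ n) (?c, initial_tapes ss)" by simp
    note R = run[OF sub(2) this]
    have "0 \<notin> set (?\<sigma> r)" using regs_okD[OF ev_regs_ok[OF wf _ ok]] B by fastforce
    then have "first (?\<sigma> r) = 0 \<longleftrightarrow> ?\<sigma> r = []" by (cases "?\<sigma> r") auto
    then show ?thesis using R by (auto simp: halting_def split: if_splits)
  qed
  have "accepts V (verifier_input x w) \<longleftrightarrow> ev c (input_regs (verifier_input x w)) r \<noteq> []" for x w
  proof -
    let ?ss = "verifier_input x w"
    let ?n = "pbound (a + 2) d (length ?ss)"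
    have "fst (run V (max n ?n) ?ss) = accept_state V" if "fst (run V n ?ss) = accept_state V" for n
    proof -
      have "set ?ss \<subseteq> {..<B}" using set_bit_word[of x] set_bit_word[of w] B unfolding verifier_input_def by auto
      note R = run[OF this refl]
      have "fst ((mstep ^^ n) (?c, initial_tapes ?ss)) = MSkip" using R[of n] that by simp
      then have "fst ((mstep ^^ (max n ?n - n + n)) (?c, initial_tapes ?ss)) = MSkip"
        unfolding funpow_add o_def by (metis funpow_mstep_final(1) prod.collapse fst_conv)
      then show ?thesis using R[of "max n ?n"] by simp
    qed
    then show ?thesis unfolding accepts_def using key[OF refl, of x w ?n] key[OF refl, of x w] by (meson max.cobounded2 order_refl)
  qed
  then show ?thesis using V key[OF refl] by blast
qed

section \<open>Tableaux of Turing machine runs\<close>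

text \<open>
  Cells are addressed relative to the head: \<open>Cell True k s\<close> at position \<open>p\<close> is the cell \<open>p\<close> steps
  to the right of head \<open>k\<close>, \<open>Cell False k s\<close> the one \<open>p + 1\<close> steps to the left. Thus all rules for one
  time step are the same at every time and position, and each involves at most one position.
\<close>

datatype tcode = St nat | Tr nat "nat list" | Cell bool nat nat

instance tcode :: countable by countable_datatype

type_synonym tatom = "nat \<times> nat \<times> tcode"
type_synonym trule = "tatom list \<times> tatom list"

definition sat_trule :: "(tatom \<Rightarrow> bool) \<Rightarrow> trule \<Rightarrow> bool" where
  "sat_trule v r \<longleftrightarrow> (list_all v (snd r) \<longrightarrow> list_ex v (fst r))"

text \<open>An atom template \<open>(ut, dt, up, dp, c)\<close> says whether the current time and position are used
  and what is added to them.\<close>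
type_synonym tmpl = "bool \<times> nat \<times> bool \<times> nat \<times> tcode"
type_synonym rtmpl = "tmpl list \<times> tmpl list"

fun inst :: "nat \<Rightarrow> nat \<Rightarrow> tmpl \<Rightarrow> tatom" where
  "inst t p (ut, dt, up, dp, c) = ((if ut then t else 0) + dt, (if up then p else 0) + dp, c)"

definition inst_rule :: "nat \<Rightarrow> nat \<Rightarrow> rtmpl \<Rightarrow> trule" where
  "inst_rule t p r = (map (inst t p) (fst r), map (inst t p) (snd r))"

text \<open>Halted configurations are copied, so that the tableau may extend beyond the halting
  time.\<close>

definition transition :: "machine \<Rightarrow> nat \<Rightarrow> nat list \<Rightarrow> nat \<times> (nat \<times> dir) list" where
  "transition M q ss = (if halting M q then (q, map (\<lambda>s. (s, Stay)) ss) else delta M q ss)"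

text \<open>When the head moves, all coordinates shift the other way. A cell that changes sides gets
  a rule without position, namely the written cell on a move to the right and the left neighbour on
  a move to the left. \<open>G\<close> lists the tape symbols.\<close>

fun move_tmpls :: "tmpl \<Rightarrow> nat \<Rightarrow> nat list \<Rightarrow> nat \<times> dir \<Rightarrow> rtmpl list" where
  "move_tmpls b k G (w, Stay) =
     ([(True, 1, False, 0, Cell True k w)], [b])
     # concat (map (\<lambda>s. [([(True, 1, True, 1, Cell True k s)], [b, (True, 0, True, 1, Cell True k s)]),
                       ([(True, 1, True, 0, Cell False k s)], [b, (True, 0, True, 0, Cell False k s)])]) G)"
| "move_tmpls b k G (w, MoveRight) =
     ([(True, 1, False, 0, Cell False k w)], [b])
     # concat (map (\<lambda>s. [([(True, 1, True, 0, Cell True k s)], [b, (True, 0, True, 1, Cell True k s)]),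
                       ([(True, 1, True, 1, Cell False k s)], [b, (True, 0, True, 0, Cell False k s)])]) G)"
| "move_tmpls b k G (w, MoveLeft) =
     ([(True, 1, False, 1, Cell True k w)], [b])
     # concat (map (\<lambda>s. [([(True, 1, True, 2, Cell True k s)], [b, (True, 0, True, 1, Cell True k s)]),
                       ([(True, 1, False, 0, Cell True k s)], [b, (True, 0, False, 0, Cell False k s)]),
                       ([(True, 1, True, 0, Cell False k s)], [b, (True, 0, True, 1, Cell False k s)])]) G)"

text \<open>The auxiliary atom \<open>Tr\<close> collects the state and the complete reading once,
  so all other transition rules have at most two body atoms.\<close>

definition trans_tmpls :: "machine \<Rightarrow> nat list \<Rightarrow> nat \<times> nat list \<Rightarrow> rtmpl list" where
  "trans_tmpls M G qs = (let q = fst qs; ss = snd qs; K = tape_count M; b = (True, 0, False, 0, Tr q ss) in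
     ([b], (True, 0, False, 0, St q) # map (\<lambda>k. (True, 0, False, 0, Cell True k (ss ! k))) [0..<K])
     # ([(True, 1, False, 0, St (fst (transition M q ss)))], [b])
     # concat (map (\<lambda>k. move_tmpls b k G (snd (transition M q ss) ! k)) [0..<K]))"

text \<open>Acceptance is not demanded; rejection is forbidden, which amounts to the same once the
  run has halted. Blanks propagate to the right on the input tape so that a guessed certificate may
  end early.\<close>

definition tmpls :: "machine \<Rightarrow> nat list \<Rightarrow> (nat \<times> nat list) list \<Rightarrow> rtmpl list" where
  "tmpls M G QS =
     ([(False, 0, False, 0, St (start_state M))], [])
     # ([(False, 0, True, 1, Cell True 0 0)], [(False, 0, True, 0, Cell True 0 0)])
     # ([], [(True, 0, False, 0, St (reject_state M))])
     # map (\<lambda>k. ([(False, 0, True, 0, Cell True k 0)], [])) [1..<tape_count M]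
     @ map (\<lambda>k. ([(False, 0, True, 0, Cell False k 0)], [])) [0..<tape_count M]
     @ concat (map (trans_tmpls M G) QS)"

definition input_tmpl :: "nat \<Rightarrow> rtmpl" where
  "input_tmpl s = ([(False, 0, True, 0, Cell True 0 s)], [])"

text \<open>This is the only disjunctive rule. The blank alternative covers certificates shorter
  than the maximum.\<close>

definition guess_tmpl :: rtmpl where
  "guess_tmpl = ([(False, 0, True, 0, Cell True 0 1), (False, 0, True, 0, Cell True 0 2),
                  (False, 0, True, 0, Cell True 0 0)], [])"

text \<open>Templates that ignore time or position are instantiated repeatedly; tolerating the
  duplicates lets a uniform nested loop write the grid.\<close>

definition tableau :: "rtmpl list \<Rightarrow> nat list \<Rightarrow> nat \<Rightarrow> nat \<Rightarrow> trule list" where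
  "tableau R ss m N =
     map (\<lambda>i. inst_rule 0 i (input_tmpl (ss ! i))) [0..<length ss]
     @ [inst_rule 0 (length ss) (input_tmpl 3)]
     @ map (\<lambda>i. inst_rule 0 (length ss + 1 + i) guess_tmpl) [0..<m]
     @ [inst_rule 0 (length ss + 1 + m) (input_tmpl 0)]
     @ concat (map (\<lambda>t. concat (map (\<lambda>p. map (inst_rule t p) R) [0..<N])) [0..<N])"

definition cell :: "config \<Rightarrow> nat \<Rightarrow> int \<Rightarrow> nat" where
  "cell c k j = fst (snd c ! k) (snd (snd c ! k) + j)"

definition config_ok :: "machine \<Rightarrow> config \<Rightarrow> bool" where
  "config_ok M c \<longleftrightarrow> fst c \<in> states M \<and> length (snd c) = tape_count M \<and>
     (\<forall>k < tape_count M. \<forall>j. cell c k j \<in> symbols M)"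

definition scan :: "machine \<Rightarrow> config \<Rightarrow> nat list" where
  "scan M c = map (\<lambda>k. cell c k 0) [0..<tape_count M]"

lemma scan_eq: "length (snd c) = tape_count M \<Longrightarrow> map (\<lambda>(t, h). t h) (snd c) = scan M c"
  by (intro nth_equalityI) (auto simp: scan_def cell_def split_beta)

lemma length_scan [simp]: "length (scan M c) = tape_count M"
  by (simp add: scan_def)

lemma step_transition:
  assumes wf: "wf_machine M" and ok: "config_ok M c"
  shows "fst (step M c) = fst (transition M (fst c) (scan M c))"
    and "k < tape_count M \<Longrightarrow> snd (transition M (fst c) (scan M c)) ! k = (w, d) \<Longrightarrow>
      cell (step M c) k j = (if j + move d 0 = 0 then w else cell c k (j + move d 0))"
    and "config_ok M (step M c)"
proof -
  let ?tr = "transition M (fst c) (scan M c)"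
  let ?K = "tape_count M"
  have len: "length (snd c) = ?K" and q: "fst c \<in> states M"
    and sy: "\<And>k j. k < ?K \<Longrightarrow> cell c k j \<in> symbols M" using ok unfolding config_ok_def by auto
  have ss: "set (scan M c) \<subseteq> symbols M" using sy by (auto simp: scan_def)
  have tr: "fst ?tr \<in> states M \<and> length (snd ?tr) = ?K \<and> fst ` set (snd ?tr) \<subseteq> symbols M"
  proof (cases "halting M (fst c)")
    case True
    then show ?thesis using q ss by (auto simp: transition_def)
  next
    case False
    then show ?thesis using wf q ss unfolding wf_machine_def transition_def by simp
  qed
  have step: "step M c = (fst ?tr, map2 act (snd ?tr) (snd c))"
  proof (cases "halting M (fst c)")
    case True
    have "map2 act (map (\<lambda>s. (s, Stay)) (scan M c)) (snd c) = snd c"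
      unfolding scan_eq[OF len, symmetric] by (intro nth_equalityI) (auto simp: split_beta)
    then show ?thesis using True by (simp add: step_def transition_def)
  next
    case False
    then show ?thesis using len by (simp add: step_def transition_def scan_eq split_beta Let_def)
  qed
  show "fst (step M c) = fst ?tr" by (simp add: step)
  have cell: "cell (step M c) k j = (if j + move d 0 = 0 then w else cell c k (j + move d 0))"
    if "k < ?K" "snd ?tr ! k = (w, d)" for k w d j
  proof -
    obtain t h where th: "snd c ! k = (t, h)" by fastforce
    have "snd (step M c) ! k = act (w, d) (t, h)" using that tr len th by (simp add: step)
    then show ?thesis using th by (cases d) (auto simp: cell_def algebra_simps)
  qed
  then show "k < ?K \<Longrightarrow> snd ?tr ! k = (w, d) \<Longrightarrow>
      cell (step M c) k j = (if j + move d 0 = 0 then w else cell c k (j + move d 0))" .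
  have "cell (step M c) k j \<in> symbols M" if k: "k < ?K" for k j
  proof -
    obtain w d where wd: "snd ?tr ! k = (w, d)" by fastforce
    have "snd ?tr ! k \<in> set (snd ?tr)" using tr k by simp
    then have "w \<in> symbols M" using tr wd by force
    then show ?thesis using cell[OF k wd] sy[OF k] by simp
  qed
  then show "config_ok M (step M c)" using tr len unfolding config_ok_def by (simp add: step)
qed

lemma config_ok_run:
  assumes wf: "wf_machine M" and ss: "set ss \<subseteq> {1, 2, 3}"
  shows "config_ok M (run M n ss)"
proof (induction n)
  case 0
  have sy: "{0, 1, 2, 3} \<subseteq> symbols M" "start_state M \<in> states M" "1 \<le> tape_count M"
    using wf by (auto simp: wf_machine_def)
  have "tape_of ss j \<in> {0, 1, 2, 3}" for j
  proof -
    have "nat j < length ss \<Longrightarrow> ss ! nat j \<in> {1, 2, 3}" using ss nth_mem by blast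
    then show ?thesis by (auto simp: tape_of_def nat_less_iff)
  qed
  then have "tape_of ss j \<in> symbols M" for j using sy by blast
  then show ?case using sy by (auto simp: run_def init_config_def config_ok_def cell_def nth_Cons')
next
  case (Suc n)
  then show ?case using step_transition(3)[OF wf] by (simp add: run_def)
qed

lemma run_Suc: "run M (Suc n) ss = step M (run M n ss)"
  by (simp add: run_def)

lemma run_halted: "halting M (fst (run M n ss)) \<Longrightarrow> n \<le> m \<Longrightarrow> run M m ss = run M n ss"
  by (induction m) (auto simp: le_Suc_eq run_Suc step_def)

lemma cell_init:
  "0 < tape_count M \<Longrightarrow> cell (run M 0 ss) 0 j = tape_of ss j"
  "0 < k \<Longrightarrow> k < tape_count M \<Longrightarrow> cell (run M 0 ss) k j = 0"
  by (simp_all add: run_def init_config_def cell_def)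

section \<open>Models of the tableau and accepting runs\<close>

definition cell_pos :: "bool \<Rightarrow> nat \<Rightarrow> int" where
  "cell_pos right p = (if right then int p else - 1 - int p)"

fun run_atom :: "machine \<Rightarrow> nat list \<Rightarrow> tatom \<Rightarrow> bool" where
  "run_atom M ss (t, p, St q) \<longleftrightarrow> p = 0 \<and> fst (run M t ss) = q"
| "run_atom M ss (t, p, Tr q us) \<longleftrightarrow> p = 0 \<and> fst (run M t ss) = q \<and> scan M (run M t ss) = us"
| "run_atom M ss (t, p, Cell right k s) \<longleftrightarrow> k < tape_count M \<and> cell (run M t ss) k (cell_pos right p) = s"

lemma sat_trule_simps [simp]:
  "sat_trule v (hs, bs) \<longleftrightarrow> (list_all v bs \<longrightarrow> list_ex v hs)"
  by (simp add: sat_trule_def)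

text \<open>The constraint against rejection holds because halted configurations of one run
  coincide, so an accepting run never visits the rejecting state. Blank propagation holds since the
  input contains no blank inside.\<close>

lemma run_atom_tmpls:
  assumes wf: "wf_machine M" and ss: "set ss \<subseteq> {1, 2, 3}" and acc: "accepts M ss"
    and QS: "\<And>q us. (q, us) \<in> set QS \<Longrightarrow> length us = tape_count M"
    and r: "r \<in> set (tmpls M G QS)"
  shows "sat_trule (run_atom M ss) (inst_rule t p r)"
proof -
  have ok: "config_ok M (run M t ss)" by (rule config_ok_run[OF wf ss])
  have K: "0 < tape_count M" using wf by (simp add: wf_machine_def)
  note step = step_transition[OF wf ok, folded run_Suc]
  have rej: "fst (run M t ss) \<noteq> reject_state M"
  proof
    assume R: "fst (run M t ss) = reject_state M"
    obtain n where A: "fst (run M n ss) = accept_state M" using acc by (auto simp: accepts_def)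
    have "run M (max n t) ss = run M n ss" "run M (max n t) ss = run M t ss"
      using A R by (auto intro!: run_halted simp: halting_def)
    then show False using A R wf by (simp add: wf_machine_def)
  qed
  have mv: "sat_trule (run_atom M ss) (inst_rule t p r)"
    if "r \<in> set (move_tmpls (True, 0, False, 0, Tr q us) k G (snd (transition M q us) ! k))" "k < tape_count M" for q us k
  proof -
    obtain w d where wd: "snd (transition M q us) ! k = (w, d)" by fastforce
    note st = step(2)[OF that(2), of w d]
    have eq: "- 2 - int p = - int p - 2" by simp
    show ?thesis using that wd st by (cases d) (auto simp: inst_rule_def cell_pos_def algebra_simps eq)
  qed
  have tr: "sat_trule (run_atom M ss) (inst_rule t p r)"
    if r: "r \<in> set (trans_tmpls M G (q, us))" and us: "length us = tape_count M" for q us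
  proof -
    have sc: "(\<forall>k\<in>{0..<tape_count M}. cell (run M t ss) k 0 = us ! k) \<Longrightarrow> scan M (run M t ss) = us"
      using us by (intro nth_equalityI) (auto simp: scan_def)
    from r consider "r = ([(True, 0, False, 0, Tr q us)], (True, 0, False, 0, St q)
          # map (\<lambda>k. (True, 0, False, 0, Cell True k (us ! k))) [0..<tape_count M])"
      | "r = ([(True, 1, False, 0, St (fst (transition M q us)))], [(True, 0, False, 0, Tr q us)])"
      | k where "k < tape_count M"
        "r \<in> set (move_tmpls (True, 0, False, 0, Tr q us) k G (snd (transition M q us) ! k))"
      by (auto simp: trans_tmpls_def Let_def)
    then show ?thesis
    proof cases
      case 1
      then show ?thesis using sc by (auto simp: inst_rule_def list_all_iff cell_pos_def)
    next
      case 2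
      then show ?thesis using step(1) by (auto simp: inst_rule_def)
    next
      case 3
      then show ?thesis using mv by blast
    qed
  qed
  have blank: "tape_of ss (int p) = 0 \<Longrightarrow> tape_of ss (int p + 1) = 0"
  proof -
    have "p < length ss \<Longrightarrow> ss ! p \<noteq> 0" using ss nth_mem by fastforce
    then show "tape_of ss (int p) = 0 \<Longrightarrow> tape_of ss (int p + 1) = 0"
      by (auto simp: tape_of_def split: if_splits)
  qed
  from r consider "r = ([(False, 0, False, 0, St (start_state M))], [])"
    | "r = ([(False, 0, True, 1, Cell True 0 0)], [(False, 0, True, 0, Cell True 0 0)])"
    | "r = ([], [(True, 0, False, 0, St (reject_state M))])"
    | k where "0 < k" "k < tape_count M" "r = ([(False, 0, True, 0, Cell True k 0)], [])"
    | k where "k < tape_count M" "r = ([(False, 0, True, 0, Cell False k 0)], [])"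
    | q us where "(q, us) \<in> set QS" "r \<in> set (trans_tmpls M G (q, us))"
    unfolding tmpls_def by auto
  then show ?thesis
  proof cases
    case 1
    then show ?thesis by (auto simp: inst_rule_def run_def init_config_def)
  next
    case 2
    then show ?thesis using blank K by (auto simp: inst_rule_def cell_init cell_pos_def add.commute)
  next
    case 3
    then show ?thesis using rej by (auto simp: inst_rule_def)
  next
    case 4
    then show ?thesis by (auto simp: inst_rule_def cell_init)
  next
    case 5
    then show ?thesis by (cases "k = 0") (auto simp: inst_rule_def cell_init cell_pos_def tape_of_def)
  next
    case 6
    then show ?thesis using tr QS by blast
  qed
qed

lemma length_verifier_input: "length (verifier_input x w) = length x + 1 + length w"
  by (simp add: verifier_input_def bit_word_def)

lemma set_verifier_input: "set (verifier_input x w) \<subseteq> {1, 2, 3}"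
  using set_bit_word[of x] set_bit_word[of w] by (auto simp: verifier_input_def)

lemma tape_of_verifier_input:
  "i < length x \<Longrightarrow> tape_of (verifier_input x w) (int i) = bit_word x ! i"
  "tape_of (verifier_input x w) (int (length x)) = 3"
  "i < length w \<Longrightarrow> tape_of (verifier_input x w) (int (length x + 1 + i)) = (if w ! i then 2 else 1)"
  "length w \<le> i \<Longrightarrow> tape_of (verifier_input x w) (int (length x + 1 + i)) = 0"
proof -
  have l: "length (bit_word x) = length x" for x by (simp add: bit_word_def)
  have n: "tape_of ss (int i) = (if i < length ss then ss ! i else 0)" for ss i by (simp add: tape_of_def)
  show "i < length x \<Longrightarrow> tape_of (verifier_input x w) (int i) = bit_word x ! i"
    "tape_of (verifier_input x w) (int (length x)) = 3"
    "i < length w \<Longrightarrow> tape_of (verifier_input x w) (int (length x + 1 + i)) = (if w ! i then 2 else 1)"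
    "length w \<le> i \<Longrightarrow> tape_of (verifier_input x w) (int (length x + 1 + i)) = 0"
    unfolding n by (auto simp: verifier_input_def l nth_append) (auto simp: bit_word_def)
qed

lemma tableau_complete:
  assumes wf: "wf_machine M" and acc: "accepts M (verifier_input x w)" and w: "length w \<le> m"
    and QS: "\<And>q us. (q, us) \<in> set QS \<Longrightarrow> length us = tape_count M"
    and r: "r \<in> set (tableau (tmpls M G QS) (bit_word x) m N)"
  shows "sat_trule (run_atom M (verifier_input x w)) r"
proof -
  have l: "length (bit_word x) = length x" by (simp add: bit_word_def)
  have K: "0 < tape_count M" using wf by (simp add: wf_machine_def)
  from r consider i where "i < length x" "r = inst_rule 0 i (input_tmpl (bit_word x ! i))"
    | "r = inst_rule 0 (length x) (input_tmpl 3)"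
    | i where "i < m" "r = inst_rule 0 (length x + 1 + i) guess_tmpl"
    | "r = inst_rule 0 (length x + 1 + m) (input_tmpl 0)"
    | t p r' where "r' \<in> set (tmpls M G QS)" "r = inst_rule t p r'"
    unfolding tableau_def l by fastforce
  then show ?thesis
  proof cases
    case 1
    then show ?thesis using K by (simp add: inst_rule_def input_tmpl_def cell_init cell_pos_def tape_of_verifier_input)
  next
    case 2
    then show ?thesis using K by (simp add: inst_rule_def input_tmpl_def cell_init cell_pos_def tape_of_verifier_input)
  next
    case 3
    then show ?thesis
      using K tape_of_verifier_input(3,4)[where x = x and w = w and i = i]
      by (cases "i < length w") (auto simp: inst_rule_def guess_tmpl_def cell_init cell_pos_def)
  next
    case 4
    then show ?thesis
      using K tape_of_verifier_input(4)[OF w, of x] by (simp add: inst_rule_def input_tmpl_def cell_init cell_pos_def)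
  next
    case 5
    then show ?thesis using run_atom_tmpls[OF wf set_verifier_input acc, of QS r' G t p] QS by blast
  qed
qed

lemma sat_trule_inst1:
  "sat_trule v (inst_rule t p ([h], bs)) \<Longrightarrow> (\<And>b. b \<in> set bs \<Longrightarrow> v (inst t p b)) \<Longrightarrow> v (inst t p h)"
  by (auto simp: inst_rule_def list_all_iff)

text \<open>A model may contain more atoms than a run. It suffices that it contains all atoms of the
  run on some certificate, for then rejection of that certificate would violate a
  constraint.\<close>

lemma tableau_sound:
  assumes wf: "wf_machine M"
    and halt: "\<And>w. length w \<le> m \<Longrightarrow> halting M (fst (run M T (verifier_input x w)))"
    and T: "T < N" and N: "length x + m + 2 < N"
    and G: "symbols M \<subseteq> set G"
    and QS: "\<And>q us. q \<in> states M \<Longrightarrow> length us = tape_count M \<Longrightarrow> set us \<subseteq> symbols M \<Longrightarrow> (q, us) \<in> set QS"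
    and sat: "\<And>r. r \<in> set (tableau (tmpls M G QS) (bit_word x) m N) \<Longrightarrow> sat_trule v r"
  shows "\<exists>w. length w \<le> m \<and> accepts M (verifier_input x w)"
proof -
  have l: "length (bit_word x) = length x" by (simp add: bit_word_def)
  have K: "0 < tape_count M" using wf by (simp add: wf_machine_def)
  have tm: "sat_trule v (inst_rule t p r)" if "r \<in> set (tmpls M G QS)" "t < N" "p < N" for r t p
  proof (rule sat)
    show "inst_rule t p r \<in> set (tableau (tmpls M G QS) (bit_word x) m N)"
      unfolding tableau_def using that by force
  qed
  have in0: "v (0, i, Cell True 0 (bit_word x ! i))" if "i < length x" for i
  proof -
    have "sat_trule v (inst_rule 0 i (input_tmpl (bit_word x ! i)))"
      by (rule sat) (use that l in \<open>auto simp: tableau_def\<close>)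
    then show ?thesis by (simp add: inst_rule_def input_tmpl_def)
  qed
  have in1: "v (0, length x, Cell True 0 3)"
    using sat[of "inst_rule 0 (length x) (input_tmpl 3)"] l by (simp add: tableau_def inst_rule_def input_tmpl_def)
  have in2: "v (0, length x + 1 + i, Cell True 0 1) \<or> v (0, length x + 1 + i, Cell True 0 2) \<or>
      v (0, length x + 1 + i, Cell True 0 0)" if "i < m" for i
  proof -
    have "sat_trule v (inst_rule 0 (length x + 1 + i) guess_tmpl)"
      by (rule sat) (use that l in \<open>auto simp: tableau_def\<close>)
    then show ?thesis by (simp add: inst_rule_def guess_tmpl_def)
  qed
  have in3: "v (0, length x + 1 + m, Cell True 0 0)"
    using sat[of "inst_rule 0 (length x + 1 + m) (input_tmpl 0)"] l by (simp add: tableau_def inst_rule_def input_tmpl_def)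
  text \<open>The certificate ends at the first cell that the model declares blank.\<close>
  define n where "n = (LEAST j. v (0, length x + 1 + j, Cell True 0 0))"
  have n: "v (0, length x + 1 + n, Cell True 0 0)" "n \<le> m"
    "\<And>j. j < n \<Longrightarrow> \<not> v (0, length x + 1 + j, Cell True 0 0)"
    unfolding n_def using in3 by (auto intro: LeastI Least_le dest: not_less_Least)
  \<comment> \<open>If the model declares both bits of a cell true, the bit 2 is chosen.\<close>
  define w where "w = map (\<lambda>i. v (0, length x + 1 + i, Cell True 0 2)) [0..<n]"
  have lw: "length w = n" by (simp add: w_def)
  define ss where "ss = verifier_input x w"
  have blank: "p < N \<Longrightarrow> v (0, p, Cell True 0 0) \<Longrightarrow> v (0, Suc p, Cell True 0 0)" for p
    using tm[of "([(False, 0, True, 1, Cell True 0 0)], [(False, 0, True, 0, Cell True 0 0)])" 0 p] T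
    by (simp add: tmpls_def inst_rule_def)
  have "length x + 1 + n + j \<le> N \<Longrightarrow> v (0, length x + 1 + n + j, Cell True 0 0)" for j
    using n(1) blank by (induction j) auto
  then have blanks: "v (0, p, Cell True 0 0)" if "length x + 1 + n \<le> p" "p \<le> N" for p
    using that le_Suc_ex by blast
  have tape0: "v (0, p, Cell True 0 (tape_of ss (int p)))" if "p < N" for p
  proof -
    define i where "i = p - (length x + 1)"
    consider "p < length x" | "p = length x" | "i < n" "p = length x + 1 + i" | "n \<le> i" "p = length x + 1 + i"
      unfolding i_def by linarith
    then show ?thesis
    proof cases
      case 3
      then have "v (0, p, Cell True 0 (if w ! i then 2 else 1))"
        using in2[of i] n(2) n(3)[of i] by (auto simp: w_def)
      then show ?thesis using 3 lw tape_of_verifier_input(3)[of i w x] by (simp add: ss_def)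
    next
      case 4
      then show ?thesis using blanks[of p] that lw tape_of_verifier_input(4)[of w i x] by (simp add: ss_def)
    qed (use in0 in1 in \<open>simp_all add: ss_def tape_of_verifier_input\<close>)
  qed
  have oks: "config_ok M (run M t ss)" for t
    unfolding ss_def by (rule config_ok_run[OF wf set_verifier_input])
  \<comment> \<open>The known region is a triangle: a moving head reads one position further out, so
    every time step may lose the outermost cell.\<close>
  have known: "t < N \<Longrightarrow> v (t, 0, St (fst (run M t ss))) \<and>
      (\<forall>right. \<forall>k<tape_count M. \<forall>p<N - t. v (t, p, Cell right k (cell (run M t ss) k (cell_pos right p))))" for t
  proof (induction t)
    case 0
    have "v (0, 0, St (start_state M))"
      using tm[of "([(False, 0, False, 0, St (start_state M))], [])" 0 0] T
      by (simp add: tmpls_def inst_rule_def)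
    moreover have "v (0, p, Cell right k (cell (run M 0 ss) k (cell_pos right p)))"
      if k: "k < tape_count M" and p: "p < N" for right k p
    proof (cases "right \<and> k = 0")
      case True
      then show ?thesis using tape0[OF p] K by (simp add: cell_init cell_pos_def)
    next
      case False
      have "sat_trule v (inst_rule 0 p ([(False, 0, True, 0, Cell right k 0)], []))"
        by (rule tm) (use False k p T in \<open>cases right; force simp: tmpls_def\<close>)+
      moreover have "cell (run M 0 ss) k (cell_pos right p) = 0"
        using False k by (cases "k = 0") (auto simp: cell_init cell_pos_def tape_of_def)
      ultimately show ?thesis by (simp add: inst_rule_def)
    qed
    ultimately show ?case by (simp add: run_def init_config_def)
  next
    case (Suc t)
    define c where "c = run M t ss"
    define q where "q = fst c"
    define us where "us = scan M c"
    have t: "t < N" using Suc.prems by simp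
    have c: "v (t, 0, St q)"
      "\<And>right k p. k < tape_count M \<Longrightarrow> p < N - t \<Longrightarrow> v (t, p, Cell right k (cell c k (cell_pos right p)))"
      using Suc unfolding c_def q_def by auto
    have okc: "config_ok M c" unfolding c_def by (rule oks)
    note st = step_transition[OF wf okc]
    have QSm: "(q, us) \<in> set QS"
      using okc by (intro QS) (auto simp: q_def us_def config_ok_def scan_def)
    have tt: "sat_trule v (inst_rule t p r)" if "r \<in> set (trans_tmpls M G (q, us))" "p < N" for r p
      by (rule tm) (use that QSm t in \<open>auto simp: tmpls_def\<close>)
    have "sat_trule v (inst_rule t 0 ([(True, 0, False, 0, Tr q us)], (True, 0, False, 0, St q)
          # map (\<lambda>k. (True, 0, False, 0, Cell True k (us ! k))) [0..<tape_count M]))"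
      by (rule tt) (use t in \<open>auto simp: trans_tmpls_def Let_def\<close>)
    moreover have "v (t, 0, Cell True k (us ! k))" if "k < tape_count M" for k
      using c(2)[of k 0 True] that t by (simp add: us_def scan_def cell_pos_def)
    ultimately have Tr: "v (t, 0, Tr q us)" using c(1)
      by (auto simp: inst_rule_def list_all_iff)
    have "sat_trule v (inst_rule t 0 ([(True, 1, False, 0, St (fst (transition M q us)))], [(True, 0, False, 0, Tr q us)]))"
      by (rule tt) (use t in \<open>auto simp: trans_tmpls_def Let_def\<close>)
    with Tr have "v (Suc t, 0, St (fst (run M (Suc t) ss)))"
      using st(1) by (simp add: inst_rule_def run_Suc c_def q_def us_def)
    moreover have "v (Suc t, p, Cell right k (cell (run M (Suc t) ss) k (cell_pos right p)))"
      if k: "k < tape_count M" and p: "p < N - Suc t" for right k p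
    proof -
      obtain a d where ad: "snd (transition M q us) ! k = (a, d)" by fastforce
      let ?b = "(True, 0, False, 0, Tr q us)"
      have mt: "sat_trule v (inst_rule t p r)" if "r \<in> set (move_tmpls ?b k G (a, d))" "p < N" for r p
        by (rule tt) (use that k in \<open>auto simp: trans_tmpls_def Let_def ad[symmetric]\<close>)
      have sy: "cell c k j \<in> set G" for j using okc k G by (auto simp: config_ok_def)
      note cl = st(2)[OF k ad[unfolded q_def us_def], folded run_Suc, folded c_def]
      have rl: "v (inst t p h)"
        if "([h], bs) \<in> set (move_tmpls ?b k G (a, d))" "p < N" "\<And>b. b \<in> set bs \<Longrightarrow> v (inst t p b)" for h bs p
        using mt[OF that(1,2)] that(3) by (rule sat_trule_inst1)
      have step: "cell (run M (Suc t) ss) k j = (if j + move d 0 = 0 then a else cell c k (j + move d 0))" for j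
        using st(2)[OF k ad[unfolded q_def us_def]] by (simp add: c_def run_Suc)
      have C: "v (t, p, Cell right k (cell c k j))" if "p < N - t" "j = cell_pos right p" for right p j
        using c(2)[OF k that(1), of right] that(2) by simp
      have written: "v (Suc t, 0, Cell True k a)" if "d = Stay"
        using rl[of "(True, 1, False, 0, Cell True k a)" "[?b]" 0] that Tr t by simp
      have kept: "v (Suc t, p', Cell right' k (cell c k j))"
        if m: "([(True, 1, True, i', Cell right' k (cell c k j))], [?b, (True, 0, True, i, Cell right k (cell c k j))])
             \<in> set (move_tmpls ?b k G (a, d))"
          and "p' = e + i'" "e + i < N - t" "j = cell_pos right (e + i)" for right right' e p' i i' j
      proof -
        have "v (inst t e (True, 1, True, i', Cell right' k (cell c k j)))"
          by (rule rl[OF m]) (use Tr C[OF that(3,4)] that(3) in auto)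
        then show ?thesis using that(2) by simp
      qed
      show ?thesis
      proof (cases d)
        case Stay
        show ?thesis
        proof (cases right)
          case True
          show ?thesis
          proof (cases p)
            case 0
            then show ?thesis using written Stay True by (simp add: step cell_pos_def)
          next
            case (Suc p')
            then have "v (Suc t, p, Cell True k (cell c k (int p)))"
              using p sy[of "int p"] Stay by (intro kept[of 1 _ _ 1 True p p']) (auto simp: cell_pos_def)
            then show ?thesis using Suc Stay True by (simp add: step cell_pos_def)
          qed
        next
          case False
          have "v (Suc t, p, Cell False k (cell c k (- 1 - int p)))"
            using p sy[of "- 1 - int p"] Stay by (intro kept[of 0 _ _ 0 False p p]) (auto simp: cell_pos_def)
          then show ?thesis using Stay False by (simp add: step cell_pos_def)
        qed
      next
        case MoveRight
        show ?thesis
        proof (cases right)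
          case True
          have "v (Suc t, p, Cell True k (cell c k (int p + 1)))"
            using p sy[of "int p + 1"] MoveRight by (intro kept[of 0 _ _ 1 True p p]) (auto simp: cell_pos_def)
          then show ?thesis using MoveRight True by (simp add: step cell_pos_def)
        next
          case False
          show ?thesis
          proof (cases p)
            case 0
            then show ?thesis using rl[of "(True, 1, False, 0, Cell False k a)" "[?b]" 0] MoveRight False Tr t
              by (simp add: step cell_pos_def)
          next
            case (Suc p')
            then have "v (Suc t, p, Cell False k (cell c k (- int p)))"
              using p sy[of "- int p"] MoveRight by (intro kept[of 1 _ _ 0 False p p']) (auto simp: cell_pos_def)
            then show ?thesis using Suc MoveRight False by (simp add: step cell_pos_def)
          qed
        qed
      next
        case MoveLeft
        show ?thesis
        proof (cases right)
          case True
          consider "p = 0" | "p = 1" | p' where "p = Suc (Suc p')" by (metis One_nat_def not0_implies_Suc)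
          then show ?thesis
          proof cases
            case 1
            have "v (inst t 0 (True, 1, False, 0, Cell True k (cell c k (- 1))))"
              by (rule rl[of _ "[?b, (True, 0, False, 0, Cell False k (cell c k (- 1)))]"])
                (use sy[of "- 1"] MoveLeft Tr t C[of 0 "- 1" False] in \<open>auto simp: cell_pos_def\<close>)
            then show ?thesis using 1 MoveLeft True by (simp add: step cell_pos_def)
          next
            case 2
            then show ?thesis using rl[of "(True, 1, False, 1, Cell True k a)" "[?b]" 0] MoveLeft True Tr t
              by (simp add: step cell_pos_def)
          next
            case 3
            then have "v (Suc t, p, Cell True k (cell c k (int p - 1)))"
              using p sy[of "int p - 1"] MoveLeft by (intro kept[of 2 _ _ 1 True p p']) (auto simp: cell_pos_def)
            then show ?thesis using 3 MoveLeft True by (simp add: step cell_pos_def)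
          qed
        next
          case False
          have "v (Suc t, p, Cell False k (cell c k (- 2 - int p)))"
            using p sy[of "- 2 - int p"] MoveLeft by (intro kept[of 0 _ _ 1 False p p]) (auto simp: cell_pos_def)
          then show ?thesis using MoveLeft False by (simp add: step cell_pos_def)
        qed
      qed
    qed
    ultimately show ?case by blast
  qed
  \<comment> \<open>At time \<open>T\<close> the run has halted, so not rejecting means
    accepting.\<close>
  have "fst (run M T ss) \<noteq> reject_state M"
    using known[OF T] tm[of "([], [(True, 0, False, 0, St (reject_state M))])" T 0] T
    by (auto simp: tmpls_def inst_rule_def)
  then have "accepts M ss" using halt[of w] n(2) lw by (auto simp: halting_def accepts_def ss_def)
  then show ?thesis using n(2) lw unfolding ss_def by blast
qed

section \<open>Writing tableaux as programs\<close>

fun nat_of_bits :: "bool list \<Rightarrow> nat" where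
  "nat_of_bits [] = 0"
| "nat_of_bits (b # bs) = of_bool b + 2 * nat_of_bits bs"

lemma nat_of_bits_pos: "bs \<noteq> [] \<Longrightarrow> last bs \<Longrightarrow> nat_of_bits bs > 0"
  by (induction bs) (auto split: if_splits)

lemma enc_nat_of_bits: "bs = [] \<or> last bs \<Longrightarrow>
  enc_nat (nat_of_bits bs) = concat (map (\<lambda>b. [True, b]) bs) @ [False]"
proof (induction bs)
  case Nil
  then show ?case by (simp add: enc_nat.simps)
next
  case (Cons b bs)
  then have "nat_of_bits (b # bs) > 0" using nat_of_bits_pos[of "b # bs"] by simp
  moreover have "bs = [] \<or> last bs" using Cons.prems by (cases bs) auto
  ultimately show ?case using Cons.IH by (simp add: enc_nat.simps[of "of_bool b + 2 * nat_of_bits bs"])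
qed

text \<open>The binary digits of the atom are three unary blocks, which a loop over time or position
  can print. The number is huge but its encoding is linear in the blocks. The final
  \<open>True\<close> is a nonzero leading digit, so the digits are canonical.\<close>

definition atom_bits :: "tatom \<Rightarrow> bool list" where
  "atom_bits a = (case a of (t, p, c) \<Rightarrow>
     replicate t True @ [False] @ replicate p True @ [False] @ replicate (to_nat c) True @ [True])"

definition atom_nat :: "tatom \<Rightarrow> nat" where
  "atom_nat a = nat_of_bits (atom_bits a)"

lemma enc_atom_nat: "enc_nat (atom_nat a) = concat (map (\<lambda>b. [True, b]) (atom_bits a)) @ [False]"
  unfolding atom_nat_def by (rule enc_nat_of_bits) (auto simp: atom_bits_def split: prod.splits)

lemma replicate_True_inj:
  "replicate m True @ False # xs = replicate n True @ False # ys \<longleftrightarrow> m = n \<and> xs = ys"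
proof (induction m arbitrary: n)
  case 0
  then show ?case by (cases n) auto
next
  case (Suc m)
  then show ?case by (cases n) auto
qed

lemma inj_atom_nat: "atom_nat a = atom_nat b \<longleftrightarrow> a = b"
proof
  assume "atom_nat a = atom_nat b"
  then have "concat (map (\<lambda>b. [True, b]) (atom_bits a)) = concat (map (\<lambda>b. [True, b]) (atom_bits b))"
    using enc_atom_nat[of a] enc_atom_nat[of b] by simp
  moreover have "concat (map (\<lambda>b. [True, b]) xs) = concat (map (\<lambda>b. [True, b]) ys) \<Longrightarrow> xs = ys" for xs ys :: "bool list"
  proof (induction xs arbitrary: ys)
    case (Cons x xs)
    then show ?case by (cases ys) auto
  qed (auto simp: concat_eq_Nil_conv)
  ultimately have "atom_bits a = atom_bits b" by blast
  then show "a = b"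
    by (auto simp: atom_bits_def replicate_True_inj replicate_append_same split: prod.splits dest!: arg_cong[of "_ # _" _ length])
qed simp

definition rule_of :: "trule \<Rightarrow> nat elp_rule" where
  "rule_of r = ELP_Rule (map atom_nat (fst r)) (map (\<lambda>a. Lit (Pos (atom_nat a))) (snd r))"

definition rule_atom_list :: "trule \<Rightarrow> nat list" where
  "rule_atom_list r = map atom_nat (fst r @ snd r)"

text \<open>No here-and-there interpretation satisfies the empty constraint, so this program has no
  world view in any context.\<close>

definition falsity :: fin_elp where
  "falsity = ([], [ELP_Rule [] []])"

definition instance_of :: "trule list \<Rightarrow> fin_elp \<times> fin_elp" where
  "instance_of R = ((concat (map rule_atom_list R), map rule_of R), falsity)"

lemma ht_model_rule_of:
  "ht_model I (rule_of ` R) Y Y \<longleftrightarrow> (\<forall>r \<in> R. sat_trule (\<lambda>a. atom_nat a \<in> Y) r)"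
  unfolding ht_model_def ht_rule_def rule_of_def sat_trule_def by (auto simp: list_all_iff list_ex_iff)

lemma is_elp_instance_of: "is_elp (elp_of (fst (instance_of R)))" "is_elp (elp_of (snd (instance_of R)))"
  by (auto simp: is_elp_def elp_of_def instance_of_def rule_of_def rule_atom_list_def falsity_def)

text \<open>Only the generated program can be the satisfied side of a witness, and separation from
  \<open>falsity\<close> is then automatic. Its rules have no epistemic literals, so a witness
  amounts to one classical model.\<close>

lemma strongly_equivalent_falsity:
  "\<not> strongly_equivalent (elp_of (fst (instance_of R))) (elp_of (snd (instance_of R))) \<longleftrightarrow>
   (\<exists>v. \<forall>r \<in> set R. sat_trule v r)"
proof -
  let ?P = "elp_of (fst (instance_of R))" and ?F = "elp_of (snd (instance_of R))"
  have P: "snd ?P = rule_of ` set R" and F: "fst ?F = {}" "snd ?F = {ELP_Rule [] []}"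
    by (auto simp: instance_of_def elp_of_def falsity_def)
  have no: "\<not> ht_model I {ELP_Rule [] []} X Y" for I :: "nat literal set" and X Y
    by (simp add: ht_model_def ht_rule_def)
  have fin: "finite (fst ?P)" "finite (fst ?F)" by (auto simp: elp_of_def)
  have "\<not> witness ?F ?P \<J> X Y" for \<J> X Y
    unfolding witness_def Let_def F using no by blast
  then have "\<not> strongly_equivalent ?P ?F \<longleftrightarrow> (\<exists>\<J> X Y. witness ?P ?F \<J> X Y)"
    using strongly_equivalent_iff_no_witness[OF fin is_elp_instance_of] by blast
  also have "\<dots> \<longleftrightarrow> (\<exists>v. \<forall>r \<in> set R. sat_trule v r)"
  proof
    assume "\<exists>\<J> X Y. witness ?P ?F \<J> X Y"
    then obtain \<J> X Y where "witness ?P ?F \<J> X Y" by blast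
    then have "ht_model (status (fst ?P \<union> fst ?F) \<J>) (rule_of ` set R) Y Y"
      unfolding witness_def Let_def P[symmetric] using ht_model_same by blast
    then show "\<exists>v. \<forall>r \<in> set R. sat_trule v r"
      unfolding ht_model_rule_of by (intro exI[of _ "\<lambda>a. atom_nat a \<in> Y"])
  next
    assume "\<exists>v. \<forall>r \<in> set R. sat_trule v r"
    then obtain v where v: "\<forall>r \<in> set R. sat_trule v r" by blast
    \<comment> \<open>Only atoms occurring in \<open>R\<close> are kept, so that \<open>Y\<close>
      stays inside the declared atoms; injectivity of \<open>atom_nat\<close> preserves the
      valuation on them.\<close>
    define Y where "Y = {atom_nat a | a r. r \<in> set R \<and> a \<in> set (fst r @ snd r) \<and> v a}"
    have Yv: "atom_nat a \<in> Y \<longleftrightarrow> v a" if "r \<in> set R" "a \<in> set (fst r @ snd r)" for a r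
    proof
      assume "atom_nat a \<in> Y"
      then obtain a' where "atom_nat a = atom_nat a'" "v a'" unfolding Y_def by blast
      then show "v a" by (simp add: inj_atom_nat)
    next
      assume "v a"
      then show "atom_nat a \<in> Y" unfolding Y_def using that by blast
    qed
    have "sat_trule (\<lambda>a. atom_nat a \<in> Y) r" if "r \<in> set R" for r
    proof -
      have "sat_trule v r \<longleftrightarrow> sat_trule (\<lambda>a. atom_nat a \<in> Y) r"
        using Yv[OF that] unfolding sat_trule_def list_all_iff list_ex_iff by simp
      then show ?thesis using v that by blast
    qed
    then have m: "ht_model I (snd ?P) Y Y" for I unfolding P ht_model_rule_of by simp
    have "Y \<subseteq> fst ?P" unfolding Y_def by (auto simp: elp_of_def instance_of_def rule_atom_list_def)
    then have "witness ?P ?F {Y} Y Y" unfolding witness_def Let_def F using m no by auto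
    then show "\<exists>\<J> X Y. witness ?P ?F \<J> X Y" by blast
  qed
  finally show ?thesis .
qed

lemma enc_list_concat: "enc_list f xs = concat (map (\<lambda>x. True # f x) xs) @ [False]"
  by (induction xs) auto

lemma enc_instance_of:
  "enc_instance (instance_of R) =
     concat (map (\<lambda>r. concat (map (\<lambda>a. True # enc_nat (atom_nat a)) (fst r @ snd r))) R) @ [False] @
     concat (map (\<lambda>r. True # enc_rule (rule_of r)) R) @ [False] @ enc_elp falsity"
proof -
  have "concat (map (\<lambda>x. True # enc_nat x) (concat (map rule_atom_list R))) =
    concat (map (\<lambda>r. concat (map (\<lambda>a. True # enc_nat (atom_nat a)) (fst r @ snd r))) R)"
    by (induction R) (auto simp: rule_atom_list_def comp_def)
  then show ?thesis
    by (simp add: enc_instance_def instance_of_def enc_elp_def enc_list_concat comp_def)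
qed

section \<open>A loop program that writes the instance\<close>

definition seqs :: "com list \<Rightarrow> com" where
  "seqs cs = foldr Seq cs Skip"

lemma ev_seqs [simp]: "ev (seqs []) \<sigma> = \<sigma>" "ev (seqs (c # cs)) \<sigma> = ev (seqs cs) (ev c \<sigma>)"
  by (simp_all add: seqs_def)

lemma wf_seqs [simp]: "wf_com k B out F (seqs cs) \<longleftrightarrow> (\<forall>c \<in> set cs. wf_com k B out F c)"
  by (induction cs) (auto simp: seqs_def)

lemma tiered_seqs [simp]: "tiered tier m (seqs cs) \<longleftrightarrow> (\<forall>c \<in> set cs. tiered tier m c)"
  by (induction cs) (auto simp: seqs_def)

definition inc :: "nat \<Rightarrow> nat \<Rightarrow> regs \<Rightarrow> regs" where
  "inc r n \<sigma> = \<sigma>(r := replicate n 1 @ \<sigma> r)"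

lemma inc_inc: "inc r a (inc r b \<sigma>) = inc r (a + b) \<sigma>"
  by (simp add: inc_def replicate_add)

lemma inc_0 [simp]: "inc r 0 \<sigma> = \<sigma>"
  by (simp add: inc_def)

lemma inc_apply: "inc r n \<sigma> q = (if q = r then replicate n 1 @ \<sigma> r else \<sigma> q)"
  by (simp add: inc_def)

text \<open>This evaluates a monomial in unary. Loops cannot be nested over the same register, so a
  power requires several registers of equal length.\<close>

fun count_up :: "nat \<Rightarrow> nat \<Rightarrow> nat list \<Rightarrow> com" where
  "count_up r n [] = seqs (replicate n (Push r 1))"
| "count_up r n (q # rs) = For q (\<lambda>_. count_up r n rs)"

lemma ev_count_up: "r \<notin> set rs \<Longrightarrow> ev (count_up r n rs) \<sigma> = inc r (n * (\<Prod>q\<leftarrow>rs. length (\<sigma> q))) \<sigma>"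
proof (induction rs arbitrary: \<sigma>)
  case Nil
  have "ev (seqs (replicate n (Push r 1))) \<sigma> = inc r n \<sigma>"
    by (induction n arbitrary: \<sigma>) (auto simp: inc_def fun_eq_iff replicate_app_Cons_same)
  then show ?case by simp
next
  case (Cons q rs)
  note IH = Cons.IH and r = Cons.prems
  have "fold (\<lambda>_. ev (count_up r n rs)) xs \<tau> = inc r (length xs * (n * (\<Prod>q\<leftarrow>rs. length (\<sigma> q)))) \<tau>"
    if "\<forall>q \<in> set rs. \<tau> q = \<sigma> q" for xs \<tau>
    using that
  proof (induction xs arbitrary: \<tau>)
    case (Cons x xs)
    have "map (\<lambda>q. length (\<tau> q)) rs = map (\<lambda>q. length (\<sigma> q)) rs" using Cons.prems by simp
    then have "(\<Prod>q\<leftarrow>rs. length (\<tau> q)) = (\<Prod>q\<leftarrow>rs. length (\<sigma> q))" by (rule arg_cong)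
    then have 1: "ev (count_up r n rs) \<tau> = inc r (n * (\<Prod>q\<leftarrow>rs. length (\<sigma> q))) \<tau>"
      using r IH[of \<tau>] by simp
    have "\<forall>q \<in> set rs. inc r (n * (\<Prod>q\<leftarrow>rs. length (\<sigma> q))) \<tau> q = \<sigma> q"
      using Cons.prems r by (auto simp: inc_apply)
    from Cons.IH[OF this] show ?case by (simp add: 1 inc_inc add.commute)
  qed simp
  from this[of \<sigma> "\<sigma> q"] show ?case by (simp add: mult.left_commute)
qed

lemma wf_count_up:
  "r < k \<Longrightarrow> 1 < B \<Longrightarrow> r \<notin> set rs \<Longrightarrow> r \<notin> F \<Longrightarrow> distinct rs \<Longrightarrow> set rs \<inter> F = {} \<Longrightarrow> set rs \<subseteq> {..<k} - {out} \<Longrightarrow>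
   wf_com k B out F (count_up r n rs)"
  by (induction rs arbitrary: F) auto

lemma tiered_count_up: "tier r < m \<Longrightarrow> (\<And>q. q \<in> set rs \<Longrightarrow> tier r < tier q) \<Longrightarrow> tiered tier m (count_up r n rs)"
  by (induction rs arbitrary: m) auto

text \<open>Registers of the generator: input, certificate length, two copies of the size of the grid,
  current time, current position, the output, and copies for computing polynomials.\<close>

abbreviation (input) "rX \<equiv> 0"
abbreviation (input) "rM \<equiv> 1"
abbreviation (input) "rN \<equiv> 2"
abbreviation (input) "rN' \<equiv> 3"
abbreviation (input) "rT \<equiv> 4"
abbreviation (input) "rP \<equiv> 5"

definition outs :: "nat \<Rightarrow> bool list \<Rightarrow> com" where
  "outs out bs = seqs (map (Push out) (bit_word bs))"

lemma ev_outs: "ev (outs out bs) \<sigma> = \<sigma>(out := rev (bit_word bs) @ \<sigma> out)"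
proof -
  have "ev (seqs (map (Push out) xs)) \<sigma> = \<sigma>(out := rev xs @ \<sigma> out)" for xs
    by (induction xs arbitrary: \<sigma>) auto
  then show ?thesis by (simp add: outs_def)
qed

lemma bit_word_append: "bit_word (xs @ ys) = bit_word xs @ bit_word ys"
  by (simp add: bit_word_def)

text \<open>All output steps of the generator have this shape, with output depending on time and position.\<close>
definition writes :: "nat \<Rightarrow> com \<Rightarrow> (nat \<Rightarrow> nat \<Rightarrow> bool list) \<Rightarrow> bool" where
  "writes out c g \<longleftrightarrow> (\<forall>\<sigma> t p. \<sigma> rT = replicate t 1 \<longrightarrow> \<sigma> rP = replicate p 1 \<longrightarrow>
     ev c \<sigma> = \<sigma>(out := rev (bit_word (g t p)) @ \<sigma> out))"

lemma writesD: "writes out c g \<Longrightarrow> \<sigma> rT = replicate t 1 \<Longrightarrow> \<sigma> rP = replicate p 1 \<Longrightarrow>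
    ev c \<sigma> = \<sigma>(out := rev (bit_word (g t p)) @ \<sigma> out)"
  by (simp add: writes_def)

lemma writes_outs: "writes out (outs out bs) (\<lambda>_ _. bs)"
  by (simp add: writes_def ev_outs)

lemma writes_Seq: "5 < out \<Longrightarrow> writes out a g \<Longrightarrow> writes out b h \<Longrightarrow> writes out (a ;; b) (\<lambda>t p. g t p @ h t p)"
  unfolding writes_def by (auto simp: bit_word_append)

lemma writes_seqs:
  "5 < out \<Longrightarrow> (\<And>x. x \<in> set xs \<Longrightarrow> writes out (c x) (g x)) \<Longrightarrow>
   writes out (seqs (map c xs)) (\<lambda>t p. concat (map (\<lambda>x. g x t p) xs))"
proof (induction xs)
  case Nil
  then show ?case by (simp add: writes_def bit_word_def)
next
  case (Cons x xs)
  then show ?case using writes_Seq[of out "c x" "g x" "seqs (map c xs)"] by (simp add: seqs_def)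
qed

lemma ev_For_outs:
  "q \<noteq> out \<Longrightarrow> ev (For q (\<lambda>_. outs out bs)) \<sigma> = \<sigma>(out := rev (bit_word (concat (replicate (length (\<sigma> q)) bs))) @ \<sigma> out)"
proof -
  assume "q \<noteq> out"
  have "fold (\<lambda>_. ev (outs out bs)) xs \<tau> = \<tau>(out := rev (bit_word (concat (replicate (length xs) bs))) @ \<tau> out)" for xs \<tau>
  proof (induction xs arbitrary: \<tau>)
    case (Cons x xs)
    show ?case unfolding fold.simps o_apply Cons unfolding ev_outs by (simp add: bit_word_append)
  qed (simp add: bit_word_def)
  then show ?thesis by simp
qed

text \<open>In \<open>enc_nat\<close> every digit is preceded by \<open>True\<close>, so a unary
  block is the pair \<open>[True, True]\<close> repeated and a separator is
  \<open>[True, False]\<close>. The last block carries the leading digit and the end mark.\<close>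

fun emit_atom :: "nat \<Rightarrow> tmpl \<Rightarrow> com" where
  "emit_atom out (ut, dt, up, dp, c) =
     (if ut then For rT (\<lambda>_. outs out [True, True]) else Skip) ;;
     outs out (concat (replicate dt [True, True]) @ [True, False]) ;;
     (if up then For rP (\<lambda>_. outs out [True, True]) else Skip) ;;
     outs out (concat (replicate dp [True, True]) @ [True, False]) ;;
     outs out (concat (replicate (to_nat c) [True, True]) @ [True, True, False])"

lemma writes_emit_atom: "5 < out \<Longrightarrow> writes out (emit_atom out b) (\<lambda>t p. enc_nat (atom_nat (inst t p b)))"
proof -
  assume out: "5 < out"
  obtain ut dt up dp c where b: "b = (ut, dt, up, dp, c)" by (cases b) auto
  have 1: "writes out (if ut then For rT (\<lambda>_. outs out [True, True]) else Skip)
      (\<lambda>t p. concat (replicate (if ut then t else 0) [True, True]))"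
    using out by (auto simp: writes_def ev_For_outs bit_word_def simp del: ev.simps(7))
  have 2: "writes out (if up then For rP (\<lambda>_. outs out [True, True]) else Skip)
      (\<lambda>t p. concat (replicate (if up then p else 0) [True, True]))"
    using out by (auto simp: writes_def ev_For_outs bit_word_def simp del: ev.simps(7))
  have "concat (map (\<lambda>b. [True, b]) (replicate n True)) = concat (replicate n [True, True])" for n
    by (induction n) auto
  then have "enc_nat (atom_nat (inst t p b)) =
     concat (replicate (if ut then t else 0) [True, True]) @
     (concat (replicate dt [True, True]) @ [True, False]) @
     concat (replicate (if up then p else 0) [True, True]) @
     (concat (replicate dp [True, True]) @ [True, False]) @
     (concat (replicate (to_nat c) [True, True]) @ [True, True, False])" for t p
    unfolding enc_atom_nat b inst.simps atom_bits_def prod.case by (simp add: replicate_add)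
  then show ?thesis
    unfolding b emit_atom.simps by (simp only:) (intro writes_Seq out 1 2 writes_outs)
qed

definition emit_atoms :: "nat \<Rightarrow> rtmpl \<Rightarrow> com" where
  "emit_atoms out r = seqs (map (\<lambda>b. outs out [True] ;; emit_atom out b) (fst r @ snd r))"

text \<open>The prefix \<open>[True, False, True]\<close> of a body atom consists of the list mark,
  the tag of \<open>Lit\<close> and the tag of \<open>Pos\<close>.\<close>

definition emit_rule :: "nat \<Rightarrow> rtmpl \<Rightarrow> com" where
  "emit_rule out r = outs out [True] ;;
     seqs (map (\<lambda>b. outs out [True] ;; emit_atom out b) (fst r)) ;; outs out [False] ;;
     seqs (map (\<lambda>b. outs out [True, False, True] ;; emit_atom out b) (snd r)) ;; outs out [False]"

lemma writes_emit_atoms: "5 < out \<Longrightarrow> writes out (emit_atoms out r)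
    (\<lambda>t p. concat (map (\<lambda>a. True # enc_nat (atom_nat a)) (fst (inst_rule t p r) @ snd (inst_rule t p r))))"
proof -
  assume out: "5 < out"
  have "writes out (emit_atoms out r) (\<lambda>t p. concat (map (\<lambda>b. [True] @ enc_nat (atom_nat (inst t p b))) (fst r @ snd r)))"
    unfolding emit_atoms_def by (intro writes_seqs writes_Seq out writes_outs writes_emit_atom)
  then show ?thesis by (simp add: inst_rule_def comp_def)
qed

lemma writes_emit_rule: "5 < out \<Longrightarrow> writes out (emit_rule out r) (\<lambda>t p. True # enc_rule (rule_of (inst_rule t p r)))"
proof -
  assume out: "5 < out"
  have "writes out (emit_rule out r) (\<lambda>t p. [True] @
     concat (map (\<lambda>b. [True] @ enc_nat (atom_nat (inst t p b))) (fst r)) @ [False] @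
     concat (map (\<lambda>b. [True, False, True] @ enc_nat (atom_nat (inst t p b))) (snd r)) @ [False])"
    unfolding emit_rule_def by (intro writes_seqs writes_Seq out writes_outs writes_emit_atom)
  then show ?thesis by (simp add: inst_rule_def rule_of_def enc_rule_def enc_list_concat comp_def)
qed

text \<open>The program follows the order of \<^const>\<open>tableau\<close>; \<open>e\<close> writes the atoms or the text of a rule.\<close>
definition walk :: "(rtmpl \<Rightarrow> com) \<Rightarrow> rtmpl list \<Rightarrow> com" where
  "walk e R =
     For rX (\<lambda>s. e (input_tmpl s) ;; Push rP 1) ;; e (input_tmpl 3) ;; Push rP 1 ;;
     For rM (\<lambda>_. e guess_tmpl ;; Push rP 1) ;; e (input_tmpl 0) ;; Clear rP ;;
     For rN (\<lambda>_. For rN' (\<lambda>_. seqs (map e R) ;; Push rP 1) ;; Clear rP ;; Push rT 1) ;; Clear rT"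

lemma concat_concat_map: "concat (concat xss) = concat (map concat xss)"
  by (induction xss) auto

lemma upt_0_Suc: "[0..<Suc n] = 0 # map Suc [0..<n]"
  by (simp add: upt_conv_Cons map_Suc_upt del: upt_Suc)

lemma ev_walk:
  assumes out: "5 < out" and e: "\<And>r. writes out (e r) (\<lambda>t p. g (inst_rule t p r))"
    and \<sigma>: "length (\<sigma> rM) = m" "length (\<sigma> rN) = N" "length (\<sigma> rN') = N" "\<sigma> rT = []" "\<sigma> rP = []"
  shows "ev (walk e R) \<sigma> = \<sigma>(out := rev (bit_word (concat (map g (tableau R (\<sigma> rX) m N)))) @ \<sigma> out)"
proof -
  define st where "st \<tau> t p bs = \<tau>(rT := replicate t 1, rP := replicate p 1, out := rev (bit_word bs) @ \<tau> out)"
    for \<tau> :: regs and t p bs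
  have e': "ev (e r) (st \<tau> t p bs) = st \<tau> t p (bs @ g (inst_rule t p r))" for r \<tau> t p bs
  proof -
    have "ev (e r) (st \<tau> t p bs) = (st \<tau> t p bs)(out := rev (bit_word (g (inst_rule t p r))) @ st \<tau> t p bs out)"
      using out by (intro writesD[OF e]) (simp_all add: st_def)
    then show ?thesis by (simp add: st_def bit_word_append)
  qed
  have push: "ev (Push rP 1) (st \<tau> t p bs) = st \<tau> t (Suc p) bs" for \<tau> t p bs
    using out by (simp add: st_def fun_upd_twist)
  have X: "fold (\<lambda>s. ev (e (input_tmpl s) ;; Push rP 1)) ss (st \<tau> t p bs) =
      st \<tau> t (p + length ss) (bs @ concat (map (\<lambda>i. g (inst_rule t (p + i) (input_tmpl (ss ! i)))) [0..<length ss]))"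
    for ss t p bs \<tau>
  proof (induction ss arbitrary: p bs)
    case (Cons s ss)
    show ?case unfolding fold.simps o_apply ev.simps(5) e' push Cons[unfolded ev.simps(5)] list.size upt_0_Suc
      by (simp add: upt_0_Suc comp_def del: upt_Suc)
  qed simp
  have G: "fold (\<lambda>_. ev (c ;; Push rP 1)) ss (st \<tau> t p bs) =
      st \<tau> t (p + length ss) (bs @ concat (map (\<lambda>i. h t (p + i)) [0..<length ss]))"
    if c: "\<And>t p bs. ev c (st \<tau> t p bs) = st \<tau> t p (bs @ h t p)" for c h t p bs \<tau> and ss :: "nat list"
  proof (induction ss arbitrary: p bs)
    case (Cons s ss)
    show ?case unfolding fold.simps o_apply ev.simps(5) c push Cons[unfolded ev.simps(5)]
      by (simp add: upt_0_Suc comp_def del: upt_Suc)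
  qed simp
  have R: "ev (seqs (map e R)) (st \<tau> t p bs) = st \<tau> t p (bs @ concat (map (\<lambda>r. g (inst_rule t p r)) R))" for t p bs \<tau>
    by (induction R arbitrary: bs) (simp_all add: e')
  have clear: "ev (Clear rP) (st \<tau> t p bs) = st \<tau> t 0 bs" for \<tau> t p bs
    using out by (simp add: st_def fun_upd_twist)
  have T: "ev (Push rT 1) (st \<tau> t p bs) = st \<tau> (Suc t) p bs" for \<tau> t p bs
    using out by (simp add: st_def fun_upd_twist)
  define row where "row = (\<lambda>t. concat (map (\<lambda>p. concat (map (\<lambda>r. g (inst_rule t p r)) R)) [0..<N]))"
  have regs: "st \<tau> t p bs rX = \<tau> rX" "st \<tau> t p bs rM = \<tau> rM" "st \<tau> t p bs rN = \<tau> rN" "st \<tau> t p bs rN' = \<tau> rN'" for \<tau> t p bs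
    using out by (auto simp: st_def)
  have body: "ev (For rN' (\<lambda>_. seqs (map e R) ;; Push rP 1) ;; Clear rP ;; Push rT 1) (st \<sigma> t 0 bs) =
     st \<sigma> (Suc t) 0 (bs @ row t)" for t bs
    using G[OF R, where ss = "\<sigma> rN'" and p = 0] unfolding ev.simps(7) ev.simps(5)[of "For _ _"] ev.simps(5)[of "Clear _"] regs
    by (simp only: clear T \<sigma>(3) add_0 row_def)
  have grid: "fold (\<lambda>_. ev (For rN' (\<lambda>_. seqs (map e R) ;; Push rP 1) ;; Clear rP ;; Push rT 1)) ss (st \<sigma> t 0 bs) =
     st \<sigma> (t + length ss) 0 (bs @ concat (map (\<lambda>i. row (t + i)) [0..<length ss]))" for ss :: "nat list" and t bs
  proof (induction ss arbitrary: t bs)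
    case (Cons s ss)
    show ?case unfolding fold.simps o_apply body Cons by (simp add: upt_0_Suc comp_def del: upt_Suc)
  qed simp
  have init: "\<sigma> = st \<sigma> 0 0 []" using \<sigma>(4,5) by (auto simp: st_def fun_eq_iff bit_word_def)
  have final: "ev (Clear rT) (st \<sigma> t 0 bs) = \<sigma>(out := rev (bit_word bs) @ \<sigma> out)" for t bs
    using \<sigma>(4,5) out by (auto simp: st_def fun_eq_iff)
  let ?A = "concat (map (\<lambda>i. g (inst_rule 0 i (input_tmpl (\<sigma> rX ! i)))) [0..<length (\<sigma> rX)])"
  let ?n = "length (\<sigma> rX)"
  have 1: "ev (For rX (\<lambda>s. e (input_tmpl s) ;; Push rP 1)) (st \<sigma> 0 0 []) = st \<sigma> 0 ?n ?A"
    using X[of "\<sigma> rX" \<sigma> 0 0 "[]"] unfolding ev.simps(7) regs by simp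
  have 2: "ev (For rM (\<lambda>_. e guess_tmpl ;; Push rP 1)) (st \<sigma> 0 p bs) =
      st \<sigma> 0 (p + m) (bs @ concat (map (\<lambda>i. g (inst_rule 0 (p + i) guess_tmpl)) [0..<m]))" for p bs
    using G[OF e', where ss = "\<sigma> rM"] \<sigma>(1) unfolding ev.simps(7) regs by simp
  have 3: "ev (For rN (\<lambda>_. For rN' (\<lambda>_. seqs (map e R) ;; Push rP 1) ;; Clear rP ;; Push rT 1)) (st \<sigma> 0 0 bs) =
      st \<sigma> N 0 (bs @ concat (map row [0..<N]))" for bs
    using grid[of "\<sigma> rN" 0 bs] \<sigma>(2) unfolding ev.simps(7)[of rN] regs by simp
  have "ev (walk e R) (st \<sigma> 0 0 []) = \<sigma>(out := rev (bit_word (concat (map g (tableau R (\<sigma> rX) m N)))) @ \<sigma> out)"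
    unfolding walk_def ev.simps(5)[of "For rX _"] ev.simps(5)[of "For rM _"] ev.simps(5)[of "For rN _"]
      ev.simps(5)[of "e _"] ev.simps(5)[of "Push rP 1"] ev.simps(5)[of "Clear rP"] 1 2 3 e' push clear final
    by (simp add: tableau_def row_def comp_def map_concat concat_concat_map)
  then show ?thesis using init by simp
qed

lemma wf_outs: "out \<notin> F \<Longrightarrow> wf_com (Suc out) 4 out F (outs out bs)"
  by (auto simp: outs_def bit_word_def)

lemma wf_emit_atom: "5 < out \<Longrightarrow> F \<inter> {rT, rP, out} = {} \<Longrightarrow> wf_com (Suc out) 4 out F (emit_atom out b)"
  by (cases b) (auto simp: wf_outs)

lemma wf_emit:
  assumes "5 < out" "F \<inter> {rT, rP, out} = {}"
  shows "wf_com (Suc out) 4 out F (emit_atoms out r)" "wf_com (Suc out) 4 out F (emit_rule out r)"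
  using assms by (auto simp: emit_atoms_def emit_rule_def wf_outs intro!: wf_emit_atom)

lemma wf_walk:
  assumes "5 < out" "\<And>r F. F \<inter> {rT, rP, out} = {} \<Longrightarrow> wf_com (Suc out) 4 out F (e r)"
  shows "wf_com (Suc out) 4 out {} (walk e R)"
  using assms by (auto simp: walk_def)

lemma tiered_outs: "tier out < m \<Longrightarrow> tiered tier m (outs out bs)"
  by (auto simp: outs_def)

lemma tiered_emit:
  assumes "tier out < m" "tier out < tier rT" "tier out < tier rP"
  shows "tiered tier m (emit_atoms out r)" "tiered tier m (emit_rule out r)"
proof -
  have "tiered tier m (emit_atom out b)" for b
    using assms by (cases b) (auto simp: tiered_outs)
  then show "tiered tier m (emit_atoms out r)" "tiered tier m (emit_rule out r)"
    using assms(1) by (auto simp: emit_atoms_def emit_rule_def tiered_outs)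
qed

lemma tiered_walk:
  assumes "\<And>r m. 1 \<le> m \<Longrightarrow> tiered tier m (e r)" "tier rX = 6" "tier rM = 4" "tier rN = 2" "tier rN' = 2" "tier rT = 1" "tier rP = 1"
  shows "tiered tier 7 (walk e R)"
  using assms by (auto simp: walk_def)

text \<open>Registers from 6 on hold \<open>d'\<close> copies of the input length and
  \<open>d\<close> copies of the verifier's input length, as factors of the two polynomials; the
  output follows.\<close>

definition gen_out :: "nat \<Rightarrow> nat \<Rightarrow> nat" where
  "gen_out d d' = 6 + d' + d"

definition gen_sizes :: "nat \<Rightarrow> nat \<Rightarrow> nat \<Rightarrow> nat \<Rightarrow> com" where
  "gen_sizes c d c' d' =
     seqs (map (\<lambda>r. count_up r 1 [rX]) [6..<6 + d']) ;;
     count_up rM c' [6..<6 + d'] ;; count_up rM c' [] ;;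
     seqs (map (\<lambda>r. count_up r 1 [rX] ;; count_up r 1 [] ;; count_up r 1 [rM]) [6 + d'..<6 + d' + d]) ;;
     seqs (map (\<lambda>r. count_up r c [6 + d'..<6 + d' + d] ;; count_up r (c + 4) [] ;; count_up r 1 [rX] ;; count_up r 1 [rM]) [rN, rN'])"

definition gen :: "nat \<Rightarrow> nat \<Rightarrow> nat \<Rightarrow> nat \<Rightarrow> rtmpl list \<Rightarrow> com" where
  "gen c d c' d' R = (let out = gen_out d d' in
     gen_sizes c d c' d' ;; walk (emit_atoms out) R ;; outs out [False] ;;
     walk (emit_rule out) R ;; outs out (False # enc_elp falsity))"

text \<open>The grid must exceed both the time bound on the longest verifier input, of length
  \<open>n + 1 + m\<close>, and the cells \<open>n + m + 2\<close> used at time 0.\<close>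

definition grid_size :: "nat \<Rightarrow> nat \<Rightarrow> nat \<Rightarrow> nat \<Rightarrow> nat" where
  "grid_size c d m n = pbound c d (n + 1 + m) + 4 + n + m"

lemma ev_seqs_inc:
  assumes "\<And>r \<tau>. r \<in> set rs \<Longrightarrow> (\<forall>q \<in> Q. \<tau> q = \<sigma> q) \<Longrightarrow> ev (f r) \<tau> = inc r K \<tau>"
    and "set rs \<inter> Q = {}" "distinct rs" "\<forall>q \<in> Q. \<tau> q = \<sigma> q"
  shows "ev (seqs (map f rs)) \<tau> = (\<lambda>q. if q \<in> set rs then replicate K 1 @ \<tau> q else \<tau> q)"
  using assms
proof (induction rs arbitrary: \<tau>)
  case (Cons r rs)
  have 1: "ev (f r) \<tau> = inc r K \<tau>" using Cons.prems by simp
  have "ev (seqs (map f rs)) (inc r K \<tau>) = (\<lambda>q. if q \<in> set rs then replicate K 1 @ inc r K \<tau> q else inc r K \<tau> q)"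
    using Cons.prems by (intro Cons.IH) (auto simp: inc_apply)
  then show ?case using Cons.prems(3) by (auto simp: 1 inc_apply fun_eq_iff)
qed simp

lemma prod_list_const: "(\<And>q. q \<in> set xs \<Longrightarrow> f q = n) \<Longrightarrow> (\<Prod>q\<leftarrow>xs. f q) = n ^ length xs" for n :: nat
  by (induction xs) auto

lemma ev_gen_sizes:
  fixes ss :: "nat list" and c' d' :: nat
  defines "n \<equiv> length ss" and "m \<equiv> pbound c' d' (length ss)"
  assumes \<sigma>: "\<sigma> = ev (gen_sizes c d c' d') (input_regs ss)"
  shows "\<sigma> rX = ss" "length (\<sigma> rM) = m" "length (\<sigma> rN) = grid_size c d m n" "length (\<sigma> rN') = grid_size c d m n"
    "\<sigma> rT = []" "\<sigma> rP = []" "\<sigma> (gen_out d d') = []"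
proof -
  let ?x = "[6..<6 + d']" and ?y = "[6 + d'..<6 + d' + d]"
  define \<sigma>1 where "\<sigma>1 = ev (seqs (map (\<lambda>r. count_up r 1 [rX]) ?x)) (input_regs ss)"
  have 1: "\<sigma>1 = (\<lambda>q. if q \<in> set ?x then replicate n 1 @ input_regs ss q else input_regs ss q)"
    unfolding \<sigma>1_def n_def by (rule ev_seqs_inc[where Q = "{rX}" and \<sigma> = "input_regs ss"])
      (auto simp: ev_count_up simp del: count_up.simps)
  define \<sigma>2 where "\<sigma>2 = ev (count_up rM c' []) (ev (count_up rM c' ?x) \<sigma>1)"
  have "(\<Prod>q\<leftarrow>?x. length (\<sigma>1 q)) = n ^ d'"
    by (subst prod_list_const[where n = n]) (auto simp: 1)
  then have 2: "\<sigma>2 = inc rM m \<sigma>1"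
    unfolding \<sigma>2_def by (simp add: ev_count_up inc_inc pbound_def m_def n_def add.commute del: count_up.simps)
  define \<sigma>3 where "\<sigma>3 = ev (seqs (map (\<lambda>r. count_up r 1 [rX] ;; count_up r 1 [] ;; count_up r 1 [rM]) ?y)) \<sigma>2"
  have s2: "\<sigma>2 rX = ss" "length (\<sigma>2 rM) = m" by (simp_all add: 2 1 inc_apply)
  have 3: "\<sigma>3 = (\<lambda>q. if q \<in> set ?y then replicate (n + 1 + m) 1 @ \<sigma>2 q else \<sigma>2 q)"
    unfolding \<sigma>3_def
  proof (rule ev_seqs_inc[where Q = "{rX, rM}" and \<sigma> = \<sigma>2])
    fix r :: nat and \<tau> assume "r \<in> set ?y" "\<forall>q\<in>{rX, rM}. \<tau> q = \<sigma>2 q"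
    then show "ev (count_up r 1 [rX] ;; count_up r 1 [] ;; count_up r 1 [rM]) \<tau> = inc r (n + 1 + m) \<tau>"
      using s2 by (simp add: ev_count_up inc_inc inc_apply n_def add.commute del: count_up.simps)
  qed auto
  have y: "(\<Prod>q\<leftarrow>?y. length (\<sigma>3 q)) = (n + 1 + m) ^ d"
    by (subst prod_list_const[where n = "n + 1 + m"]) (auto simp: 3 2 1 inc_apply)
  have s3: "\<sigma>3 rX = ss" "length (\<sigma>3 rM) = m" using s2 by (simp_all add: 3)
  have 4: "\<sigma> = (\<lambda>q. if q \<in> set [rN, rN'] then replicate (grid_size c d m n) 1 @ \<sigma>3 q else \<sigma>3 q)"
    unfolding \<sigma> gen_sizes_def ev.simps(5) \<sigma>1_def[symmetric] \<sigma>2_def[symmetric] \<sigma>3_def[symmetric]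
  proof (rule ev_seqs_inc[where Q = "{rX, rM} \<union> set ?y" and \<sigma> = \<sigma>3])
    fix r :: nat and \<tau> assume r: "r \<in> set [rN, rN']" and \<tau>: "\<forall>q\<in>{rX, rM} \<union> set ?y. \<tau> q = \<sigma>3 q"
    have "map (\<lambda>q. length (\<tau> q)) ?y = map (\<lambda>q. length (\<sigma>3 q)) ?y" using \<tau> by simp
    then have "(\<Prod>q\<leftarrow>?y. length (\<tau> q)) = (n + 1 + m) ^ d" unfolding y[symmetric] by (rule arg_cong)
    then show "ev (count_up r c ?y ;; count_up r (c + 4) [] ;; count_up r 1 [rX] ;; count_up r 1 [rM]) \<tau> =
        inc r (grid_size c d m n) \<tau>"
      using r \<tau> s3 by (auto simp: ev_count_up inc_inc inc_apply n_def grid_size_def pbound_def simp del: count_up.simps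
          intro!: arg_cong2[where f = "inc r" for r])
  qed auto
  show "\<sigma> rX = ss" "length (\<sigma> rM) = m" "length (\<sigma> rN) = grid_size c d m n" "length (\<sigma> rN') = grid_size c d m n"
    "\<sigma> rT = []" "\<sigma> rP = []" "\<sigma> (gen_out d d') = []"
    using s3 by (simp_all add: 4 3 2 1 inc_apply gen_out_def)
qed

lemma ev_gen:
  fixes x :: "bool list" and c' d' :: nat
  defines "m \<equiv> pbound c' d' (length x)"
  shows "ev (gen c d c' d' R) (input_regs (bit_word x)) (gen_out d d') =
    rev (bit_word (enc_instance (instance_of (tableau R (bit_word x) m (grid_size c d m (length x))))))"
proof -
  let ?out = "gen_out d d'"
  define \<sigma> where "\<sigma> = ev (gen_sizes c d c' d') (input_regs (bit_word x))"
  have l: "length (bit_word x) = length x" by (simp add: bit_word_def)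
  have out: "5 < ?out" by (simp add: gen_out_def)
  note S = ev_gen_sizes[OF \<sigma>_def, unfolded l, folded m_def]
  define N where "N = grid_size c d m (length x)"
  define tab where "tab = tableau R (bit_word x) m N"
  define ga where "ga r = concat (map (\<lambda>a. True # enc_nat (atom_nat a)) (fst r @ snd r))" for r
  define gr where "gr r = True # enc_rule (rule_of r)" for r
  have wa: "writes ?out (emit_atoms ?out r) (\<lambda>t p. ga (inst_rule t p r))" for r
    unfolding ga_def by (rule writes_emit_atoms[OF out])
  have wr: "writes ?out (emit_rule ?out r) (\<lambda>t p. gr (inst_rule t p r))" for r
    unfolding gr_def by (rule writes_emit_rule[OF out])
  have A: "ev (walk (emit_atoms ?out) R) (\<sigma>(?out := xs)) = \<sigma>(?out := rev (bit_word (concat (map ga tab))) @ xs)" for xs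
    using ev_walk[OF out wa, of "\<sigma>(?out := xs)" m N R] out S by (simp add: N_def tab_def)
  have B: "ev (walk (emit_rule ?out) R) (\<sigma>(?out := xs)) = \<sigma>(?out := rev (bit_word (concat (map gr tab))) @ xs)" for xs
    using ev_walk[OF out wr, of "\<sigma>(?out := xs)" m N R] out S by (simp add: N_def tab_def)
  have "\<sigma> = \<sigma>(?out := [])" using S(7) by auto
  then have "ev (gen c d c' d' R) (input_regs (bit_word x)) ?out =
     rev (bit_word (False # enc_elp falsity)) @ rev (bit_word (concat (map gr tab))) @ rev (bit_word [False]) @
     rev (bit_word (concat (map ga tab)))"
    unfolding gen_def Let_def ev.simps(5) \<sigma>_def[symmetric] using A[of "[]"] B
    by (simp add: ev_outs)
  also have "\<dots> = rev (bit_word (enc_instance (instance_of tab)))"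
    unfolding enc_instance_of ga_def gr_def by (simp add: bit_word_append) (simp add: bit_word_def)
  finally show ?thesis unfolding tab_def N_def .
qed

lemma wf_gen: "wf_com (Suc (gen_out d d')) 4 (gen_out d d') {} (gen c d c' d' R)"
proof -
  let ?out = "gen_out d d'"
  have out: "5 < ?out" by (simp add: gen_out_def)
  have "wf_com (Suc ?out) 4 ?out {} (gen_sizes c d c' d')"
    unfolding gen_sizes_def
    by (auto simp del: count_up.simps intro!: wf_count_up simp: gen_out_def)
  then show ?thesis unfolding gen_def Let_def using out
    by (auto intro!: wf_walk wf_emit wf_outs)
qed

text \<open>The tiers follow the order of computation: input, copies of its length, certificate
  length, copies of the verifier's input length, grid size, time and position, output.\<close>

lemma tiered_gen:
  "tiered (\<lambda>r. if r = rX then 6 else if r = rM then 4 else if r \<le> rN' then 2 else if r \<le> rP then 1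
      else if r < 6 + d' then 5 else if r < 6 + d' + d then 3 else 0) 7 (gen c d c' d' R)"
    (is "tiered ?tier 7 _")
proof -
  have "tiered ?tier 7 (gen_sizes c d c' d')"
    unfolding gen_sizes_def by (auto simp del: count_up.simps intro!: tiered_count_up)
  moreover have "tiered ?tier 7 (walk (emit_atoms (gen_out d d')) R)" "tiered ?tier 7 (walk (emit_rule (gen_out d d')) R)"
    by (intro tiered_walk tiered_emit; simp add: gen_out_def)+
  ultimately show ?thesis unfolding gen_def Let_def by (auto intro!: tiered_outs simp: gen_out_def)
qed

section \<open>The reduction from an arbitrary coNP language\<close>

lemma enc_instance_mem_iff:
  "enc_instance i \<in> strong_equivalence_problem \<longleftrightarrow>
     is_elp (elp_of (fst i)) \<and> is_elp (elp_of (snd i)) \<and> strongly_equivalent (elp_of (fst i)) (elp_of (snd i))"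
  unfolding strong_equivalence_problem_def using inj_enc_instance
  by (cases i) (auto dest: injD)

theorem strong_equivalence_coNP_hard:
  assumes "L \<in> coNP"
  shows "polytime_reducible L strong_equivalence_problem"
proof -
  from assms obtain V c d c' d' where wf: "wf_machine V"
    and halt: "\<And>x w. halting V (fst (run V (pbound c d (length (verifier_input x w))) (verifier_input x w)))"
    and L: "\<And>x. x \<notin> L \<longleftrightarrow> (\<exists>w. length w \<le> pbound c' d' (length x) \<and> accepts V (verifier_input x w))"
    unfolding coNP_def NP_def mem_Collect_eq Compl_iff by blast
  have fin: "finite (states V)" "finite (symbols V)" using wf by (auto simp: wf_machine_def)
  obtain G where G: "set G = symbols V" using finite_list[OF fin(2)] by blast
  have "finite (states V \<times> {us. set us \<subseteq> symbols V \<and> length us = tape_count V})"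
    by (intro finite_cartesian_product fin finite_lists_length_eq)
  from finite_list[OF this] obtain QS where QS: "set QS = states V \<times> {us. set us \<subseteq> symbols V \<and> length us = tape_count V}" ..
  let ?R = "tmpls V G QS"
  let ?m = "\<lambda>x :: bool list. pbound c' d' (length x)"
  let ?N = "\<lambda>x. grid_size c d (?m x) (length x)"
  define f where "f x = enc_instance (instance_of (tableau ?R (bit_word x) (?m x) (?N x)))" for x
  have "polytime_function f"
  proof (rule polytime_functionI[OF wf_gen tiered_gen])
    show "ev (gen c d c' d' ?R) (input_regs (bit_word x)) (gen_out d d') = rev (bit_word (f x))" for x
      unfolding f_def by (rule ev_gen)
  qed (auto simp: gen_out_def)
  moreover have "x \<in> L \<longleftrightarrow> f x \<in> strong_equivalence_problem" for x
  proof -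
    have "x \<notin> L \<longleftrightarrow> (\<exists>v. \<forall>r \<in> set (tableau ?R (bit_word x) (?m x) (?N x)). sat_trule v r)"
    proof
      assume "x \<notin> L"
      then obtain w where w: "length w \<le> ?m x" "accepts V (verifier_input x w)" using L by blast
      have "sat_trule (run_atom V (verifier_input x w)) r"
        if "r \<in> set (tableau ?R (bit_word x) (?m x) (?N x))" for r
        by (rule tableau_complete[OF wf w(2,1) _ that]) (auto simp: QS)
      then show "\<exists>v. \<forall>r \<in> set (tableau ?R (bit_word x) (?m x) (?N x)). sat_trule v r" by blast
    next
      assume "\<exists>v. \<forall>r \<in> set (tableau ?R (bit_word x) (?m x) (?N x)). sat_trule v r"
      then obtain v where v: "\<And>r. r \<in> set (tableau ?R (bit_word x) (?m x) (?N x)) \<Longrightarrow> sat_trule v r" by blast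
      \<comment> \<open>This is the time bound for the longest certificate. Shorter ones have halted
        earlier and stay halted, so one number serves all of them.\<close>
      let ?T = "pbound c d (length x + 1 + ?m x)"
      have "\<exists>w. length w \<le> ?m x \<and> accepts V (verifier_input x w)"
      proof (rule tableau_sound[OF wf _ _ _ _ _ v])
        fix w :: "bool list" assume "length w \<le> ?m x"
        then have "pbound c d (length (verifier_input x w)) \<le> ?T"
          unfolding pbound_def length_verifier_input by (intro add_mono mult_left_mono power_mono) auto
        from run_halted[OF halt this] halt show "halting V (fst (run V ?T (verifier_input x w)))" by simp
      qed (auto simp: grid_size_def G QS)
      then show "x \<notin> L" using L by blast
    qed
    then show ?thesis
      unfolding f_def enc_instance_mem_iff using strongly_equivalent_falsity is_elp_instance_of by blast
  qed
  ultimately show ?thesis unfolding polytime_reducible_def by blast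
qed

section \<open>Checking a certificate of non-equivalence\<close>

text \<open>
  The certificate is a table of annotations of atoms: membership in the two atom lists, in \<open>X\<close> and
  \<open>Y\<close>, and in each of the realizing sets. The instance is scanned once for every world, where world
  \<open>0\<close> is \<open>(X, Y)\<close> and the others are the realizing sets; the annotations are looked up by name. The
  candidate world interpretation is read off the realizing sets, so that it needs no check.
\<close>

datatype bkind = BLit | BENot | BNegENot
datatype kind = KAtom | KHead | KBody bkind bool
datatype list_kind = LAtoms | LRules | LHead | LBody
datatype dstate = Tag list_kind bool | Nat0 kind bool | NatD kind bool | NatS bool kind bool
  | E1 bool | E2 bool | E3 bkind bool | Done | Bad

datatype action = ANone | ABit | AOcc kind bool | AStart | AEnd bool

fun after :: "kind \<Rightarrow> bool \<Rightarrow> dstate" where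
  "after KAtom p = Tag LAtoms p"
| "after KHead p = Tag LHead p"
| "after (KBody c s) p = Tag LBody p"

text \<open>The flag \<open>p\<close> tells whether the first program is being read.
  \<open>NatS\<close> remembers the last digit because a number ending in the digit 0 is not
  canonical and hence no encoding.\<close>

fun dfa :: "dstate \<Rightarrow> bool \<Rightarrow> dstate \<times> action" where
  "dfa (Tag LAtoms p) b = (if b then Nat0 KAtom p else Tag LRules p, ANone)"
| "dfa (Tag LRules p) b = (if b then (Tag LHead p, AStart) else (if p then Tag LAtoms False else Done, ANone))"
| "dfa (Tag LHead p) b = (if b then Nat0 KHead p else Tag LBody p, ANone)"
| "dfa (Tag LBody p) b = (if b then (E1 p, ANone) else (Tag LRules p, AEnd p))"
| "dfa (E1 p) b = (if b then E2 p else E3 BLit p, ANone)"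
| "dfa (E2 p) b = (if b then E3 BNegENot p else E3 BENot p, ANone)"
| "dfa (E3 c p) b = (Nat0 (KBody c b) p, ANone)"
| "dfa (Nat0 k p) b = (if b then (NatD k p, ANone) else (after k p, AOcc k p))"
| "dfa (NatD k p) b = (NatS b k p, ABit)"
| "dfa (NatS c k p) b = (if b then (NatD k p, ANone) else if c then (after k p, AOcc k p) else (Bad, ANone))"
| "dfa Done b = (Bad, ANone)"
| "dfa Bad b = (Bad, ANone)"

text \<open>
  Flags are numbers of registers, of which only emptiness matters. \<open>rFail\<close>: the table is not a well-formed
  annotation of the instance; \<open>rDiff\<close>: the two atom sets differ; \<open>rNelp\<close>: some rule uses an undeclared
  atom; \<open>rV p\<close>: program \<open>p\<close> (\<open>True\<close> is the first one) is violated in some world. The last four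
  describe the current rule: its head holds in \<open>X\<close>, in \<open>Y\<close>, its body fails in \<open>X\<close>, in \<open>Y\<close>.
\<close>

abbreviation (input) "rFail \<equiv> 20::nat"
abbreviation (input) "rDiff \<equiv> 21::nat"
abbreviation (input) "rNelp \<equiv> 22::nat"
abbreviation (input) "rHX \<equiv> 25::nat"
abbreviation (input) "rHY \<equiv> 26::nat"
abbreviation (input) "rNBX \<equiv> 27::nat"
abbreviation (input) "rNBY \<equiv> 28::nat"

definition rV :: "bool \<Rightarrow> nat" where
  "rV p = (if p then 23 else 24)"

definition rule_flags :: "nat set" where
  "rule_flags = {rHX, rHY, rNBX, rNBY}"

text \<open>Within a rule, flags can only be raised. Truth of a body is a conjunction, so it is
  recorded through its failure; truth of a head is a disjunction and is recorded directly.\<close>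

definition violated :: "nat set \<Rightarrow> bool" where
  "violated F \<longleftrightarrow> rNBY \<notin> F \<and> rHY \<notin> F \<or> rNBX \<notin> F \<and> rHX \<notin> F"

type_synonym occ = "kind \<Rightarrow> bool \<Rightarrow> nat list \<Rightarrow> nat set"

definition bsym :: "bool \<Rightarrow> nat" where
  "bsym b = (if b then 2 else 1)"

fun do_action :: "occ \<Rightarrow> action \<Rightarrow> bool \<Rightarrow> nat list \<times> nat set \<Rightarrow> nat list \<times> nat set" where
  "do_action oc ANone b (nm, F) = (nm, F)"
| "do_action oc ABit b (nm, F) = (bsym b # nm, F)"
| "do_action oc (AOcc k p) b (nm, F) = ([], F \<union> oc k p nm)"
| "do_action oc AStart b (nm, F) = (nm, F - rule_flags)"
| "do_action oc (AEnd p) b (nm, F) = (nm, F \<union> (if violated F then {rV p} else {}))"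

definition scan_step :: "occ \<Rightarrow> bool \<Rightarrow> dstate \<times> nat list \<times> nat set \<Rightarrow> dstate \<times> nat list \<times> nat set" where
  "scan_step oc b S = (fst (dfa (fst S) b), do_action oc (snd (dfa (fst S) b)) b (snd S))"

definition scan_bits :: "occ \<Rightarrow> bool list \<Rightarrow> dstate \<times> nat list \<times> nat set \<Rightarrow> dstate \<times> nat list \<times> nat set" where
  "scan_bits oc = fold (scan_step oc)"

lemma scan_bits_simps [simp]:
  "scan_bits oc [] S = S"
  "scan_bits oc (b # bs) S = scan_bits oc bs (scan_step oc b S)"
  "scan_bits oc (bs @ cs) S = scan_bits oc cs (scan_bits oc bs S)"
  by (simp_all add: scan_bits_def)

fun name_of :: "nat \<Rightarrow> nat list" where
  "name_of n = (if n = 0 then [] else bsym (odd n) # name_of (n div 2))"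

declare name_of.simps [simp del]

lemma name_of_inj: "name_of m = name_of n \<Longrightarrow> m = n"
proof (induction m arbitrary: n rule: less_induct)
  case (less m)
  show ?case
  proof (cases "m = 0 \<or> n = 0")
    case True
    then show ?thesis using less.prems by (auto simp: name_of.simps[of m] name_of.simps[of n] split: if_splits)
  next
    case False
    then have *: "odd m = odd n" "name_of (m div 2) = name_of (n div 2)"
      using less.prems by (auto simp: name_of.simps[of m] name_of.simps[of n] bsym_def split: if_splits)
    have "m div 2 < m" using False by simp
    with less.IH * have "m div 2 = n div 2" by blast
    moreover have "m mod 2 = n mod 2" using *(1) by presburger
    ultimately show ?thesis by (metis div_mult_mod_eq)
  qed
qed

lemma scan_nat_pos:
  "0 < n \<Longrightarrow> (q = Nat0 k p \<or> (\<exists>c. q = NatS c k p)) \<Longrightarrow>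
   scan_bits oc (enc_nat n) (q, nm, F) = (after k p, [], F \<union> oc k p (rev (name_of n) @ nm))"
proof (induction n arbitrary: q nm rule: less_induct)
  case (less n)
  let ?q = "NatS (odd n) k p"
  have 1: "scan_bits oc (enc_nat n) (q, nm, F) = scan_bits oc (enc_nat (n div 2)) (?q, bsym (odd n) # nm, F)"
    using less.prems by (auto simp: enc_nat.simps[of n] scan_step_def)
  have nm: "name_of n = bsym (odd n) # name_of (n div 2)" using less.prems by (simp add: name_of.simps[of n])
  show ?case
  proof (cases "n div 2 = 0")
    case True
    then have "n = 1" using less.prems(1) by presburger
    then show ?thesis unfolding 1 nm by (simp add: enc_nat.simps[of 0] scan_step_def name_of.simps[of 0])
  next
    case False
    then show ?thesis unfolding 1 nm using less.prems by (subst less.IH) auto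
  qed
qed

lemma scan_nat: "scan_bits oc (enc_nat n) (Nat0 k p, [], F) = (after k p, [], F \<union> oc k p (rev (name_of n)))"
  using scan_nat_pos[of n "Nat0 k p"]
  by (cases "n = 0") (auto simp: enc_nat.simps[of 0] scan_step_def name_of.simps[of 0])

lemma scan_atoms:
  "scan_bits oc (enc_list enc_nat xs) (Tag LAtoms p, [], F) =
     (Tag LRules p, [], F \<union> (\<Union>a\<in>set xs. oc KAtom p (rev (name_of a))))"
  by (induction xs arbitrary: F) (auto simp: scan_step_def scan_nat)

lemma scan_head:
  "scan_bits oc (enc_list enc_nat xs) (Tag LHead p, [], F) =
     (Tag LBody p, [], F \<union> (\<Union>a\<in>set xs. oc KHead p (rev (name_of a))))"
  by (induction xs arbitrary: F) (auto simp: scan_step_def scan_nat)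

fun lit_pos :: "'a literal \<Rightarrow> bool" where
  "lit_pos (Pos a) = True"
| "lit_pos (Neg a) = False"

fun lit_atom :: "'a literal \<Rightarrow> 'a" where
  "lit_atom (Pos a) = a"
| "lit_atom (Neg a) = a"

fun elem_lit :: "'a body_elem \<Rightarrow> 'a literal" where
  "elem_lit (Lit l) = l"
| "elem_lit (ENot l) = l"
| "elem_lit (NegENot l) = l"

fun elem_kind :: "'a body_elem \<Rightarrow> kind" where
  "elem_kind (Lit l) = KBody BLit (lit_pos l)"
| "elem_kind (ENot l) = KBody BENot (lit_pos l)"
| "elem_kind (NegENot l) = KBody BNegENot (lit_pos l)"

definition elem_atom :: "'a body_elem \<Rightarrow> 'a" where
  "elem_atom e = lit_atom (elem_lit e)"

lemma set_body_elem_atom: "set_body_elem e = {elem_atom e}"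
proof -
  have "set_literal l = {lit_atom l}" for l :: "'a literal" by (cases l) auto
  then show ?thesis by (cases e) (auto simp: elem_atom_def)
qed

lemma scan_body:
  "scan_bits oc (enc_list enc_body_elem es) (Tag LBody p, [], F) =
     (let F' = F \<union> (\<Union>e\<in>set es. oc (elem_kind e) p (rev (name_of (elem_atom e))))
      in (Tag LRules p, [], F' \<union> (if violated F' then {rV p} else {})))"
proof (induction es arbitrary: F)
  case (Cons e es)
  obtain l where "e = Lit l \<or> e = ENot l \<or> e = NegENot l" by (cases e) auto
  then have "scan_bits oc (True # enc_body_elem e) (Tag LBody p, [], F) =
      (Tag LBody p, [], F \<union> oc (elem_kind e) p (rev (name_of (elem_atom e))))"
    by (cases l) (auto simp: scan_step_def scan_nat elem_atom_def)
  then show ?case using Cons by (simp add: Un_assoc Let_def)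
qed (simp add: scan_step_def)

definition rule_occ :: "occ \<Rightarrow> bool \<Rightarrow> nat elp_rule \<Rightarrow> nat set" where
  "rule_occ oc p r = (\<Union>a\<in>set (head r). oc KHead p (rev (name_of a))) \<union>
     (\<Union>e\<in>set (body r). oc (elem_kind e) p (rev (name_of (elem_atom e))))"

definition after_rule :: "occ \<Rightarrow> bool \<Rightarrow> nat elp_rule \<Rightarrow> nat set \<Rightarrow> nat set" where
  "after_rule oc p r F = (let F' = F - rule_flags \<union> rule_occ oc p r in F' \<union> (if violated F' then {rV p} else {}))"

lemma scan_rules:
  "scan_bits oc (enc_list enc_rule rs) (Tag LRules p, [], F) =
     (if p then Tag LAtoms False else Done, [], fold (after_rule oc p) rs F)"
proof (induction rs arbitrary: F)
  case (Cons r rs)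
  have "scan_bits oc (True # enc_rule r) (Tag LRules p, [], F) = (Tag LRules p, [], after_rule oc p r F)"
    by (simp add: scan_step_def enc_rule_def scan_head scan_body after_rule_def rule_occ_def Un_assoc)
  then show ?case using Cons by simp
qed (simp add: scan_step_def)

definition scan_prog :: "occ \<Rightarrow> bool \<Rightarrow> fin_elp \<Rightarrow> nat set \<Rightarrow> nat set" where
  "scan_prog oc p P F = fold (after_rule oc p) (snd P) (F \<union> (\<Union>a\<in>set (fst P). oc KAtom p (rev (name_of a))))"

lemma scan_enc_instance:
  "scan_bits oc (enc_instance (p1, p2)) (Tag LAtoms True, [], F) =
     (Done, [], scan_prog oc False p2 (scan_prog oc True p1 F))"
  by (simp add: enc_instance_def enc_elp_def scan_atoms scan_rules scan_prog_def)

section \<open>The automaton recognizes exactly the encodings\<close>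

definition dfa_run :: "bool list \<Rightarrow> dstate \<Rightarrow> dstate" where
  "dfa_run = fold (\<lambda>b q. fst (dfa q b))"

lemma dfa_run_simps [simp]:
  "dfa_run [] q = q" "dfa_run (b # bs) q = dfa_run bs (fst (dfa q b))"
  by (simp_all add: dfa_run_def)

lemma fst_scan_bits: "fst (scan_bits oc bs S) = dfa_run bs (fst S)"
  by (induction bs arbitrary: S) (simp_all add: scan_step_def)

lemma dfa_run_Bad [simp]: "dfa_run bs Bad = Bad"
  by (induction bs) auto

lemma dfa_nat_pos:
  "dfa_run bs (NatD k p) = Done \<Longrightarrow>
   \<exists>n cs. 0 < n \<and> True # bs = enc_nat n @ cs \<and> dfa_run cs (after k p) = Done"
proof (induction "length bs" arbitrary: bs rule: less_induct)
  case less
  then obtain b cs where bs: "bs = b # cs" and c: "dfa_run cs (NatS b k p) = Done" by (cases bs) auto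
  then obtain d ds where cs: "cs = d # ds" by (cases cs) auto
  show ?case
  proof (cases d)
    case True
    then have "dfa_run ds (NatD k p) = Done" using c cs by simp
    from less.hyps[OF _ this] bs cs obtain n es where
      n: "0 < n" "True # ds = enc_nat n @ es" "dfa_run es (after k p) = Done" by auto
    have "(of_bool b + 2 * n) div 2 = n" "odd (of_bool b + 2 * n) = b" by auto
    then have "enc_nat (of_bool b + 2 * n) = True # b # enc_nat n"
      using n(1) by (subst enc_nat.simps) simp
    then show ?thesis using n bs cs True by (intro exI[of _ "of_bool b + 2 * n"] exI[of _ es]) simp
  next
    case False
    with c cs have "b" "dfa_run ds (after k p) = Done" by (auto split: if_splits)
    then show ?thesis using bs cs False by (intro exI[of _ 1] exI[of _ ds]) (simp add: enc_nat.simps)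
  qed
qed

lemma dfa_nat:
  assumes "dfa_run bs (Nat0 k p) = Done"
  shows "\<exists>n cs. bs = enc_nat n @ cs \<and> dfa_run cs (after k p) = Done"
proof -
  from assms obtain b cs where bs: "bs = b # cs" by (cases bs) auto
  show ?thesis
  proof (cases b)
    case True
    then have "dfa_run cs (NatD k p) = Done" using assms bs by simp
    from dfa_nat_pos[OF this] show ?thesis using bs True by auto
  next
    case False
    then show ?thesis using assms bs by (intro exI[of _ 0] exI[of _ cs]) (simp add: enc_nat.simps)
  qed
qed

text \<open>Induction on the length of the input: each list element consumes at least its list mark,
  so the remaining word is shorter.\<close>

lemma dfa_list:
  assumes start: "\<And>bs. dfa_run (True # bs) q = Done \<Longrightarrow> \<exists>x cs. bs = f x @ cs \<and> dfa_run cs q = Done"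
    and q: "q \<noteq> Done" and f: "dfa_run bs q = Done"
  shows "\<exists>xs cs. bs = enc_list f xs @ cs \<and> dfa_run (False # cs) q = Done"
  using f
proof (induction "length bs" arbitrary: bs rule: less_induct)
  case less
  then obtain b cs where bs: "bs = b # cs" using q by (cases bs) auto
  show ?case
  proof (cases b)
    case True
    then obtain x ds where x: "cs = f x @ ds" "dfa_run ds q = Done" using start[of cs] less.prems bs by auto
    then have "length ds < length bs" using bs by simp
    from less.hyps[OF this x(2)] obtain xs es where "ds = enc_list f xs @ es" "dfa_run (False # es) q = Done" by blast
    then show ?thesis using bs True x by (intro exI[of _ "x # xs"] exI[of _ es]) simp
  next
    case False
    then show ?thesis using bs less.prems by (intro exI[of _ "[]"] exI[of _ cs]) simp
  qed
qed

lemma dfa_body_elem: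
  assumes "dfa_run (True # bs) (Tag LBody p) = Done"
  shows "\<exists>x cs. bs = enc_body_elem x @ cs \<and> dfa_run cs (Tag LBody p) = Done"
proof -
  have lit: "\<exists>l ds. cs = enc_literal l @ ds \<and> dfa_run ds (Tag LBody p) = Done" if "dfa_run cs (E3 c p) = Done" for c cs
  proof -
    from that obtain b ds where cs: "cs = b # ds" by (cases cs) auto
    with that have "dfa_run ds (Nat0 (KBody c b) p) = Done" by simp
    from dfa_nat[OF this] obtain n es where "ds = enc_nat n @ es" "dfa_run es (Tag LBody p) = Done" by auto
    then show ?thesis using cs
      by (intro exI[of _ "if b then Pos n else Neg n"] exI[of _ es]) auto
  qed
  from assms obtain b cs where bs: "bs = b # cs" by (cases bs) auto
  show ?thesis
  proof (cases b)
    case False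
    then have "dfa_run cs (E3 BLit p) = Done" using assms bs by simp
    from lit[OF this] obtain l ds where "cs = enc_literal l @ ds" "dfa_run ds (Tag LBody p) = Done" by blast
    then show ?thesis using bs False by (intro exI[of _ "Lit l"] exI[of _ ds]) simp
  next
    case True
    then obtain b' ds where cs: "cs = b' # ds" using assms bs by (cases cs) auto
    then have "dfa_run ds (E3 (if b' then BNegENot else BENot) p) = Done" using assms bs True by (cases b') auto
    from lit[OF this] obtain l es where "ds = enc_literal l @ es" "dfa_run es (Tag LBody p) = Done" by blast
    then show ?thesis using bs True cs by (intro exI[of _ "if b' then NegENot l else ENot l"] exI[of _ es]) simp
  qed
qed

lemma dfa_rule:
  assumes "dfa_run (True # bs) (Tag LRules p) = Done"
  shows "\<exists>x cs. bs = enc_rule x @ cs \<and> dfa_run cs (Tag LRules p) = Done"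
proof -
  have "dfa_run bs (Tag LHead p) = Done" using assms by simp
  moreover have "dfa_run (True # bs) (Tag LHead p) = Done \<Longrightarrow>
      \<exists>x cs. bs = enc_nat x @ cs \<and> dfa_run cs (Tag LHead p) = Done" for bs
    using dfa_nat[of bs KHead p] by simp
  ultimately have "\<exists>xs cs. bs = enc_list enc_nat xs @ cs \<and> dfa_run (False # cs) (Tag LHead p) = Done"
    by (intro dfa_list) auto
  then obtain xs cs where 1: "bs = enc_list enc_nat xs @ cs" "dfa_run cs (Tag LBody p) = Done" by auto
  then have "\<exists>es ds. cs = enc_list enc_body_elem es @ ds \<and> dfa_run (False # ds) (Tag LBody p) = Done"
    by (intro dfa_list dfa_body_elem) auto
  then obtain es ds where "cs = enc_list enc_body_elem es @ ds" "dfa_run ds (Tag LRules p) = Done" by auto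
  then show ?thesis using 1 by (intro exI[of _ "ELP_Rule xs es"] exI[of _ ds]) (simp add: enc_rule_def)
qed

lemma dfa_elp:
  assumes "dfa_run bs (Tag LAtoms p) = Done"
  shows "\<exists>P cs. bs = enc_elp P @ cs \<and> dfa_run cs (if p then Tag LAtoms False else Done) = Done"
proof -
  have "dfa_run (True # bs) (Tag LAtoms p) = Done \<Longrightarrow>
      \<exists>x cs. bs = enc_nat x @ cs \<and> dfa_run cs (Tag LAtoms p) = Done" for bs
    using dfa_nat[of bs KAtom p] by simp
  then have "\<exists>xs cs. bs = enc_list enc_nat xs @ cs \<and> dfa_run (False # cs) (Tag LAtoms p) = Done"
    using assms by (intro dfa_list) auto
  then obtain xs cs where 1: "bs = enc_list enc_nat xs @ cs" "dfa_run cs (Tag LRules p) = Done" by auto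
  then have "\<exists>rs ds. cs = enc_list enc_rule rs @ ds \<and> dfa_run (False # ds) (Tag LRules p) = Done"
    by (intro dfa_list dfa_rule) auto
  then show ?thesis using 1 by (fastforce simp: enc_elp_def)
qed

lemma dfa_run_Done_iff: "dfa_run x (Tag LAtoms True) = Done \<longleftrightarrow> x \<in> range enc_instance"
proof
  assume "dfa_run x (Tag LAtoms True) = Done"
  from dfa_elp[OF this] obtain P cs where 1: "x = enc_elp P @ cs" "dfa_run cs (Tag LAtoms False) = Done" by auto
  from dfa_elp[OF this(2)] obtain Q ds where 2: "cs = enc_elp Q @ ds" "dfa_run ds Done = Done" by auto
  have "ds = []" using 2(2) by (cases ds) auto
  then have "x = enc_instance (P, Q)" using 1 2 by (simp add: enc_instance_def)
  then show "x \<in> range enc_instance" by blast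
next
  assume "x \<in> range enc_instance"
  then obtain p1 p2 where "x = enc_instance (p1, p2)" by auto
  \<comment> \<open>The automaton state does not depend on the annotations, so the scan with trivial
    ones gives the converse.\<close>
  then show "dfa_run x (Tag LAtoms True) = Done"
    using scan_enc_instance[of "\<lambda>_ _ _. {}" p1 p2 "{}"] fst_scan_bits[of "\<lambda>_ _ _. {}" x "(Tag LAtoms True, [], {})"] by simp
qed

section \<open>Looking up annotations\<close>

text \<open>The table is a word over \<open>{1, 2, 3, 4}\<close>: \<open>1\<close> and \<open>2\<close> are bits, \<open>3\<close> ends a (reversed) name and
  \<open>4\<close> an annotation. The state consists of the mode, the name read, whether it matches, and the result.\<close>

fun lookup_step :: "nat list \<Rightarrow> nat \<Rightarrow> bool \<times> nat list \<times> bool \<times> nat list \<Rightarrow> bool \<times> nat list \<times> bool \<times> nat list" where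
  "lookup_step nm t (mode, en, mat, an) =
     (if \<not> mode then
        if t \<le> 2 then (False, t # en, mat, an)
        else if t = 3 then (True, en, mat \<or> en = rev nm, an)
        else (False, en, mat, an)
      else
        if t \<le> 2 then (True, en, mat, if mat then t # an else an)
        else if t = 3 then (True, en, mat, an)
        else (False, [], False, an))"

text \<open>Every word counts as a table, and the result depends on the name alone. All occurrences
  of an atom thus get the same values for any certificate, and no consistency check is needed.
  Annotations are collected in reverse, hence the \<open>rev\<close> in
  \<open>entry\<close>.\<close>

definition annot :: "nat list \<Rightarrow> nat list \<Rightarrow> nat list" where
  "annot W nm = snd (snd (snd (fold (lookup_step nm) W (False, [], False, []))))"

lemma set_annot: "set (annot W nm) \<subseteq> set W \<inter> {..2}"
proof -
  have "set (snd (snd (snd (fold (lookup_step nm) W S)))) \<subseteq> set (snd (snd (snd S))) \<union> set W \<inter> {..2}" for S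
  proof (induction W arbitrary: S)
    case (Cons t W)
    obtain mode en mat an where S: "S = (mode, en, mat, an)" by (cases S) auto
    have "set (snd (snd (snd (lookup_step nm t S)))) \<subseteq> set an \<union> {t} \<inter> {..2}" by (auto simp: S)
    with Cons[of "lookup_step nm t S"] S show ?case by auto
  qed simp
  from this[of "(False, [], False, [])"] show ?thesis by (simp add: annot_def)
qed

lemma length_annot: "length (annot W nm) \<le> length W"
proof -
  have "length (snd (snd (snd (fold (lookup_step nm) W S)))) \<le> length (snd (snd (snd S))) + length W" for S
  proof (induction W arbitrary: S)
    case (Cons t W)
    obtain mode en mat an where S: "S = (mode, en, mat, an)" by (cases S) auto
    have "length (snd (snd (snd (lookup_step nm t S)))) \<le> length an + 1" by (auto simp: S)
    with Cons[of "lookup_step nm t S"] S show ?case by auto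
  qed simp
  from this[of "(False, [], False, [])"] show ?thesis by (simp add: annot_def)
qed

lemma set_name_of: "set (name_of n) \<subseteq> {1, 2}"
  by (induction n rule: name_of.induct) (subst name_of.simps, auto simp: bsym_def)

definition entry :: "(nat \<Rightarrow> nat list) \<Rightarrow> nat \<Rightarrow> nat list" where
  "entry l a = rev (name_of a) @ [3] @ rev (l a) @ [4]"

lemma annot_table:
  assumes l: "\<And>a. set (l a) \<subseteq> {1, 2}" and as: "distinct as"
  shows "annot (concat (map (entry l) as)) (rev (name_of b)) = (if b \<in> set as then l b else [])"
proof -
  let ?st = "lookup_step (rev (name_of b))"
  have 1: "fold ?st xs (False, en, mat, an) = (False, rev xs @ en, mat, an)" if "set xs \<subseteq> {1, 2}" for xs en mat an
    using that by (induction xs arbitrary: en) auto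
  have 2: "fold ?st xs (True, en, mat, an) = (True, en, mat, if mat then rev xs @ an else an)" if "set xs \<subseteq> {1, 2}" for xs en mat an
    using that by (induction xs arbitrary: an) auto
  have 3: "fold ?st (entry l a) (False, [], False, an) = (False, [], False, if a = b then l a @ an else an)" for a an
    using set_name_of[of a] l[of a] by (auto simp: entry_def 1 2 dest: name_of_inj)
  have "fold ?st (concat (map (entry l) as)) (False, [], False, an) =
      (False, [], False, if b \<in> set as then l b @ an else an)" for an
    using as by (induction as arbitrary: an) (auto simp: 3)
  then show ?thesis by (simp add: annot_def)
qed

section \<open>Correctness of the check\<close>

text \<open>The value 0 stands for world 0, which uses the bits for \<open>X\<close> and
  \<open>Y\<close> instead. Beyond its end an annotation repeats the last value, so lists of
  different lengths still define all worlds.\<close>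

definition world_val :: "nat \<Rightarrow> nat list \<Rightarrow> nat" where
  "world_val i ys = (if i = 0 \<or> ys = [] then 0 else ys ! (min i (length ys) - 1))"

text \<open>\<open>s1\<close> and \<open>s0\<close> tell whether some realizing set contains,
  respectively omits, the atom; so \<open>\<not> s0\<close> means that its positive literal is in
  the interpretation and \<open>\<not> s1\<close> that the negative one is. Declared atoms must be
  marked, but false extra marks are harmless: \<open>rNelp\<close> and \<open>rDiff\<close> arise
  only from missing marks.\<close>

definition occ_list :: "kind \<Rightarrow> bool \<Rightarrow> nat \<Rightarrow> nat \<Rightarrow> nat \<Rightarrow> nat \<Rightarrow> nat \<Rightarrow> bool \<Rightarrow> bool \<Rightarrow> nat list" where
  "occ_list k p m1 m2 x0 y0 v s1 s0 =
    (let x = (if v = 0 then x0 else v) = 2; y = (if v = 0 then y0 else v) = 2;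
         own = (if p then m1 else m2) = 2; other = (if p then m2 else m1) = 2 in
     (if m1 = 0 \<or> m2 = 0 \<or> x0 = 0 \<or> y0 = 0 \<or> \<not> s1 \<and> \<not> s0 \<or> x \<and> \<not> y then [rFail] else []) @
     (case k of
        KAtom \<Rightarrow> (if own then [] else [rFail]) @ (if other then [] else [rDiff])
      | KHead \<Rightarrow> (if own then [] else [rNelp]) @ (if x then [rHX] else []) @ (if y then [rHY] else [])
      | KBody c s \<Rightarrow> (if own then [] else [rNelp]) @
          (let neg = (case c of
               BLit \<Rightarrow> \<not> y
             | BENot \<Rightarrow> (if s then \<not> s0 \<longrightarrow> \<not> y else \<not> s1 \<longrightarrow> y)
             | BNegENot \<Rightarrow> (if s then \<not> s0 \<and> y else \<not> s1 \<and> \<not> y)) in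
           if c = BLit \<and> s then (if x then [] else [rNBX]) @ (if y then [] else [rNBY])
           else if neg then [] else [rNBX, rNBY])))"

definition occ_flags :: "nat \<Rightarrow> nat list \<Rightarrow> kind \<Rightarrow> bool \<Rightarrow> nat set" where
  "occ_flags i l k p = set (occ_list k p (first l) (first (tl l)) (first (tl (tl l))) (first (tl (tl (tl l))))
     (world_val i (tl (tl (tl (tl l))))) (2 \<in> set (tl (tl (tl (tl l))))) (\<exists>s \<in> set (tl (tl (tl (tl l)))). s \<noteq> 2))"

definition table_occ :: "nat list \<Rightarrow> nat \<Rightarrow> occ" where
  "table_occ W i k p nm = occ_flags i (annot W nm) k p"

definition world_scan :: "nat list \<Rightarrow> bool list \<Rightarrow> nat \<Rightarrow> nat set \<Rightarrow> nat set" where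
  "world_scan W x i F = snd (snd (scan_bits (table_occ W i) x (Tag LAtoms True, [], F)))"

definition final_flags :: "nat list \<Rightarrow> bool list \<Rightarrow> nat set" where
  "final_flags W x = fold (world_scan W x) [0..<length W + 2] {}"

text \<open>A word that encodes no instance is a non-member and is accepted at once. With different
  atom sets one satisfied program is enough; testing only the first is complete because the
  preceding disjunct covers the case that exactly one is violated.\<close>

definition accepting :: "dstate \<Rightarrow> nat set \<Rightarrow> bool" where
  "accepting q F \<longleftrightarrow> q \<noteq> Done \<or> rFail \<notin> F \<and>
     (rNelp \<in> F \<or> (rV True \<in> F) \<noteq> (rV False \<in> F) \<or> rDiff \<in> F \<and> rV True \<notin> F)"

definition table_accepts :: "nat list \<Rightarrow> bool list \<Rightarrow> bool" where
  "table_accepts W x \<longleftrightarrow> accepting (dfa_run x (Tag LAtoms True)) (final_flags W x)"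

definition prog_occ :: "occ \<Rightarrow> bool \<Rightarrow> fin_elp \<Rightarrow> nat set" where
  "prog_occ oc p P = (\<Union>a\<in>set (fst P). oc KAtom p (rev (name_of a))) \<union> (\<Union>r\<in>set (snd P). rule_occ oc p r)"

lemma violated_rule_flags: "violated (F - rule_flags \<union> G) = violated G"
  by (auto simp: violated_def rule_flags_def)

lemma mem_scan_prog:
  assumes "f \<in> {rFail, rDiff, rNelp}"
  shows "f \<in> scan_prog oc p P F \<longleftrightarrow> f \<in> F \<or> f \<in> prog_occ oc p P"
proof -
  have "f \<noteq> rV p" "f \<notin> rule_flags" using assms by (auto simp: rV_def rule_flags_def)
  then have "f \<in> fold (after_rule oc p) rs G \<longleftrightarrow> f \<in> G \<or> (\<exists>r\<in>set rs. f \<in> rule_occ oc p r)" for rs G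
    by (induction rs arbitrary: G) (auto simp: after_rule_def Let_def)
  then show ?thesis by (auto simp: scan_prog_def prog_occ_def)
qed

lemma V_mem_scan_prog:
  assumes "\<And>k nm. rV q \<notin> oc k p nm"
  shows "rV q \<in> scan_prog oc p P F \<longleftrightarrow> rV q \<in> F \<or> q = p \<and> (\<exists>r\<in>set (snd P). violated (rule_occ oc p r))"
proof -
  have q: "rV q \<notin> rule_flags" "rV q = rV p \<longleftrightarrow> q = p" by (auto simp: rV_def rule_flags_def)
  have "rV q \<notin> rule_occ oc p r" for r using assms by (auto simp: rule_occ_def)
  then have "rV q \<in> fold (after_rule oc p) rs G \<longleftrightarrow> rV q \<in> G \<or> q = p \<and> (\<exists>r\<in>set rs. violated (rule_occ oc p r))" for rs G
    using q by (induction rs arbitrary: G) (auto simp: after_rule_def Let_def violated_rule_flags)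
  then show ?thesis using assms by (auto simp: scan_prog_def)
qed

lemma V_notin_table_occ: "rV q \<notin> table_occ W i k p nm"
  by (auto simp: table_occ_def occ_flags_def occ_list_def rV_def Let_def split: kind.splits)

lemma mem_fold_iff:
  "(\<And>i F. f \<in> g i F \<longleftrightarrow> f \<in> F \<or> P i) \<Longrightarrow> f \<in> fold g js F \<longleftrightarrow> f \<in> F \<or> (\<exists>i\<in>set js. P i)"
  by (induction js arbitrary: F) auto

section \<open>Meaning of the flags for a given instance and table\<close>

context
  fixes W :: "nat list" and p1 p2 :: fin_elp
begin

definition prog :: "bool \<Rightarrow> fin_elp" where
  "prog p = (if p then p1 else p2)"

definition ann :: "nat \<Rightarrow> nat list" where
  "ann a = annot W (rev (name_of a))"

abbreviation "F_final \<equiv> final_flags W (enc_instance (p1, p2))"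
abbreviation "K \<equiv> length W + 2"

lemma world_scan_enc:
  "world_scan W (enc_instance (p1, p2)) i F =
     scan_prog (table_occ W i) False p2 (scan_prog (table_occ W i) True p1 F)"
  by (simp add: world_scan_def scan_enc_instance)

lemma mem_final_flags:
  "f \<in> {rFail, rDiff, rNelp} \<Longrightarrow> f \<in> F_final \<longleftrightarrow> (\<exists>i<K. \<exists>p. f \<in> prog_occ (table_occ W i) p (prog p))"
proof -
  assume f: "f \<in> {rFail, rDiff, rNelp}"
  have "f \<in> world_scan W (enc_instance (p1, p2)) i F \<longleftrightarrow> f \<in> F \<or> (\<exists>p. f \<in> prog_occ (table_occ W i) p (prog p))" for i F
    unfolding world_scan_enc mem_scan_prog[OF f] by (auto simp: prog_def ex_bool_eq)
  then have "f \<in> F_final \<longleftrightarrow> f \<in> {} \<or> (\<exists>i\<in>set [0..<K]. \<exists>p. f \<in> prog_occ (table_occ W i) p (prog p))"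
    unfolding final_flags_def by (rule mem_fold_iff)
  then show ?thesis unfolding set_upt by auto
qed

lemma V_mem_final_flags:
  "rV q \<in> F_final \<longleftrightarrow> (\<exists>i<K. \<exists>r\<in>set (snd (prog q)). violated (rule_occ (table_occ W i) q r))"
proof -
  have "rV q \<in> world_scan W (enc_instance (p1, p2)) i F \<longleftrightarrow>
      rV q \<in> F \<or> (\<exists>r\<in>set (snd (prog q)). violated (rule_occ (table_occ W i) q r))" for i F
    unfolding world_scan_enc V_mem_scan_prog[OF V_notin_table_occ] by (auto simp: prog_def)
  then have "rV q \<in> F_final \<longleftrightarrow> rV q \<in> {} \<or>
      (\<exists>i\<in>set [0..<K]. \<exists>r\<in>set (snd (prog q)). violated (rule_occ (table_occ W i) q r))"
    unfolding final_flags_def by (rule mem_fold_iff)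
  then show ?thesis unfolding set_upt by auto
qed

definition rest :: "nat \<Rightarrow> nat list" where
  "rest a = tl (tl (tl (tl (ann a))))"

definition inX :: "nat \<Rightarrow> nat \<Rightarrow> bool" where
  "inX i a \<longleftrightarrow> (if world_val i (rest a) = 0 then first (tl (tl (ann a))) else world_val i (rest a)) = 2"

definition inY :: "nat \<Rightarrow> nat \<Rightarrow> bool" where
  "inY i a \<longleftrightarrow> (if world_val i (rest a) = 0 then first (tl (tl (tl (ann a)))) else world_val i (rest a)) = 2"

definition member :: "bool \<Rightarrow> nat \<Rightarrow> bool" where
  "member p a \<longleftrightarrow> first (if p then ann a else tl (ann a)) = 2"

definition bad :: "nat \<Rightarrow> nat \<Rightarrow> bool" where
  "bad i a \<longleftrightarrow> first (ann a) = 0 \<or> first (tl (ann a)) = 0 \<or> first (tl (tl (ann a))) = 0 \<or>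
     first (tl (tl (tl (ann a)))) = 0 \<or> rest a = [] \<or> inX i a \<and> \<not> inY i a"

lemma table_occ_name:
  "table_occ W i k p (rev (name_of a)) =
     (if bad i a then {rFail} else {}) \<union>
     (case k of
        KAtom \<Rightarrow> (if member p a then {} else {rFail}) \<union> (if member (\<not> p) a then {} else {rDiff})
      | KHead \<Rightarrow> (if member p a then {} else {rNelp}) \<union> (if inX i a then {rHX} else {}) \<union> (if inY i a then {rHY} else {})
      | KBody c s \<Rightarrow> (if member p a then {} else {rNelp}) \<union>
          (let neg = (case c of
               BLit \<Rightarrow> \<not> inY i a
             | BENot \<Rightarrow> (if s then (\<forall>v \<in> set (rest a). v = 2) \<longrightarrow> \<not> inY i a else 2 \<notin> set (rest a) \<longrightarrow> inY i a)
             | BNegENot \<Rightarrow> (if s then (\<forall>v \<in> set (rest a). v = 2) \<and> inY i a else 2 \<notin> set (rest a) \<and> \<not> inY i a)) in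
           if c = BLit \<and> s then (if inX i a then {} else {rNBX}) \<union> (if inY i a then {} else {rNBY})
           else if neg then {} else {rNBX, rNBY}))"
proof -
  have ne: "\<not> 2 \<in> set xs \<and> (\<forall>s\<in>set xs. s = 2) \<longleftrightarrow> xs = []" for xs :: "nat list" by (cases xs) auto
  have own: "(if p then first (ann a) else first (tl (ann a))) = 2 \<longleftrightarrow> member p a"
    and other: "(if p then first (tl (ann a)) else first (ann a)) = 2 \<longleftrightarrow> member (\<not> p) a"
    by (simp_all add: member_def)
  have set_if: "set (if c then xs else ys) = (if c then set xs else set ys)" for c and xs ys :: "nat list" by simp
  have all2: "\<not> (\<exists>s\<in>set xs. s \<noteq> 2) \<longleftrightarrow> (\<forall>v\<in>set xs. v = 2)" for xs :: "nat list" by simp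
  have b: "(first (ann a) = 0 \<or> first (tl (ann a)) = 0 \<or> first (tl (tl (ann a))) = 0 \<or>
      first (tl (tl (tl (ann a)))) = 0 \<or> rest a = [] \<or> inX i a \<and> \<not> inY i a) = bad i a"
    by (simp only: bad_def)
  show ?thesis
    unfolding table_occ_def occ_flags_def occ_list_def ann_def[symmetric] rest_def[symmetric] Let_def
      inX_def[symmetric] inY_def[symmetric] own other all2 set_append set_if
    unfolding ne b
    by (cases k) (simp_all only: kind.case set_append set_if list.set Un_assoc)
qed

definition all_atoms :: "nat set" where
  "all_atoms = set (fst p1) \<union> set (fst p2)"

text \<open>Since \<open>K\<close> is at least 2, this family is nonempty for every
  certificate.\<close>

definition realizing :: "nat set set" where
  "realizing = (\<lambda>i. {a \<in> all_atoms. inY i a}) ` {1..<K}"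

abbreviation "worldI \<equiv> status all_atoms realizing"
abbreviation "worldX i \<equiv> {a \<in> all_atoms. inX i a}"
abbreviation "worldY i \<equiv> {a \<in> all_atoms. inY i a}"

lemma violated_rule_occ:
  assumes I: "\<And>a. a \<in> rule_atoms r \<Longrightarrow> (Pos a \<in> I \<longleftrightarrow> (\<forall>v \<in> set (rest a). v = 2)) \<and> (Neg a \<in> I \<longleftrightarrow> 2 \<notin> set (rest a))"
    and X: "\<And>a. a \<in> rule_atoms r \<Longrightarrow> a \<in> X \<longleftrightarrow> inX i a" and Y: "\<And>a. a \<in> rule_atoms r \<Longrightarrow> a \<in> Y \<longleftrightarrow> inY i a"
  shows "violated (rule_occ (table_occ W i) p r) \<longleftrightarrow> \<not> ht_rule I X Y r"
proof -
  have h: "a \<in> rule_atoms r" if "a \<in> set (head r)" for a using that by (cases r) auto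
  have b: "elem_atom e \<in> rule_atoms r" if "e \<in> set (body r)" for e
    using that by (cases r) (auto simp: set_body_elem_atom)
  have NB: "(rNBX \<in> table_occ W i (elem_kind e) p (rev (name_of (elem_atom e))) \<longleftrightarrow> \<not> belem_val I X Y e) \<and>
      (rNBY \<in> table_occ W i (elem_kind e) p (rev (name_of (elem_atom e))) \<longleftrightarrow> \<not> belem_val I Y Y e)"
    if "e \<in> set (body r)" for e
  proof -
    define a where "a = elem_atom e"
    have mem_if: "x \<in> (if c then A else B) \<longleftrightarrow> (if c then x \<in> A else x \<in> B)" for x :: nat and c A B by simp
    have body: "(rNBX \<in> table_occ W i (KBody c s) p (rev (name_of a)) \<longleftrightarrow>
          (if c = BLit \<and> s then \<not> inX i a else \<not> (case c of
               BLit \<Rightarrow> \<not> inY i a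
             | BENot \<Rightarrow> (if s then (\<forall>v \<in> set (rest a). v = 2) \<longrightarrow> \<not> inY i a else 2 \<notin> set (rest a) \<longrightarrow> inY i a)
             | BNegENot \<Rightarrow> (if s then (\<forall>v \<in> set (rest a). v = 2) \<and> inY i a else 2 \<notin> set (rest a) \<and> \<not> inY i a)))) \<and>
        (rNBY \<in> table_occ W i (KBody c s) p (rev (name_of a)) \<longleftrightarrow>
          (if c = BLit \<and> s then \<not> inY i a else \<not> (case c of
               BLit \<Rightarrow> \<not> inY i a
             | BENot \<Rightarrow> (if s then (\<forall>v \<in> set (rest a). v = 2) \<longrightarrow> \<not> inY i a else 2 \<notin> set (rest a) \<longrightarrow> inY i a)
             | BNegENot \<Rightarrow> (if s then (\<forall>v \<in> set (rest a). v = 2) \<and> inY i a else 2 \<notin> set (rest a) \<and> \<not> inY i a))))" for c s a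
      unfolding table_occ_name kind.case Let_def Un_iff mem_if by simp
    note Ia = I[OF b[OF that], folded a_def] and Xa = X[OF b[OF that], folded a_def] and Ya = Y[OF b[OF that], folded a_def]
    have "(rNBX \<in> table_occ W i (elem_kind e) p (rev (name_of a)) \<longleftrightarrow> \<not> belem_val I X Y e) \<and>
      (rNBY \<in> table_occ W i (elem_kind e) p (rev (name_of a)) \<longleftrightarrow> \<not> belem_val I Y Y e)"
    proof (cases e)
      case (Lit l)
      then show ?thesis using Xa Ya by (cases l) (simp_all add: body elem_atom_def a_def)
    next
      case (ENot l)
      then show ?thesis using Ia Ya by (cases l) (simp_all add: body elem_atom_def a_def)
    next
      case (NegENot l)
      then show ?thesis using Ia Ya by (cases l) (simp_all add: body elem_atom_def a_def)
    qed
    then show ?thesis by (simp only: a_def)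
  qed
  have H: "rHX \<notin> table_occ W i (elem_kind e) p nm" "rHY \<notin> table_occ W i (elem_kind e) p nm"
    "rNBX \<notin> table_occ W i KHead p nm" "rNBY \<notin> table_occ W i KHead p nm" for e :: "nat body_elem" and nm
    by (cases e; auto simp: table_occ_def occ_flags_def occ_list_def Let_def)+
  have mem_if: "x \<in> (if c then A else B) \<longleftrightarrow> (if c then x \<in> A else x \<in> B)" for x :: nat and c A B by simp
  have HX: "rHX \<in> table_occ W i KHead p (rev (name_of a)) \<longleftrightarrow> inX i a"
    and HY: "rHY \<in> table_occ W i KHead p (rev (name_of a)) \<longleftrightarrow> inY i a" for a
    unfolding table_occ_name kind.case Un_iff mem_if by simp_all
  have "rHX \<in> rule_occ (table_occ W i) p r \<longleftrightarrow> (\<exists>h \<in> set (head r). h \<in> X)"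
    unfolding rule_occ_def Un_iff UN_iff HX using H(1) X h by metis
  moreover have "rHY \<in> rule_occ (table_occ W i) p r \<longleftrightarrow> (\<exists>h \<in> set (head r). h \<in> Y)"
    unfolding rule_occ_def Un_iff UN_iff HY using H(2) Y h by metis
  moreover have "rNBX \<in> rule_occ (table_occ W i) p r \<longleftrightarrow> \<not> (\<forall>e \<in> set (body r). belem_val I X Y e)"
    unfolding rule_occ_def Un_iff UN_iff using NB H(3) by metis
  moreover have "rNBY \<in> rule_occ (table_occ W i) p r \<longleftrightarrow> \<not> (\<forall>e \<in> set (body r). belem_val I Y Y e)"
    unfolding rule_occ_def Un_iff UN_iff using NB H(4) by metis
  ultimately show ?thesis unfolding violated_def ht_rule_def by blast
qed

text \<open>An annotation is no longer than the table, so \<open>K\<close> worlds reach each of its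
  entries.\<close>

lemma world_val_range:
  assumes "rest a \<noteq> []"
  shows "(\<lambda>i. world_val i (rest a)) ` {1..<K} = set (rest a)"
proof -
  have len: "length (rest a) \<le> length W" using length_annot[of W "rev (name_of a)"] by (simp add: rest_def ann_def)
  show ?thesis
  proof (intro equalityI subsetI)
    fix v assume "v \<in> (\<lambda>i. world_val i (rest a)) ` {1..<K}"
    then obtain i where "1 \<le> i" "v = rest a ! (min i (length (rest a)) - 1)"
      using assms by (auto simp: world_val_def)
    moreover have "min i (length (rest a)) - 1 < length (rest a)" using assms by (cases "rest a") auto
    ultimately show "v \<in> set (rest a)" using nth_mem by blast
  next
    fix v assume "v \<in> set (rest a)"
    then obtain j where j: "j < length (rest a)" "v = rest a ! j" by (auto simp: in_set_conv_nth)
    then have "v = world_val (Suc j) (rest a)" by (auto simp: world_val_def min_def Suc_le_eq)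
    then show "v \<in> (\<lambda>i. world_val i (rest a)) ` {1..<K}" using j len by (intro image_eqI[of _ _ "Suc j"]) auto
  qed
qed

text \<open>Over the realizing worlds an atom takes exactly the values in its annotation. No value
  is 0, so none of these worlds falls back on the bits for \<open>X\<close> and
  \<open>Y\<close>.\<close>

lemma worldI_iff:
  assumes W: "0 \<notin> set W" and a: "a \<in> all_atoms" and ne: "rest a \<noteq> []"
  shows "Pos a \<in> worldI \<longleftrightarrow> (\<forall>v \<in> set (rest a). v = 2)" "Neg a \<in> worldI \<longleftrightarrow> 2 \<notin> set (rest a)"
proof -
  have tls: "set (tl xs) \<subseteq> set xs" for xs :: "nat list" by (cases xs) auto
  have "set (rest a) \<subseteq> set (ann a)" unfolding rest_def using tls by blast
  then have "0 \<notin> set (rest a)" using set_annot[of W "rev (name_of a)"] W unfolding ann_def by auto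
  then have nz: "world_val i (rest a) \<noteq> 0" if "i \<in> {1..<K}" for i
    using world_val_range[OF ne] that by (metis imageI)
  have "a \<in> worldY i \<longleftrightarrow> world_val i (rest a) = 2" if "i \<in> {1..<K}" for i
    using nz[OF that] a by (simp add: inY_def)
  then have "(\<forall>J\<in>realizing. a \<in> J) \<longleftrightarrow> (\<forall>v \<in> (\<lambda>i. world_val i (rest a)) ` {1..<K}. v = 2)"
    "(\<forall>J\<in>realizing. a \<notin> J) \<longleftrightarrow> (\<forall>v \<in> (\<lambda>i. world_val i (rest a)) ` {1..<K}. v \<noteq> 2)"
    unfolding realizing_def ball_simps(9) by blast+
  then show "Pos a \<in> worldI \<longleftrightarrow> (\<forall>v \<in> set (rest a). v = 2)" "Neg a \<in> worldI \<longleftrightarrow> 2 \<notin> set (rest a)"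
    unfolding world_val_range[OF ne] Pos_status Neg_status using a by auto
qed

lemma Fail_iff:
  "rFail \<in> F_final \<longleftrightarrow> (\<exists>i<K. \<exists>p. (\<exists>a\<in>set (fst (prog p)). bad i a \<or> \<not> member p a) \<or>
     (\<exists>r\<in>set (snd (prog p)). \<exists>a\<in>rule_atoms r. bad i a))"
proof -
  have "rFail \<in> rule_occ (table_occ W i) p r \<longleftrightarrow> (\<exists>a\<in>rule_atoms r. bad i a)" for i p r
  proof -
    have ra: "rule_atoms r = set (head r) \<union> elem_atom ` set (body r)"
      by (cases r) (auto simp: set_body_elem_atom)
    have k: "rFail \<in> table_occ W i (elem_kind e) p (rev (name_of a)) \<longleftrightarrow> bad i a" for e :: "nat body_elem" and a
      unfolding table_occ_name by (cases e) (auto simp: Let_def)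
    show ?thesis unfolding rule_occ_def ra by (auto simp: k) (auto simp: table_occ_name split: if_splits)
  qed
  then have "rFail \<in> prog_occ (table_occ W i) p P \<longleftrightarrow> (\<exists>a\<in>set (fst P). bad i a \<or> \<not> member p a) \<or>
     (\<exists>r\<in>set (snd P). \<exists>a\<in>rule_atoms r. bad i a)" for i p P
    unfolding prog_occ_def by (auto simp: table_occ_name)
  moreover have "rFail \<in> {rFail, rDiff, rNelp}" by simp
  ultimately show ?thesis by (simp only: mem_final_flags)
qed

lemma Nelp_iff:
  "rNelp \<in> F_final \<longleftrightarrow> (\<exists>p. \<exists>r\<in>set (snd (prog p)). \<exists>a\<in>rule_atoms r. \<not> member p a)"
proof -
  have "rNelp \<in> rule_occ (table_occ W i) p r \<longleftrightarrow> (\<exists>a\<in>rule_atoms r. \<not> member p a)" for i p r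
  proof -
    have ra: "rule_atoms r = set (head r) \<union> elem_atom ` set (body r)"
      by (cases r) (auto simp: set_body_elem_atom)
    have k: "rNelp \<in> table_occ W i (elem_kind e) p (rev (name_of a)) \<longleftrightarrow> \<not> member p a" for e :: "nat body_elem" and a
      unfolding table_occ_name by (cases e) (auto simp: Let_def)
    show ?thesis unfolding rule_occ_def ra by (auto simp: k) (auto simp: table_occ_name split: if_splits)
  qed
  then have "rNelp \<in> prog_occ (table_occ W i) p P \<longleftrightarrow> (\<exists>r\<in>set (snd P). \<exists>a\<in>rule_atoms r. \<not> member p a)" for i p P
    unfolding prog_occ_def by (auto simp: table_occ_name)
  moreover have "rNelp \<in> {rFail, rDiff, rNelp}" by simp
  ultimately have "rNelp \<in> F_final \<longleftrightarrow> (\<exists>i<K. \<exists>p. \<exists>r\<in>set (snd (prog p)). \<exists>a\<in>rule_atoms r. \<not> member p a)"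
    by (simp only: mem_final_flags)
  moreover have "0 < K" by simp
  ultimately show ?thesis by blast
qed

lemma Diff_iff: "rDiff \<in> F_final \<longleftrightarrow> (\<exists>p. \<exists>a\<in>set (fst (prog p)). \<not> member (\<not> p) a)"
proof -
  have "rDiff \<notin> rule_occ (table_occ W i) p r" for i p r
  proof -
    have "rDiff \<notin> table_occ W i (elem_kind e) p nm" "rDiff \<notin> table_occ W i KHead p nm" for e :: "nat body_elem" and nm
      by (cases e; auto simp: table_occ_def occ_flags_def occ_list_def Let_def)+
    then show ?thesis by (auto simp: rule_occ_def)
  qed
  then have "rDiff \<in> prog_occ (table_occ W i) p P \<longleftrightarrow> (\<exists>a\<in>set (fst P). \<not> member (\<not> p) a)" for i p P
    unfolding prog_occ_def by (auto simp: table_occ_name)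
  moreover have "rDiff \<in> {rFail, rDiff, rNelp}" by simp
  ultimately have "rDiff \<in> F_final \<longleftrightarrow> (\<exists>i<K. \<exists>p. \<exists>a\<in>set (fst (prog p)). \<not> member (\<not> p) a)"
    by (simp only: mem_final_flags)
  moreover have "0 < K" by simp
  ultimately show ?thesis by blast
qed

lemma V_iff:
  assumes W: "0 \<notin> set W" and nf: "rFail \<notin> F_final" and elp: "\<And>p. is_elp (elp_of (prog p))"
  shows "rV p \<in> F_final \<longleftrightarrow> (\<exists>i<K. \<not> ht_model worldI (set (snd (prog p))) (worldX i) (worldY i))"
proof -
  have "violated (rule_occ (table_occ W i) p r) \<longleftrightarrow> \<not> ht_rule worldI (worldX i) (worldY i) r"
    if r: "r \<in> set (snd (prog p))" and i: "i < K" for i r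
  proof (rule violated_rule_occ)
    fix a assume a: "a \<in> rule_atoms r"
    have "rule_atoms r \<subseteq> set (fst (prog p))" using elp[of p] r by (auto simp: is_elp_def elp_of_def)
    then have aa: "a \<in> all_atoms" using a unfolding all_atoms_def prog_def by (auto split: if_splits)
    have "\<not> bad i a" using nf r a i unfolding Fail_iff by blast
    then have "rest a \<noteq> []" by (simp add: bad_def)
    then show "(Pos a \<in> worldI \<longleftrightarrow> (\<forall>v \<in> set (rest a). v = 2)) \<and> (Neg a \<in> worldI \<longleftrightarrow> 2 \<notin> set (rest a))"
      using worldI_iff[OF W aa] by blast
    show "a \<in> worldX i \<longleftrightarrow> inX i a" "a \<in> worldY i \<longleftrightarrow> inY i a" using aa by auto
  qed
  then show ?thesis unfolding V_mem_final_flags ht_model_def by blast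
qed

lemma not_bad:
  assumes nf: "rFail \<notin> F_final" and a: "a \<in> all_atoms" and i: "i < K"
  shows "\<not> bad i a"
proof -
  have "a \<in> set (fst (prog True)) \<or> a \<in> set (fst (prog False))" using a by (auto simp: all_atoms_def prog_def)
  then show ?thesis using nf i unfolding Fail_iff by blast
qed

lemma worldX_subset: "rFail \<notin> F_final \<Longrightarrow> i < K \<Longrightarrow> worldX i \<subseteq> worldY i"
  using not_bad by (auto simp: bad_def)

text \<open>A nonzero annotated value overrides both bits, so every world other than 0 is
  total.\<close>

lemma worldX_eq:
  assumes W: "0 \<notin> set W" and nf: "rFail \<notin> F_final" and i: "1 \<le> i" "i < K"
  shows "worldX i = worldY i"
proof -
  have "inX i a \<longleftrightarrow> inY i a" if a: "a \<in> all_atoms" for a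
  proof -
    have ne: "rest a \<noteq> []" using not_bad[OF nf a i(2)] by (simp add: bad_def)
    have "world_val i (rest a) \<in> set (rest a)" using world_val_range[OF ne] i by (metis atLeastLessThan_iff imageI)
    moreover have tls: "set (tl xs) \<subseteq> set xs" for xs :: "nat list" by (cases xs) auto
    have "set (rest a) \<subseteq> set (ann a)" unfolding rest_def using tls by blast
    then have "0 \<notin> set (rest a)" using set_annot[of W "rev (name_of a)"] W unfolding ann_def by auto
    ultimately have "world_val i (rest a) \<noteq> 0" by metis
    then show ?thesis by (simp add: inX_def inY_def)
  qed
  then show ?thesis by auto
qed

end

lemma elp_of_simps [simp]: "fst (elp_of p) = set (fst p)" "snd (elp_of p) = set (snd p)"
  by (simp_all add: elp_of_def)

text \<open>For a genuine member, the absence of \<open>rFail\<close> means that declared atoms are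
  marked, which rules out \<open>rNelp\<close> and makes \<open>rDiff\<close> truthful. The
  remaining accepting cases read off a witness from the worlds of the table, contradicting
  equivalence.\<close>

lemma table_accepts_sound:
  assumes W: "0 \<notin> set W" and acc: "table_accepts W x"
  shows "x \<notin> strong_equivalence_problem"
proof
  assume "x \<in> strong_equivalence_problem"
  then obtain p1 p2 where x: "x = enc_instance (p1, p2)" and 1: "is_elp (elp_of p1)" and 2: "is_elp (elp_of p2)"
    and SE: "strongly_equivalent (elp_of p1) (elp_of p2)" unfolding strong_equivalence_problem_def by blast
  let ?F = "final_flags W x" and ?pr = "prog p1 p2"
  let ?K = "length W + 2"
  let ?I = "status (all_atoms p1 p2) (realizing W p1 p2)"
  let ?X = "\<lambda>i. {a \<in> all_atoms p1 p2. inX W i a}" and ?Y = "\<lambda>i. {a \<in> all_atoms p1 p2. inY W i a}"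
  have elp: "is_elp (elp_of (?pr p))" for p using 1 2 by (simp add: prog_def)
  have "dfa_run x (Tag LAtoms True) = Done" unfolding dfa_run_Done_iff x by blast
  with acc have nf: "rFail \<notin> ?F" and cond: "rNelp \<in> ?F \<or> (rV True \<in> ?F) \<noteq> (rV False \<in> ?F) \<or> rDiff \<in> ?F \<and> rV True \<notin> ?F"
    by (auto simp: table_accepts_def accepting_def)
  have mem: "member W p a" if "a \<in> set (fst (?pr p))" for p a
    using nf that unfolding x Fail_iff by (auto dest: spec[of _ 0])
  have "rNelp \<notin> ?F"
    unfolding x Nelp_iff
  proof (clarify)
    fix p r a assume "r \<in> set (snd (?pr p))" "a \<in> rule_atoms r" "\<not> member W p a"
    then show False using mem[of a p] elp[of p] by (auto simp: is_elp_def)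
  qed
  note V = V_iff[OF W nf[unfolded x] elp]
  \<comment> \<open>The program that is never violated takes the first place of the witness. If the
    other one is violated, the violating world serves as the pair; otherwise any world does and the
    atom sets differ.\<close>
  have wit: "\<exists>X Y. witness (elp_of (?pr p)) (elp_of (?pr (\<not> p))) (realizing W p1 p2) X Y"
    if np: "rV p \<notin> ?F" and d: "rV (\<not> p) \<in> ?F \<or> set (fst p1) \<noteq> set (fst p2)" for p
  proof -
    have A: "set (fst (?pr p)) \<union> set (fst (?pr (\<not> p))) = all_atoms p1 p2"
      by (auto simp: prog_def all_atoms_def)
    have m: "ht_model ?I (set (snd (?pr p))) (?X i) (?Y i)" if "i < ?K" for i
      using np V[of p] that unfolding x by blast
    have J: "realizing W p1 p2 \<noteq> {}" "realizing W p1 p2 \<subseteq> Pow (all_atoms p1 p2)"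
      by (auto simp: realizing_def)
    have mJ: "ht_model ?I (set (snd (?pr p))) J J" if "J \<in> realizing W p1 p2" for J
    proof -
      from that obtain i where i: "1 \<le> i" "i < ?K" "J = ?Y i" by (auto simp: realizing_def)
      then show ?thesis using m[OF i(2)] worldX_eq[OF W nf[unfolded x] i(1,2)] by simp
    qed
    have AA: "set (fst p1) \<noteq> set (fst p2) \<longleftrightarrow> set (fst (?pr p)) \<noteq> set (fst (?pr (\<not> p)))"
      by (auto simp: prog_def)
    obtain i where i: "i < ?K" and "set (fst p1) \<noteq> set (fst p2) \<or> \<not> ht_model ?I (set (snd (?pr (\<not> p)))) (?X i) (?Y i)"
    proof (cases "rV (\<not> p) \<in> ?F")
      case True
      then show ?thesis using V[of "\<not> p"] that unfolding x by blast
    next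
      case False
      then show ?thesis using d that[of 0] by simp
    qed
    then have "witness (elp_of (?pr p)) (elp_of (?pr (\<not> p))) (realizing W p1 p2) (?X i) (?Y i)"
      unfolding witness_def Let_def elp_of_simps A using J mJ m[OF i] worldX_subset[OF nf[unfolded x] i] AA by auto
    then show ?thesis by blast
  qed
  have dif: "rDiff \<in> ?F \<Longrightarrow> set (fst p1) \<noteq> set (fst p2)"
    unfolding x Diff_iff using mem by (auto simp: prog_def split: if_splits)
  have "\<exists>p. rV p \<notin> ?F \<and> (rV (\<not> p) \<in> ?F \<or> set (fst p1) \<noteq> set (fst p2))"
    using cond \<open>rNelp \<notin> ?F\<close> dif by (metis (full_types))
  then obtain p where "rV p \<notin> ?F" "rV (\<not> p) \<in> ?F \<or> set (fst p1) \<noteq> set (fst p2)" by blast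
  from wit[OF this] obtain X Y where w: "witness (elp_of (?pr p)) (elp_of (?pr (\<not> p))) (realizing W p1 p2) X Y" by blast
  have "\<not> strongly_equivalent (elp_of p1) (elp_of p2)"
    using w strongly_equivalent_iff_no_witness[OF _ _ 1 2] by (cases p) (auto simp: prog_def)
  then show False using SE by blast
qed

section \<open>Small certificates\<close>

definition rule_al :: "nat elp_rule \<Rightarrow> nat list" where
  "rule_al r = head r @ map elem_atom (body r)"

definition occ_atoms :: "fin_elp \<Rightarrow> nat list" where
  "occ_atoms p = fst p @ concat (map rule_al (snd p))"

lemma set_rule_al: "set (rule_al r) = rule_atoms r"
  by (cases r) (auto simp: rule_al_def set_body_elem_atom)

abbreviation "enc_size xs \<equiv> (\<Sum>a\<leftarrow>xs. length (enc_nat a))"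

lemma enc_size_list: "(\<And>x. enc_size (g x) \<le> length (f x)) \<Longrightarrow> enc_size (concat (map g xs)) \<le> length (enc_list f xs)"
proof (induction xs)
  case (Cons x xs)
  show ?case using Cons.IH[OF Cons.prems] Cons.prems[of x] by simp
qed simp

lemma enc_size_enc_instance: "enc_size (occ_atoms p1 @ occ_atoms p2) \<le> length (enc_instance (p1, p2))"
proof -
  have n: "enc_size (concat (map (\<lambda>a. [a]) xs)) \<le> length (enc_list enc_nat xs)" for xs
    by (rule enc_size_list) simp
  have m: "concat (map (\<lambda>a. [a]) xs) = xs" for xs :: "nat list" by (induction xs) auto
  have "enc_size [elem_atom e] \<le> length (enc_body_elem e)" for e
  proof -
    obtain l where "e = Lit l \<or> e = ENot l \<or> e = NegENot l" by (cases e) auto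
    then show ?thesis by (cases l) (auto simp: elem_atom_def)
  qed
  from enc_size_list[where g = "\<lambda>e. [elem_atom e]", OF this]
  have e: "enc_size (concat (map (\<lambda>e. [elem_atom e]) es)) \<le> length (enc_list enc_body_elem es)" for es .
  have m': "concat (map (\<lambda>e. [elem_atom e]) es) = map elem_atom es" for es :: "nat body_elem list" by (induction es) auto
  have "enc_size (rule_al r) \<le> length (enc_rule r)" for r
    using n[of "head r"] e[of "body r"] unfolding m m' by (simp add: rule_al_def enc_rule_def)
  from enc_size_list[where g = rule_al, OF this]
  have r: "enc_size (concat (map rule_al rs)) \<le> length (enc_list enc_rule rs)" for rs .
  have "enc_size (occ_atoms p) \<le> length (enc_elp p)" for p
    using n[of "fst p"] r[of "snd p"] unfolding m by (simp add: occ_atoms_def enc_elp_def)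
  from this[of p1] this[of p2] show ?thesis by (simp add: enc_instance_def)
qed

lemma length_name_of: "length (enc_nat n) = 2 * length (name_of n) + 1"
  by (induction n rule: name_of.induct) (subst enc_nat.simps, subst name_of.simps, auto)

lemma name_length_le: "a \<in> set xs \<Longrightarrow> length (name_of a) \<le> enc_size xs"
  by (induction xs) (auto simp: length_name_of)

lemma length_le_enc_size: "length xs \<le> enc_size xs"
  by (induction xs) (auto simp: length_name_of)

text \<open>For each atom, one set containing it and one omitting it (where they exist) preserve
  both literals of \<open>status\<close>. The additional \<open>J0\<close> is kept on purpose: it
  may be the only set that separates the programs.\<close>

lemma small_subfamily:
  assumes "J0 \<in> \<J>"
  shows "\<exists>Js. J0 \<in> set Js \<and> set Js \<subseteq> \<J> \<and> length Js = 2 * length as + 1 \<and>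
    (\<forall>A \<subseteq> set as. status A (set Js) = status A \<J>)"
proof -
  define f where "f a = (if \<exists>J\<in>\<J>. a \<in> J then SOME J. J \<in> \<J> \<and> a \<in> J else J0)" for a
  define g where "g a = (if \<exists>J\<in>\<J>. a \<notin> J then SOME J. J \<in> \<J> \<and> a \<notin> J else J0)" for a
  have f: "f a \<in> \<J>" "(\<exists>J\<in>\<J>. a \<in> J) \<Longrightarrow> a \<in> f a" for a
    using assms someI_ex[of "\<lambda>J. J \<in> \<J> \<and> a \<in> J"] unfolding f_def by (auto split: if_splits)
  have g: "g a \<in> \<J>" "(\<exists>J\<in>\<J>. a \<notin> J) \<Longrightarrow> a \<notin> g a" for a
    using assms someI_ex[of "\<lambda>J. J \<in> \<J> \<and> a \<notin> J"] unfolding g_def by (auto split: if_splits)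
  let ?Js = "J0 # map f as @ map g as"
  have sub: "set ?Js \<subseteq> \<J>" using assms f(1) g(1) by auto
  have "status A (set ?Js) = status A \<J>" if A: "A \<subseteq> set as" for A
  proof -
    have "(\<forall>J\<in>set ?Js. a \<in> J) \<longleftrightarrow> (\<forall>J\<in>\<J>. a \<in> J)" "(\<forall>J\<in>set ?Js. a \<notin> J) \<longleftrightarrow> (\<forall>J\<in>\<J>. a \<notin> J)" if a: "a \<in> A" for a
    proof -
      have "f a \<in> set ?Js" "g a \<in> set ?Js" using a A by auto
      then show "(\<forall>J\<in>set ?Js. a \<in> J) \<longleftrightarrow> (\<forall>J\<in>\<J>. a \<in> J)" "(\<forall>J\<in>set ?Js. a \<notin> J) \<longleftrightarrow> (\<forall>J\<in>\<J>. a \<notin> J)"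
        using sub f(2)[of a] g(2)[of a] by blast+
    qed
    then show ?thesis unfolding status_def by (auto simp del: set_simps)
  qed
  then show ?thesis using sub by (intro exI[of _ ?Js]) auto
qed

text \<open>The table lists all occurring atoms, not only the declared ones, so that a program with
  undeclared atoms raises \<open>rNelp\<close> and not \<open>rFail\<close>.\<close>

lemma table_accepts_complete_aux:
  fixes p1 p2 :: fin_elp
  defines "pr \<equiv> prog p1 p2" and "as \<equiv> remdups (occ_atoms p1 @ occ_atoms p2)"
    and "n \<equiv> length (enc_instance (p1, p2))" and "A \<equiv> all_atoms p1 p2"
  assumes XY: "X \<subseteq> Y" "Y \<subseteq> A" and Js: "length Js \<le> 2 * length as + 1" "Js \<noteq> []" "\<And>J. J \<in> set Js \<Longrightarrow> J \<subseteq> A"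
    and good: "(\<exists>p. \<not> is_elp (elp_of (pr p))) \<or> (\<exists>p.
      (\<forall>J \<in> set Js. ht_model (status A (set Js)) (set (snd (pr p))) J J) \<and>
      ht_model (status A (set Js)) (set (snd (pr p))) X Y \<and>
      (set (fst p1) \<noteq> set (fst p2) \<or> \<not> ht_model (status A (set Js)) (set (snd (pr (\<not> p)))) X Y \<or>
       (\<exists>J \<in> set Js. \<not> ht_model (status A (set Js)) (set (snd (pr (\<not> p)))) J J)))"
  shows "\<exists>W. set W \<subseteq> {1, 2, 3, 4} \<and> table_accepts W (enc_instance (p1, p2)) \<and> length W \<le> n * (3 * n + 7)"
proof -
  define l where "l a = [bsym (a \<in> set (fst p1)), bsym (a \<in> set (fst p2)), bsym (a \<in> X), bsym (a \<in> Y)]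
    @ map (\<lambda>J. bsym (a \<in> J)) Js" for a
  define W where "W = concat (map (entry l) as)"
  let ?x = "enc_instance (p1, p2)"
  have l: "set (l a) \<subseteq> {1, 2}" for a unfolding l_def bsym_def by auto
  have W: "set W \<subseteq> {1, 2, 3, 4}"
  proof -
    have "set (entry l a) \<subseteq> {1, 2, 3, 4}" for a
      unfolding entry_def using set_name_of[of a] l[of a] by auto
    then show ?thesis unfolding W_def by auto
  qed
  then have W0: "0 \<notin> set W" by auto
  have dist: "distinct as" unfolding as_def by simp
  have ann: "ann W a = l a" if "a \<in> set as" for a
    unfolding ann_def W_def annot_table[OF l dist] using that by simp
  have A_as: "A \<subseteq> set as" unfolding A_def all_atoms_def as_def occ_atoms_def by auto
  have fst_as: "set (fst (pr p)) \<subseteq> A" for p unfolding pr_def prog_def A_def all_atoms_def by auto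
  have rule_as: "rule_atoms r \<subseteq> set as" if "r \<in> set (snd (pr p))" for r p
    using that unfolding pr_def prog_def as_def occ_atoms_def set_rule_al[symmetric] by (auto split: if_splits)
  \<comment> \<open>An entry has four bits and two end marks, which makes the table long enough for
    the number of scans to cover all of \<open>Js\<close>.\<close>
  have lenW: "6 * length as \<le> length W"
  proof -
    have "6 \<le> length (entry l a)" for a by (simp add: entry_def l_def)
    then have "6 * length bs \<le> length (concat (map (entry l) bs))" for bs
      by (induction bs) (auto simp: add_mono)
    then show ?thesis unfolding W_def .
  qed
  have rest: "rest W a = map (\<lambda>J. bsym (a \<in> J)) Js" if "a \<in> set as" for a
    using ann[OF that] by (simp add: rest_def l_def)
  have bs: "bsym b = 0 \<longleftrightarrow> False" "bsym b = 2 \<longleftrightarrow> b" for b by (simp_all add: bsym_def)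
  have wv: "world_val i (rest W a) = (if i = 0 then 0 else bsym (a \<in> Js ! (min i (length Js) - 1)))" if "a \<in> set as" for i a
  proof -
    have "min i (length Js) - 1 < length Js" using Js(2) by (cases Js) auto
    then show ?thesis using rest[OF that] Js(2) by (simp add: world_val_def)
  qed
  have inY: "inY W i a \<longleftrightarrow> (if i = 0 then a \<in> Y else a \<in> Js ! (min i (length Js) - 1))"
    and inX: "inX W i a \<longleftrightarrow> (if i = 0 then a \<in> X else a \<in> Js ! (min i (length Js) - 1))" if "a \<in> set as" for i a
    unfolding inY_def inX_def wv[OF that] ann[OF that] by (simp_all add: l_def bs)
  have member: "member W p a \<longleftrightarrow> a \<in> set (fst (pr p))" if "a \<in> set as" for p a
    unfolding member_def ann[OF that] using bs by (cases p) (simp_all add: l_def pr_def prog_def)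
  have notbad: "\<not> bad W i a" if "a \<in> set as" for i a
    unfolding bad_def inX[OF that] inY[OF that] rest[OF that] ann[OF that] using bs XY(1) Js(2) by (auto simp: l_def)
  have nf: "rFail \<notin> final_flags W ?x"
    unfolding Fail_iff pr_def[symmetric] using notbad member fst_as A_as rule_as by blast
  have dfa: "dfa_run ?x (Tag LAtoms True) = Done" unfolding dfa_run_Done_iff by blast
  have acc: "table_accepts W ?x"
  proof (cases "\<exists>p. \<not> is_elp (elp_of (pr p))")
    case True
    then obtain p r a where "r \<in> set (snd (pr p))" "a \<in> rule_atoms r" "a \<notin> set (fst (pr p))"
      unfolding is_elp_def elp_of_simps by blast
    then have "rNelp \<in> final_flags W ?x"
      unfolding Nelp_iff pr_def[symmetric] using member rule_as by blast
    then show ?thesis using nf by (simp add: table_accepts_def accepting_def)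
  next
    case False
    then have elp: "is_elp (elp_of (pr p))" for p by blast
    let ?K = "length W + 2"
    have Y0: "{a \<in> A. inY W 0 a} = Y" "{a \<in> A. inX W 0 a} = X"
    proof -
      have "inY W 0 a \<longleftrightarrow> a \<in> Y" "inX W 0 a \<longleftrightarrow> a \<in> X" if "a \<in> A" for a
        using that A_as inX[of a 0] inY[of a 0] by auto
      then show "{a \<in> A. inY W 0 a} = Y" "{a \<in> A. inX W 0 a} = X" using XY by auto
    qed
    have Yi: "{a \<in> A. inY W i a} = Js ! (min i (length Js) - 1)" "{a \<in> A. inX W i a} = Js ! (min i (length Js) - 1)"
      if "1 \<le> i" for i
    proof -
      have "min i (length Js) - 1 < length Js" using Js(2) by (cases Js) auto
      then have "Js ! (min i (length Js) - 1) \<subseteq> A" using Js(3) nth_mem by blast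
      moreover have "inY W i a \<longleftrightarrow> a \<in> Js ! (min i (length Js) - 1)" "inX W i a \<longleftrightarrow> a \<in> Js ! (min i (length Js) - 1)"
        if "a \<in> A" for a
        using that A_as inX[of a i] inY[of a i] \<open>1 \<le> i\<close> by auto
      ultimately show "{a \<in> A. inY W i a} = Js ! (min i (length Js) - 1)" "{a \<in> A. inX W i a} = Js ! (min i (length Js) - 1)"
        by blast+
    qed
    have mem: "Js ! (min i (length Js) - 1) \<in> set Js" for i
      using Js(2) by (cases Js) (auto simp: nth_Cons split: nat.splits intro!: nth_mem)
    have ex: "\<exists>i. 1 \<le> i \<and> i < ?K \<and> J = Js ! (min i (length Js) - 1)" if J: "J \<in> set Js" for J
    proof -
      obtain j where "j < length Js" "J = Js ! j" using J by (auto simp: in_set_conv_nth)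
      then show ?thesis using Js(1) lenW by (intro exI[of _ "Suc j"]) (auto simp: min_def)
    qed
    have real: "realizing W p1 p2 = set Js"
    proof -
      have "realizing W p1 p2 = (\<lambda>i. Js ! (min i (length Js) - 1)) ` {1..<?K}"
        unfolding realizing_def A_def[symmetric] using Yi(1) by (intro image_cong) auto
      also have "\<dots> = set Js"
      proof (intro equalityI subsetI)
        fix J assume "J \<in> set Js"
        from ex[OF this] show "J \<in> (\<lambda>i. Js ! (min i (length Js) - 1)) ` {1..<?K}" by auto
      qed (use mem in auto)
      finally show ?thesis .
    qed
    let ?I = "status A (set Js)"
    have V: "rV p \<in> final_flags W ?x \<longleftrightarrow> \<not> ht_model ?I (set (snd (pr p))) X Y \<or>
        (\<exists>J \<in> set Js. \<not> ht_model ?I (set (snd (pr p))) J J)" for p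
    proof -
      have "rV p \<in> final_flags W ?x \<longleftrightarrow> (\<exists>i<?K. \<not> ht_model ?I (set (snd (pr p))) {a \<in> A. inX W i a} {a \<in> A. inY W i a})"
        using V_iff[OF W0 nf elp[unfolded pr_def], of p] unfolding real A_def[symmetric] pr_def[symmetric] .
      also have "\<dots> \<longleftrightarrow> \<not> ht_model ?I (set (snd (pr p))) X Y \<or> (\<exists>i. 1 \<le> i \<and> i < ?K \<and>
          \<not> ht_model ?I (set (snd (pr p))) {a \<in> A. inX W i a} {a \<in> A. inY W i a})"
      proof -
        have "(\<exists>i<?K. P i) \<longleftrightarrow> P 0 \<or> (\<exists>i. 1 \<le> i \<and> i < ?K \<and> P i)" for P :: "nat \<Rightarrow> bool"
        proof
          assume "\<exists>i<?K. P i"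
          then obtain i where "i < ?K" "P i" by blast
          then show "P 0 \<or> (\<exists>i. 1 \<le> i \<and> i < ?K \<and> P i)" by (cases i) auto
        qed auto
        from this[of "\<lambda>i. \<not> ht_model ?I (set (snd (pr p))) {a \<in> A. inX W i a} {a \<in> A. inY W i a}"]
        show ?thesis unfolding Y0 .
      qed
      also have "\<dots> \<longleftrightarrow> \<not> ht_model ?I (set (snd (pr p))) X Y \<or> (\<exists>J \<in> set Js. \<not> ht_model ?I (set (snd (pr p))) J J)"
      proof -
        have "(\<exists>i. 1 \<le> i \<and> i < ?K \<and> \<not> ht_model ?I (set (snd (pr p))) {a \<in> A. inX W i a} {a \<in> A. inY W i a}) \<longleftrightarrow>
          (\<exists>i. 1 \<le> i \<and> i < ?K \<and> \<not> ht_model ?I (set (snd (pr p))) (Js ! (min i (length Js) - 1)) (Js ! (min i (length Js) - 1)))"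
          using Yi by (intro ex_cong1 conj_cong refl) simp
        also have "\<dots> \<longleftrightarrow> (\<exists>J \<in> set Js. \<not> ht_model ?I (set (snd (pr p))) J J)"
        proof
          assume "\<exists>J \<in> set Js. \<not> ht_model ?I (set (snd (pr p))) J J"
          then obtain J where J: "J \<in> set Js" "\<not> ht_model ?I (set (snd (pr p))) J J" by blast
          from ex[OF J(1)] J(2) show "\<exists>i. 1 \<le> i \<and> i < ?K \<and>
            \<not> ht_model ?I (set (snd (pr p))) (Js ! (min i (length Js) - 1)) (Js ! (min i (length Js) - 1))" by auto
        qed (use mem in blast)
        finally show ?thesis by simp
      qed
      finally show ?thesis .
    qed
    have D: "rDiff \<in> final_flags W ?x \<longleftrightarrow> set (fst p1) \<noteq> set (fst p2)"
    proof -
      have "rDiff \<in> final_flags W ?x \<longleftrightarrow> (\<exists>p. \<exists>a\<in>set (fst (pr p)). a \<notin> set (fst (pr (\<not> p))))"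
        unfolding Diff_iff pr_def[symmetric] using member fst_as A_as by blast
      also have "\<dots> \<longleftrightarrow> set (fst p1) \<noteq> set (fst p2)" by (auto simp: pr_def prog_def ex_bool_eq)
      finally show ?thesis .
    qed
    from good False obtain p where p: "rV p \<notin> final_flags W ?x"
      "set (fst p1) \<noteq> set (fst p2) \<or> rV (\<not> p) \<in> final_flags W ?x" unfolding V by blast
    then have "(rV True \<in> final_flags W ?x) \<noteq> (rV False \<in> final_flags W ?x) \<or>
        rDiff \<in> final_flags W ?x \<and> rV True \<notin> final_flags W ?x"
      unfolding D by (cases p) auto
    then show ?thesis using nf by (auto simp: table_accepts_def accepting_def)
  qed
  have "length W \<le> n * (3 * n + 7)"
  proof -
    have as: "length as \<le> n"
      using length_remdups_leq[of "occ_atoms p1 @ occ_atoms p2"] length_le_enc_size[of "occ_atoms p1 @ occ_atoms p2"]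
        enc_size_enc_instance[of p1 p2] unfolding as_def n_def by linarith
    \<comment> \<open>An entry consists of a name of at most \<open>n\<close> symbols, two end
      marks, four bits and at most \<open>2 * n + 1\<close> values.\<close>
    have "length (entry l a) \<le> 3 * n + 7" if "a \<in> set as" for a
    proof -
      have "length (name_of a) \<le> n"
        using name_length_le[of a "occ_atoms p1 @ occ_atoms p2"] that enc_size_enc_instance[of p1 p2]
        unfolding as_def n_def by (simp del: append_assoc)
      then show ?thesis using Js(1) as by (simp add: entry_def l_def)
    qed
    then have "set bs \<subseteq> set as \<Longrightarrow> length (concat (map (entry l) bs)) \<le> length bs * (3 * n + 7)" for bs
      by (induction bs) (auto simp: add_mono)
    then have "length W \<le> length as * (3 * n + 7)" unfolding W_def by blast
    also have "\<dots> \<le> n * (3 * n + 7)" using as by (rule mult_right_mono) simp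
    finally show ?thesis .
  qed
  with W acc show ?thesis by blast
qed

lemma table_accepts_complete:
  assumes x: "x \<notin> strong_equivalence_problem"
  shows "\<exists>W. set W \<subseteq> {1, 2, 3, 4} \<and> table_accepts W x \<and> length W \<le> length x * (3 * length x + 7)"
proof (cases "x \<in> range enc_instance")
  case False
  then have "table_accepts [] x" by (simp add: table_accepts_def accepting_def dfa_run_Done_iff)
  then show ?thesis by (intro exI[of _ "[]"]) simp
next
  case True
  then obtain p1 p2 where xe: "x = enc_instance (p1, p2)" by auto
  let ?A = "all_atoms p1 p2" and ?as = "remdups (occ_atoms p1 @ occ_atoms p2)" and ?pr = "prog p1 p2"
  show ?thesis
  proof (cases "is_elp (elp_of p1) \<and> is_elp (elp_of p2)")
    case False
    then have "\<exists>p. \<not> is_elp (elp_of (?pr p))" by (auto simp: prog_def ex_bool_eq)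
    then show ?thesis unfolding xe
      by (intro table_accepts_complete_aux[of "{}" "{}" p1 p2 "[{}]"]) auto
  next
    case elp: True
    then have "\<not> strongly_equivalent (elp_of p1) (elp_of p2)"
      using x unfolding xe enc_instance_mem_iff by simp
    then obtain \<J> X Y where "witness (elp_of p1) (elp_of p2) \<J> X Y \<or> witness (elp_of p2) (elp_of p1) \<J> X Y"
      using strongly_equivalent_iff_no_witness[of "elp_of p1" "elp_of p2"] elp by auto
    then obtain p where "witness (elp_of (?pr p)) (elp_of (?pr (\<not> p))) \<J> X Y"
      by (metis prog_def)
    moreover have A: "set (fst (?pr p)) \<union> set (fst (?pr (\<not> p))) = ?A" by (auto simp: prog_def all_atoms_def)
    ultimately have w: "\<J> \<noteq> {}" "\<J> \<subseteq> Pow ?A" "X \<subseteq> Y" "Y \<subseteq> ?A"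
      "\<And>J. J \<in> \<J> \<Longrightarrow> ht_model (status ?A \<J>) (set (snd (?pr p))) J J" "ht_model (status ?A \<J>) (set (snd (?pr p))) X Y"
      and d: "set (fst (?pr p)) \<noteq> set (fst (?pr (\<not> p))) \<or> \<not> ht_model (status ?A \<J>) (set (snd (?pr (\<not> p)))) X Y \<or>
        (\<exists>J \<in> \<J>. \<not> ht_model (status ?A \<J>) (set (snd (?pr (\<not> p)))) J J)"
      unfolding witness_def Let_def elp_of_simps A by blast+
    \<comment> \<open>If some realizing set violates the other program, such a set is chosen, so
      that passing to the subfamily does not lose the separation.\<close>
    obtain J0 where J0: "J0 \<in> \<J>" "(\<exists>J \<in> \<J>. \<not> ht_model (status ?A \<J>) (set (snd (?pr (\<not> p)))) J J) \<longrightarrow>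
        \<not> ht_model (status ?A \<J>) (set (snd (?pr (\<not> p)))) J0 J0" using w(1) by blast
    from small_subfamily[OF J0(1), of ?as] obtain Js where Js: "J0 \<in> set Js" "set Js \<subseteq> \<J>" "length Js = 2 * length ?as + 1"
      and st: "\<And>B. B \<subseteq> set ?as \<Longrightarrow> status B (set Js) = status B \<J>" by blast
    have stA: "status ?A (set Js) = status ?A \<J>" by (rule st) (auto simp: all_atoms_def occ_atoms_def)
    have dif: "set (fst (?pr p)) \<noteq> set (fst (?pr (\<not> p))) \<longleftrightarrow> set (fst p1) \<noteq> set (fst p2)" by (auto simp: prog_def)
    show ?thesis unfolding xe
    proof (rule table_accepts_complete_aux[of X Y p1 p2 Js])
      show "length Js \<le> 2 * length ?as + 1" "Js \<noteq> []" using Js by auto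
      show "J \<subseteq> ?A" if "J \<in> set Js" for J using that Js(2) w(2) by blast
      show "(\<exists>p. \<not> is_elp (elp_of (?pr p))) \<or> (\<exists>p.
      (\<forall>J \<in> set Js. ht_model (status ?A (set Js)) (set (snd (?pr p))) J J) \<and>
      ht_model (status ?A (set Js)) (set (snd (?pr p))) X Y \<and>
      (set (fst p1) \<noteq> set (fst p2) \<or> \<not> ht_model (status ?A (set Js)) (set (snd (?pr (\<not> p)))) X Y \<or>
       (\<exists>J \<in> set Js. \<not> ht_model (status ?A (set Js)) (set (snd (?pr (\<not> p)))) J J)))"
        unfolding stA using w(5,6) d J0(2) Js(1,2) dif by blast
    qed (use w in auto)
  qed
qed

section \<open>The verifier as a program\<close>

instance bkind :: countable by countable_datatype
instance kind :: countable by countable_datatype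
instance list_kind :: countable by countable_datatype
instance dstate :: countable by countable_datatype

lemma finite_dstate: "finite (UNIV :: dstate set)"
proof -
  have b: "finite (UNIV :: bkind set)"
  proof (rule finite_subset)
    show "UNIV \<subseteq> {BLit, BENot, BNegENot}" using bkind.exhaust by blast
  qed simp
  have l: "finite (UNIV :: list_kind set)"
  proof (rule finite_subset)
    show "UNIV \<subseteq> {LAtoms, LRules, LHead, LBody}" using list_kind.exhaust by blast
  qed simp
  have k: "finite (UNIV :: kind set)"
  proof (rule finite_subset)
    show "UNIV \<subseteq> {KAtom, KHead} \<union> case_prod KBody ` (UNIV \<times> UNIV)"
    proof
      fix k :: kind show "k \<in> {KAtom, KHead} \<union> case_prod KBody ` (UNIV \<times> UNIV)" by (cases k) auto
    qed
  qed (intro finite_UnI finite_imageI finite_cartesian_product; simp add: b)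
  show ?thesis
  proof (rule finite_subset)
    show "UNIV \<subseteq> {Done, Bad} \<union> case_prod Tag ` (UNIV \<times> UNIV) \<union> case_prod Nat0 ` (UNIV \<times> UNIV) \<union> case_prod NatD ` (UNIV \<times> UNIV)
       \<union> (\<lambda>(c, k, p). NatS c k p) ` (UNIV \<times> UNIV \<times> UNIV) \<union> range E1 \<union> range E2 \<union> case_prod E3 ` (UNIV \<times> UNIV)"
      (is "_ \<subseteq> ?S")
    proof
      fix q :: dstate
      show "q \<in> ?S"
      proof (cases q)
        case (NatS c k p)
        then have "q = (\<lambda>(c, k, p). NatS c k p) (c, k, p)" by simp
        then show ?thesis by blast
      qed auto
    qed
  qed (intro finite_UnI finite_imageI finite_cartesian_product; simp add: b l k)
qed

text \<open>An automaton state is stored as a single tape symbol; the successor avoids the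
  blank.\<close>

definition qsym :: "dstate \<Rightarrow> nat" where
  "qsym q = Suc (to_nat q)"

definition qof :: "nat \<Rightarrow> dstate" where
  "qof s = from_nat (s - 1)"

lemma qof_qsym [simp]: "qof (qsym q) = q"
  by (simp add: qof_def qsym_def)

definition vB :: nat where
  "vB = 5 + Suc (Max (range qsym))"

lemma qsym_less: "0 < qsym q" "qsym q < vB"
proof -
  have "qsym q \<le> Max (range qsym)" using finite_dstate by (intro Max_ge) auto
  then show "0 < qsym q" "qsym q < vB" by (simp_all add: vB_def qsym_def)
qed

abbreviation (input) "rFL \<equiv> 1::nat"
abbreviation (input) "rXR \<equiv> 2::nat"
abbreviation (input) "rWR \<equiv> 3::nat"
abbreviation (input) "rH \<equiv> 4::nat"
abbreviation (input) "rXX \<equiv> 5::nat"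
abbreviation (input) "rW \<equiv> 6::nat"
abbreviation (input) "rW2 \<equiv> 7::nat"
abbreviation (input) "rIdx \<equiv> 8::nat"
abbreviation (input) "rQ \<equiv> 9::nat"
abbreviation (input) "rName \<equiv> 10::nat"
abbreviation (input) "rEnt \<equiv> 11::nat"
abbreviation (input) "rMode \<equiv> 12::nat"
abbreviation (input) "rMatch \<equiv> 13::nat"
abbreviation (input) "rAnn \<equiv> 14::nat"
abbreviation (input) "rTmp \<equiv> 15::nat"
abbreviation (input) "rBad \<equiv> 16::nat"
abbreviation (input) "rCnt \<equiv> 17::nat"
abbreviation (input) "rYV \<equiv> 18::nat"
abbreviation (input) "rS1 \<equiv> 19::nat"
abbreviation (input) "rS0 \<equiv> 29::nat"
abbreviation (input) "rAcc \<equiv> 30::nat"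

text \<open>Certificates are bit words, so a table symbol from 1 to 4 is coded by two bits. The word
  is read from its end: \<open>h\<close> is the second bit of the pair, held back until the first
  one \<open>s\<close> arrives. An unpaired bit is ignored.\<close>

definition tok :: "nat \<Rightarrow> nat \<Rightarrow> nat" where
  "tok s h = (if s = 2 then 2 else 0) + (if h = 2 then 2 else 1)"

text \<open>Each pass over a register reverses it, hence the intermediate copies. \<open>rW2\<close>
  counts the scans: one per table symbol and two more, which is the number of worlds. It is separate
  from \<open>rW\<close> because the lookups inside the scan loop over \<open>rW\<close>.\<close>

definition parse_prog :: com where
  "parse_prog =
     For 0 (\<lambda>s. Case rFL (\<lambda>f. if f = 0 then (if s = 3 then Push rFL 1 else Push rXR s) else Push rWR s)) ;;
     For rXR (\<lambda>s. Push rXX s) ;;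
     For rWR (\<lambda>s. Case rH (\<lambda>h. if h = 0 then Push rH s
        else Pop rH ;; Push rW (tok s h) ;; Push rW2 1)) ;;
     Push rW2 1 ;; Push rW2 1"

definition compare_step :: "nat \<Rightarrow> com" where
  "compare_step s = Case rTmp (\<lambda>t. if t = s then Pop rTmp else Push rBad 1)"

text \<open>Copying the name into \<open>rTmp\<close> reverses it, which is why the lookup compares
  with \<open>rev nm\<close>. The copy is consumed by the comparison while the name is kept.\<close>

definition eq_prog :: com where
  "eq_prog =
     Clear rTmp ;; For rName (\<lambda>s. Push rTmp s) ;; Clear rBad ;;
     For rEnt compare_step ;;
     Case rTmp (\<lambda>t. if t = 0 then Case rBad (\<lambda>b. if b = 0 then Push rMatch 1 else Skip) else Skip)"

definition lookup_prog_step :: "nat \<Rightarrow> com" where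
  "lookup_prog_step t = Case rMode (\<lambda>m.
     if m = 0 then
       if t \<le> 2 then Push rEnt t
       else if t = 3 then eq_prog ;; Push rMode 1
       else Skip
     else
       if t \<le> 2 then Case rMatch (\<lambda>c. if c = 0 then Skip else Push rAnn t)
       else if t = 3 then Skip
       else Clear rMode ;; Clear rEnt ;; Clear rMatch)"

definition lookup_prog :: com where
  "lookup_prog = Clear rMode ;; Clear rEnt ;; Clear rMatch ;; Clear rAnn ;; For rW lookup_prog_step"

definition flag_prog :: "nat list \<Rightarrow> com" where
  "flag_prog rs = seqs (map (\<lambda>r. Push r 1) rs)"

text \<open>The nested cases move the fields of an annotation into the control, where
  \<open>occ_list\<close> is evaluated as a finite table. \<open>rCnt\<close> starts as the world
  index and counts down, so that \<open>rYV\<close> ends with the value for this world.\<close>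

definition occ_prog :: "kind \<Rightarrow> bool \<Rightarrow> com" where
  "occ_prog k p = lookup_prog ;;
     Clear rCnt ;; Clear rYV ;; Clear rS1 ;; Clear rS0 ;; For rIdx (\<lambda>_. Push rCnt 1) ;;
     Case rAnn (\<lambda>m1. Pop rAnn ;; Case rAnn (\<lambda>m2. Pop rAnn ;; Case rAnn (\<lambda>x. Pop rAnn ;; Case rAnn (\<lambda>y. Pop rAnn ;;
       For rAnn (\<lambda>s. (if s = 2 then Push rS1 1 else Push rS0 1) ;;
         Case rCnt (\<lambda>c. if c = 0 then Skip else Pop rCnt ;; Clear rYV ;; Push rYV s)) ;;
       Case rYV (\<lambda>v. Case rS1 (\<lambda>s1. Case rS0 (\<lambda>s0.
         flag_prog (occ_list k p m1 m2 x y v (s1 \<noteq> 0) (s0 \<noteq> 0)))))))))"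

fun action_prog :: "action \<Rightarrow> nat \<Rightarrow> com" where
  "action_prog ANone s = Skip"
| "action_prog ABit s = Push rName s"
| "action_prog (AOcc k p) s = occ_prog k p ;; Clear rName"
| "action_prog AStart s = Clear rHX ;; Clear rHY ;; Clear rNBX ;; Clear rNBY"
| "action_prog (AEnd p) s =
     Case rNBY (\<lambda>a. Case rHY (\<lambda>b. Case rNBX (\<lambda>c. Case rHX (\<lambda>d.
       if a = 0 \<and> b = 0 \<or> c = 0 \<and> d = 0 then Push (rV p) 1 else Skip))))"

definition scan_prog_step :: "nat \<Rightarrow> com" where
  "scan_prog_step s = Case rQ (\<lambda>q.
     action_prog (snd (dfa (qof q) (s = 2))) s ;; Clear rQ ;; Push rQ (qsym (fst (dfa (qof q) (s = 2)))))"

definition verifier_prog :: com where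
  "verifier_prog = parse_prog ;;
     For rW2 (\<lambda>_. Clear rQ ;; Push rQ (qsym (Tag LAtoms True)) ;; Clear rName ;;
       For rXX scan_prog_step ;; Push rIdx 1) ;;
     Case rQ (\<lambda>q. Case rFail (\<lambda>f. Case rNelp (\<lambda>n. Case (rV True) (\<lambda>a. Case (rV False) (\<lambda>b. Case rDiff (\<lambda>d.
       if qof q \<noteq> Done \<or> f = 0 \<and> (n \<noteq> 0 \<or> (a \<noteq> 0) \<noteq> (b \<noteq> 0) \<or> d \<noteq> 0 \<and> a = 0) then Push rAcc 1 else Skip))))))"

lemma set_occ_list: "set (occ_list k p m1 m2 x y v s1 s0) \<subseteq> {20..28}"
proof -
  have set_if: "set (if c then xs else ys) = (if c then set xs else set ys)" for c and xs ys :: "nat list" by simp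
  have I: "S \<subseteq> {20..28} \<Longrightarrow> T \<subseteq> {20..28} \<Longrightarrow> (if c then S else T) \<subseteq> {20..28}"
    for c and S T :: "nat set" by simp
  show ?thesis
  proof (cases k)
    case (KBody c s)
    show ?thesis unfolding KBody occ_list_def Let_def kind.case set_append set_if by (intro Un_least I; simp)
  qed (unfold occ_list_def Let_def set_append set_if; simp only: kind.case set_append set_if; intro Un_least I; simp)+
qed

lemma wf_scan_prog_step:
  assumes s: "0 < s" "s < vB"
  shows "wf_com 32 vB 31 {rW2, rXX} (scan_prog_step s)"
proof -
  have B: "5 < vB" by (simp add: vB_def)
  have flag: "wf_com 32 vB 31 F (flag_prog rs)" if "set rs \<subseteq> {20..28}" "F \<inter> {20..28} = {}" for F rs
    using that B by (fastforce simp: flag_prog_def)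
  have occ: "wf_com 32 vB 31 {rW2, rXX} (occ_prog k p)" for k p
    unfolding occ_prog_def lookup_prog_def lookup_prog_step_def eq_prog_def compare_step_def using B
    by (auto intro!: flag set_occ_list)
  have act: "wf_com 32 vB 31 {rW2, rXX} (action_prog a s)" for a
    using B s occ by (cases a) (auto simp: rV_def)
  show ?thesis unfolding scan_prog_step_def using act qsym_less by auto
qed

lemma wf_verifier_prog: "wf_com 32 vB 31 {} verifier_prog"
proof -
  have B: "5 < vB" by (simp add: vB_def)
  show ?thesis
    unfolding verifier_prog_def parse_prog_def using B wf_scan_prog_step qsym_less
    by (auto simp: rV_def tok_def insert_commute)
qed

text \<open>The tiers descend along the flow of data: input, its two reversed parts, instance and
  table with the scan counter, world index, the name, entry, annotation and countdown, the
  comparison copy, and finally flags and control.\<close>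

lemma tiered_verifier_prog:
  "tiered (\<lambda>r. if r = 0 then 9 else if r \<in> {2, 3} then 8 else if r \<in> {5, 6, 7} then 7 else if r = 8 then 6
     else if r \<in> {10, 11, 14, 17} then 5 else if r = 15 then 4 else 0) 10 verifier_prog"
    (is "tiered ?t 10 _")
proof -
  have flag: "tiered ?t m (flag_prog rs)" if "set rs \<subseteq> {20..28}" "0 < m" for m rs
    using that by (fastforce simp: flag_prog_def)
  have occ: "tiered ?t 7 (occ_prog k p)" for k p
    unfolding occ_prog_def lookup_prog_def lookup_prog_step_def eq_prog_def compare_step_def
    by (auto intro!: flag set_occ_list)
  have act: "tiered ?t 7 (action_prog a s)" for a s
    using occ by (cases a) (auto simp: rV_def)
  show ?thesis
    unfolding verifier_prog_def parse_prog_def scan_prog_step_def using act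
    by (auto simp: rV_def)
qed

section \<open>The verifier program computes the scan\<close>

lemma fold_rel:
  assumes "R S \<sigma>" "\<And>t S \<sigma>. t \<in> set xs \<Longrightarrow> R S \<sigma> \<Longrightarrow> R (g t S) (e t \<sigma>)"
  shows "R (fold g xs S) (fold e xs \<sigma>)"
  using assms by (induction xs arbitrary: S \<sigma>) auto

lemma first_0_iff: "0 \<notin> set xs \<Longrightarrow> first xs = 0 \<longleftrightarrow> xs = []"
  by (cases xs) auto

lemma ev_copy: "a \<noteq> b \<Longrightarrow> ev (For a (\<lambda>s. Push b s)) \<sigma> = \<sigma>(b := rev (\<sigma> a) @ \<sigma> b)"
proof -
  have "fold (\<lambda>s. ev (Push b s)) xs \<sigma> = \<sigma>(b := rev xs @ \<sigma> b)" for xs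
    by (induction xs arbitrary: \<sigma>) auto
  then show ?thesis by simp
qed

fun compare_fn :: "nat \<Rightarrow> nat list \<times> nat list \<Rightarrow> nat list \<times> nat list" where
  "compare_fn s (ys, b) = (if first ys = s then (tl ys, b) else (ys, 1 # b))"

text \<open>A mismatch is recorded for good in the second component. Without one, the words are
  equal exactly when nothing is left over.\<close>

lemma compare_fn_fold:
  "0 \<notin> set xs \<Longrightarrow> 0 \<notin> set ys \<Longrightarrow> fold compare_fn xs (ys, b) = (zs, c) \<Longrightarrow>
   (zs = [] \<and> c = [] \<longleftrightarrow> b = [] \<and> xs = ys) \<and> 0 \<notin> set zs \<and> set c \<subseteq> insert 1 (set b)"
proof (induction xs arbitrary: ys b)
  case (Cons x xs)
  show ?case
  proof (cases "first ys = x")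
    case True
    then obtain us where "ys = x # us" using Cons.prems(1) by (cases ys) auto
    then show ?thesis using Cons.prems Cons.IH[of us b] by simp
  next
    case False
    then have "(zs = [] \<and> c = [] \<longleftrightarrow> 1 # b = [] \<and> xs = ys) \<and> 0 \<notin> set zs \<and> set c \<subseteq> insert 1 (set (1 # b))"
      using Cons.prems by (intro Cons.IH) simp_all
    then show ?thesis using False by auto
  qed
qed auto

lemma ev_compare:
  "fold (\<lambda>s. ev (compare_step s)) xs (\<sigma>(rTmp := ys, rBad := b)) =
     \<sigma>(rTmp := fst (fold compare_fn xs (ys, b)), rBad := snd (fold compare_fn xs (ys, b)))"
proof (induction xs arbitrary: ys b)
  case (Cons x xs)
  have "ev (compare_step x) (\<sigma>(rTmp := ys, rBad := b)) =
      \<sigma>(rTmp := fst (compare_fn x (ys, b)), rBad := snd (compare_fn x (ys, b)))"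
    by (simp add: compare_step_def fun_upd_twist)
  then show ?case using Cons[of "fst (compare_fn x (ys, b))" "snd (compare_fn x (ys, b))"]
    by (simp only: fold.simps o_apply prod.collapse)
qed simp

lemma ev_eq_prog:
  assumes "0 \<notin> set (\<sigma> rName)" "0 \<notin> set (\<sigma> rEnt)" "0 \<notin> set (\<sigma> rMatch)"
  shows "\<exists>t b c. ev eq_prog \<sigma> = \<sigma>(rTmp := t, rBad := b, rMatch := c) \<and>
    (c \<noteq> [] \<longleftrightarrow> \<sigma> rMatch \<noteq> [] \<or> \<sigma> rEnt = rev (\<sigma> rName)) \<and> 0 \<notin> set c"
proof -
  let ?\<tau> = "\<sigma>(rTmp := rev (\<sigma> rName), rBad := [])"
  have 1: "ev (Clear rBad) (ev (For rName (\<lambda>s. Push rTmp s)) (ev (Clear rTmp) \<sigma>)) = ?\<tau>"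
    by (subst ev_copy) simp_all
  obtain ys b where f: "fold compare_fn (\<sigma> rEnt) (rev (\<sigma> rName), []) = (ys, b)" by fastforce
  have 2: "ev (For rEnt compare_step) ?\<tau> = ?\<tau>(rTmp := ys, rBad := b)"
    using ev_compare[of "\<sigma> rEnt" \<sigma> "rev (\<sigma> rName)" "[]"] f by (simp add: fun_upd_twist)
  have c: "ys = [] \<and> b = [] \<longleftrightarrow> \<sigma> rEnt = rev (\<sigma> rName)" "0 \<notin> set ys" "set b \<subseteq> {1}"
    using compare_fn_fold[OF _ _ f] assms by auto
  have b: "first b = 0 \<longleftrightarrow> b = []" "first ys = 0 \<longleftrightarrow> ys = []" using c(2,3) by (auto intro!: first_0_iff)
  show ?thesis unfolding eq_prog_def ev.simps(5) 1 2 using b c(1) assms(3)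
    by (intro exI[of _ ys] exI[of _ b] exI[of _ "if ys = [] \<and> b = [] then 1 # \<sigma> rMatch else \<sigma> rMatch"])
      (auto simp: fun_upd_twist)
qed

text \<open>Only emptiness of mode and match registers is meaningful.\<close>
definition lookup_rel :: "regs \<Rightarrow> bool \<times> nat list \<times> bool \<times> nat list \<Rightarrow> regs \<Rightarrow> bool" where
  "lookup_rel \<sigma>0 S \<sigma> \<longleftrightarrow> (case S of (mode, en, mat, an) \<Rightarrow>
     (\<sigma> rMode \<noteq> [] \<longleftrightarrow> mode) \<and> \<sigma> rEnt = en \<and> (\<sigma> rMatch \<noteq> [] \<longleftrightarrow> mat) \<and> \<sigma> rAnn = an \<and>
     0 \<notin> set (\<sigma> rMode) \<and> 0 \<notin> set en \<and> 0 \<notin> set (\<sigma> rMatch) \<and> (\<forall>r. r \<notin> {11..16} \<longrightarrow> \<sigma> r = \<sigma>0 r))"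

lemma lookup_rel_step:
  assumes R: "lookup_rel \<sigma>0 S \<sigma>" and t: "0 < t" and nm: "0 \<notin> set (\<sigma>0 rName)"
  shows "lookup_rel \<sigma>0 (lookup_step (\<sigma>0 rName) t S) (ev (lookup_prog_step t) \<sigma>)"
proof -
  obtain mode en mat an where S: "S = (mode, en, mat, an)" by (cases S) auto
  have nm': "\<sigma> rName = \<sigma>0 rName" using R by (auto simp: lookup_rel_def S)
  have f: "first (\<sigma> rMode) = 0 \<longleftrightarrow> \<not> mode" "first (\<sigma> rMatch) = 0 \<longleftrightarrow> \<not> mat"
    using R by (auto simp: lookup_rel_def S first_0_iff)
  show ?thesis
  proof (cases "\<not> mode \<and> t = 3")
    case True
    obtain t' b c where e: "ev eq_prog \<sigma> = \<sigma>(rTmp := t', rBad := b, rMatch := c)"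
      "c \<noteq> [] \<longleftrightarrow> mat \<or> en = rev (\<sigma>0 rName)" "0 \<notin> set c"
      using ev_eq_prog[of \<sigma>] R nm nm' by (auto simp: lookup_rel_def S)
    then show ?thesis using R True f by (auto simp: lookup_rel_def S lookup_prog_step_def)
  next
    case False
    then show ?thesis using R t f by (auto simp: lookup_rel_def S lookup_prog_step_def)
  qed
qed

lemma ev_lookup_prog:
  assumes "0 \<notin> set (\<sigma> rName)" "0 \<notin> set (\<sigma> rW)"
  shows "ev lookup_prog \<sigma> rAnn = annot (\<sigma> rW) (\<sigma> rName)" "r \<notin> {11..16} \<Longrightarrow> ev lookup_prog \<sigma> r = \<sigma> r"
proof -
  let ?\<tau> = "\<sigma>(rMode := [], rEnt := [], rMatch := [], rAnn := [])"
  have "lookup_rel \<sigma> (fold (lookup_step (\<sigma> rName)) (\<sigma> rW) (False, [], False, [])) (fold (\<lambda>t. ev (lookup_prog_step t)) (\<sigma> rW) ?\<tau>)"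
  proof (rule fold_rel[where R = "lookup_rel \<sigma>"])
    show "lookup_rel \<sigma> (False, [], False, []) ?\<tau>" by (auto simp: lookup_rel_def)
    fix t S \<upsilon> assume t: "t \<in> set (\<sigma> rW)" and "lookup_rel \<sigma> S \<upsilon>"
    moreover have "0 < t" using t assms(2) by (metis gr0I)
    ultimately show "lookup_rel \<sigma> (lookup_step (\<sigma> rName) t S) (ev (lookup_prog_step t) \<upsilon>)"
      using lookup_rel_step assms(1) by blast
  qed
  moreover have "ev lookup_prog \<sigma> = fold (\<lambda>t. ev (lookup_prog_step t)) (\<sigma> rW) ?\<tau>" by (simp add: lookup_prog_def)
  ultimately show "ev lookup_prog \<sigma> rAnn = annot (\<sigma> rW) (\<sigma> rName)" "r \<notin> {11..16} \<Longrightarrow> ev lookup_prog \<sigma> r = \<sigma> r"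
    by (auto simp: lookup_rel_def annot_def split: prod.splits)
qed

fun ann_fn :: "nat \<Rightarrow> nat list \<times> nat list \<times> nat list \<times> nat list \<Rightarrow> nat list \<times> nat list \<times> nat list \<times> nat list" where
  "ann_fn s (c, v, s1, s0) = (tl c, if c = [] then v else [s], if s = 2 then 1 # s1 else s1, if s = 2 then s0 else 1 # s0)"

text \<open>The value is overwritten as long as the counter lasts, so the final one sits at position
  \<open>min n (length ys)\<close>, counted from 1; this is the repetition of the last value in
  \<open>world_val\<close>.\<close>

lemma fold_ann_fn:
  "\<exists>c a b. fold ann_fn ys (replicate n 1, v, s1, s0) =
     (c, if n = 0 \<or> ys = [] then v else [ys ! (min n (length ys) - 1)], a, b) \<and>
     (a \<noteq> [] \<longleftrightarrow> s1 \<noteq> [] \<or> 2 \<in> set ys) \<and> (b \<noteq> [] \<longleftrightarrow> s0 \<noteq> [] \<or> (\<exists>s\<in>set ys. s \<noteq> 2)) \<and>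
     set a \<subseteq> insert 1 (set s1) \<and> set b \<subseteq> insert 1 (set s0)"
proof (induction ys arbitrary: n v s1 s0)
  case (Cons y ys)
  let ?s1 = "if y = 2 then 1 # s1 else s1" and ?s0 = "if y = 2 then s0 else 1 # s0"
  from Cons[of "n - 1" "if n = 0 then v else [y]" ?s1 ?s0] obtain c a b where
    1: "fold ann_fn ys (replicate (n - 1) 1, if n = 0 then v else [y], ?s1, ?s0) =
     (c, if n - 1 = 0 \<or> ys = [] then (if n = 0 then v else [y]) else [ys ! (min (n - 1) (length ys) - 1)], a, b)"
    "a \<noteq> [] \<longleftrightarrow> ?s1 \<noteq> [] \<or> 2 \<in> set ys" "b \<noteq> [] \<longleftrightarrow> ?s0 \<noteq> [] \<or> (\<exists>s\<in>set ys. s \<noteq> 2)"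
    "set a \<subseteq> insert 1 (set ?s1)" "set b \<subseteq> insert 1 (set ?s0)" by blast
  have "fold ann_fn (y # ys) (replicate n 1, v, s1, s0) = fold ann_fn ys (replicate (n - 1) 1, if n = 0 then v else [y], ?s1, ?s0)"
    by (cases n) auto
  moreover have "(if n - 1 = 0 \<or> ys = [] then (if n = 0 then v else [y]) else [ys ! (min (n - 1) (length ys) - 1)]) =
      (if n = 0 \<or> y # ys = [] then v else [(y # ys) ! (min n (length (y # ys)) - 1)])"
  proof -
    consider "n = 0" | "n = 1" | "ys = []" "n \<noteq> 0" | m z zs where "n = Suc (Suc m)" "ys = z # zs"
      by (cases n rule: nat.exhaust; cases ys; cases "n - 1") auto
    then show ?thesis by cases (simp_all add: min_def)
  qed
  ultimately have eq: "fold ann_fn (y # ys) (replicate n 1, v, s1, s0) =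
     (c, if n = 0 \<or> y # ys = [] then v else [(y # ys) ! (min n (length (y # ys)) - 1)], a, b)"
    using 1(1) by (simp only:)
  have "(a \<noteq> [] \<longleftrightarrow> s1 \<noteq> [] \<or> 2 \<in> set (y # ys)) \<and> (b \<noteq> [] \<longleftrightarrow> s0 \<noteq> [] \<or> (\<exists>s\<in>set (y # ys). s \<noteq> 2)) \<and>
     set a \<subseteq> insert 1 (set s1) \<and> set b \<subseteq> insert 1 (set s0)"
    using 1(2-5) by (cases "y = 2") auto
  with eq show ?case by blast
qed auto

lemma ev_flag_prog:
  "(ev (flag_prog rs) \<sigma> r \<noteq> [] \<longleftrightarrow> r \<in> set rs \<or> \<sigma> r \<noteq> []) \<and> (r \<notin> set rs \<longrightarrow> ev (flag_prog rs) \<sigma> r = \<sigma> r)"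
  unfolding flag_prog_def by (induction rs arbitrary: \<sigma>) auto

lemma ev_occ_prog:
  assumes nz: "0 \<notin> set (\<sigma> rName)" "0 \<notin> set (\<sigma> rW)" and i: "\<sigma> rIdx = replicate i 1"
  shows "r \<in> {20..28} \<Longrightarrow> ev (occ_prog k p) \<sigma> r \<noteq> [] \<longleftrightarrow> \<sigma> r \<noteq> [] \<or> r \<in> occ_flags i (annot (\<sigma> rW) (\<sigma> rName)) k p"
    and "r \<notin> {11..29} \<Longrightarrow> ev (occ_prog k p) \<sigma> r = \<sigma> r"
proof -
  define l where "l = annot (\<sigma> rW) (\<sigma> rName)"
  define \<tau> where "\<tau> = ev lookup_prog \<sigma>"
  have \<tau>: "\<tau> rAnn = l" "r \<notin> {11..16} \<Longrightarrow> \<tau> r = \<sigma> r" for r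
    using ev_lookup_prog[OF nz] by (simp_all add: \<tau>_def l_def)
  define ys where "ys = tl (tl (tl (tl l)))"
  define base where "base = \<tau>(rAnn := ys)"
  define loop where "loop = (\<lambda>s. (if s = 2 then Push rS1 1 else Push rS0 1) ;;
         Case rCnt (\<lambda>c. if c = 0 then Skip else Pop rCnt ;; Clear rYV ;; Push rYV s))"
  define R where "R S \<upsilon> \<longleftrightarrow> (case S of (c, v, s1, s0) \<Rightarrow> \<upsilon> rCnt = c \<and> \<upsilon> rYV = v \<and> \<upsilon> rS1 = s1 \<and> \<upsilon> rS0 = s0 \<and>
     set c \<subseteq> {1} \<and> (\<forall>r. r \<notin> {17, 18, 19, 29} \<longrightarrow> \<upsilon> r = base r))" for S and \<upsilon> :: regs
  let ?start = "base(rCnt := replicate i 1, rYV := [], rS1 := [], rS0 := [])"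
  have start: "R (replicate i 1, [], [], []) ?start" by (auto simp: R_def)
  define fin where "fin = fold (\<lambda>s. ev (loop s)) ys ?start"
  have Rf: "R (fold ann_fn ys (replicate i 1, [], [], [])) fin"
    unfolding fin_def
  proof (rule fold_rel[where R = R, OF start])
    fix s S \<upsilon> assume "R S \<upsilon>"
    moreover obtain c v s1 s0 where S: "S = (c, v, s1, s0)" by (cases S) auto
    ultimately have u: "\<upsilon> rCnt = c" "\<upsilon> rYV = v" "\<upsilon> rS1 = s1" "\<upsilon> rS0 = s0" "set c \<subseteq> {1}"
      "\<And>r. r \<notin> {17, 18, 19, 29} \<Longrightarrow> \<upsilon> r = base r" by (auto simp: R_def)
    have "first c = 0 \<longleftrightarrow> c = []" using u(5) by (cases c) auto
    then show "R (ann_fn s S) (ev (loop s) \<upsilon>)"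
      using u by (cases c; cases "s = 2") (auto simp: R_def S loop_def)
  qed
  obtain c a b where f: "fold ann_fn ys (replicate i 1, [], [], []) =
      (c, if i = 0 \<or> ys = [] then [] else [ys ! (min i (length ys) - 1)], a, b)"
    "a \<noteq> [] \<longleftrightarrow> 2 \<in> set ys" "b \<noteq> [] \<longleftrightarrow> (\<exists>s\<in>set ys. s \<noteq> 2)" "set a \<subseteq> {1}" "set b \<subseteq> {1}"
    using fold_ann_fn[of ys i "[]" "[]" "[]"] by auto
  have fin: "fin rYV = (if i = 0 \<or> ys = [] then [] else [ys ! (min i (length ys) - 1)])" "fin rS1 = a" "fin rS0 = b"
    "\<And>r. r \<notin> {17, 18, 19, 29} \<Longrightarrow> fin r = base r"
    using Rf unfolding f(1) R_def prod.case by blast+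
  have "first a \<noteq> 0 \<longleftrightarrow> a \<noteq> []" "first b \<noteq> 0 \<longleftrightarrow> b \<noteq> []" using f(4,5) by (cases a; cases b; auto)+
  then have u: "first (fin rYV) = world_val i ys" "first (fin rS1) \<noteq> 0 \<longleftrightarrow> 2 \<in> set ys"
    "first (fin rS0) \<noteq> 0 \<longleftrightarrow> (\<exists>s\<in>set ys. s \<noteq> 2)"
    using fin f(2,3) by (simp_all add: world_val_def)
  let ?u = "\<tau>(rCnt := replicate i 1, rYV := [], rS1 := [], rS0 := [])"
  have push: "ev (For rIdx (\<lambda>_. Push rCnt 1)) \<upsilon> = \<upsilon>(rCnt := replicate (length (\<upsilon> rIdx)) 1 @ \<upsilon> rCnt)" for \<upsilon>
  proof -
    have "fold (\<lambda>_. ev (Push rCnt 1)) xs \<upsilon> = \<upsilon>(rCnt := replicate (length xs) 1 @ \<upsilon> rCnt)" for xs :: "nat list"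
      by (induction xs arbitrary: \<upsilon>) (auto simp: replicate_app_Cons_same)
    then show ?thesis unfolding ev.simps(7) .
  qed
  have cnt: "ev (For rIdx (\<lambda>_. Push rCnt 1)) (ev (Clear rS0) (ev (Clear rS1) (ev (Clear rYV) (ev (Clear rCnt) \<tau>)))) = ?u"
    unfolding push using \<tau>(2)[of rIdx] i by (auto simp: fun_eq_iff)
  have pop: "ev (Case rAnn (\<lambda>m. Pop rAnn ;; g m)) \<upsilon> = ev (g (first (\<upsilon> rAnn))) (\<upsilon>(rAnn := tl (\<upsilon> rAnn)))" for g \<upsilon>
    by simp
  have ua: "?u rAnn = l" using \<tau>(1) by simp
  have us: "?u(rAnn := ys) = ?start" "?start rAnn = ys" by (auto simp: base_def fun_eq_iff)
  let ?ls = "occ_list k p (first l) (first (tl l)) (first (tl (tl l))) (first (tl (tl (tl l))))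
      (world_val i ys) (2 \<in> set ys) (\<exists>s\<in>set ys. s \<noteq> 2)"
  have E: "ev (occ_prog k p) \<sigma> = ev (flag_prog ?ls) fin"
    unfolding occ_prog_def ev.simps(5)[of lookup_prog] \<tau>_def[symmetric] ev.simps(5)[of "Clear _"] ev.simps(5)[of "For rIdx _"] cnt
      pop fun_upd_same fun_upd_upd ua ys_def[symmetric] us(1) loop_def[symmetric]
    unfolding ev.simps(5)[of "For rAnn _"] ev.simps(7)[of rAnn] us(2) fin_def[symmetric] ev.simps(6) u ..
  have F: "set ?ls = occ_flags i (annot (\<sigma> rW) (\<sigma> rName)) k p"
    unfolding occ_flags_def l_def[symmetric] ys_def[symmetric] ..
  have b: "base r = \<tau> r" if "r \<noteq> 14" for r using that by (simp add: base_def)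
  show "ev (occ_prog k p) \<sigma> r \<noteq> [] \<longleftrightarrow> \<sigma> r \<noteq> [] \<or> r \<in> occ_flags i (annot (\<sigma> rW) (\<sigma> rName)) k p" if r: "r \<in> {20..28}"
  proof -
    have fr: "fin r = \<sigma> r" using fin(4)[of r] b[of r] \<tau>(2)[of r] r by auto
    show ?thesis unfolding E F[symmetric] using conjunct1[OF ev_flag_prog[of ?ls fin r]]
      by (simp only: fr disj_commute)
  qed
  show "ev (occ_prog k p) \<sigma> r = \<sigma> r" if r: "r \<notin> {11..29}"
  proof -
    have "fin r = \<sigma> r" using fin(4)[of r] b[of r] \<tau>(2)[of r] r by auto
    moreover have "r \<notin> set ?ls" using set_occ_list r by fastforce
    ultimately show ?thesis unfolding E using ev_flag_prog[of ?ls fin r] by simp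
  qed
qed

text \<open>Flags are compared by emptiness only, since a register may be pushed many times.
  Registers up to 8 and the result register 30 are the frame of a single scan.\<close>

definition scan_rel :: "regs \<Rightarrow> dstate \<times> nat list \<times> nat set \<Rightarrow> regs \<Rightarrow> bool" where
  "scan_rel \<sigma>0 S \<sigma> \<longleftrightarrow> (case S of (q, nm, F) \<Rightarrow>
     \<sigma> rQ = [qsym q] \<and> \<sigma> rName = nm \<and> F = {r \<in> {20..28}. \<sigma> r \<noteq> []} \<and>
     (\<forall>r \<in> {0..8} \<union> {30}. \<sigma> r = \<sigma>0 r) \<and> regs_ok vB \<sigma>)"

lemma rV_range: "rV p \<in> {20..28}"
  by (simp add: rV_def)

lemma scan_rel_step:
  assumes R: "scan_rel \<sigma>0 S \<sigma>" and i: "\<sigma>0 rIdx = replicate i 1"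
  shows "scan_rel \<sigma>0 (scan_step (table_occ (\<sigma>0 rW) i) b S) (ev (scan_prog_step (bsym b)) \<sigma>)"
proof -
  obtain q nm F where S: "S = (q, nm, F)" by (cases S) auto
  have r: "\<sigma> rQ = [qsym q]" "\<sigma> rName = nm" "F = {r \<in> {20..28}. \<sigma> r \<noteq> []}"
    "\<And>r. r \<le> 8 \<or> r = 30 \<Longrightarrow> \<sigma> r = \<sigma>0 r" and ok: "regs_ok vB \<sigma>"
    using R by (auto simp: scan_rel_def S)
  obtain q' a where qa: "dfa q b = (q', a)" by fastforce
  let ?oc = "table_occ (\<sigma>0 rW) i" and ?s = "bsym b"
  have s: "0 < ?s" "?s < vB" "?s = 2 \<longleftrightarrow> b" by (auto simp: bsym_def vB_def)
  have z: "0 \<notin> set (\<sigma> r)" for r using regs_okD[OF ok] by blast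
  have f0: "first (\<sigma> r) = 0 \<longleftrightarrow> r \<notin> F" if "r \<in> {20..28}" for r
    using that first_0_iff[OF z] by (auto simp: r(3))
  let ?\<tau> = "ev (action_prog a ?s) \<sigma>"
  have act: "?\<tau> rName = fst (do_action ?oc a b (nm, F)) \<and> {r \<in> {20..28}. ?\<tau> r \<noteq> []} = snd (do_action ?oc a b (nm, F)) \<and>
      (\<forall>r. r \<le> 8 \<or> r = 30 \<longrightarrow> ?\<tau> r = \<sigma>0 r)"
  proof (cases a)
    case ANone
    then show ?thesis using r by simp
  next
    case ABit
    then show ?thesis using r by auto
  next
    case (AOcc k p)
    note o = ev_occ_prog[of \<sigma> i, OF z z]
    have eq: "\<sigma> rIdx = replicate i 1" "\<sigma> rW = \<sigma>0 rW" using r(4) i by auto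
    let ?o = "occ_flags i (annot (\<sigma>0 rW) nm) k p"
    have "?o \<subseteq> {20..28}" unfolding occ_flags_def by (rule set_occ_list)
    moreover have "ev (occ_prog k p) \<sigma> r \<noteq> [] \<longleftrightarrow> \<sigma> r \<noteq> [] \<or> r \<in> ?o" if "r \<in> {20..28}" for r
      using o(1)[OF eq(1) that] by (simp only: eq(2) r(2))
    ultimately have "{r \<in> {20..28}. ev (occ_prog k p) \<sigma> r \<noteq> []} = F \<union> ?o" unfolding r(3) by blast
    moreover have "{r \<in> {20..28}. ((ev (occ_prog k p) \<sigma>)(rName := [])) r \<noteq> []} = {r \<in> {20..28}. ev (occ_prog k p) \<sigma> r \<noteq> []}" by auto
    moreover have "\<forall>r. r \<le> 8 \<or> r = 30 \<longrightarrow> ev (occ_prog k p) \<sigma> r = \<sigma>0 r" using o(2)[OF eq(1)] r(4) by auto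
    ultimately show ?thesis unfolding AOcc action_prog.simps do_action.simps ev.simps(4,5) table_occ_def fst_conv snd_conv
      by simp
  next
    case AStart
    then show ?thesis using r by (auto simp: rule_flags_def)
  next
    case (AEnd p)
    then show ?thesis using r f0 rV_range[of p] by (auto simp: violated_def)
  qed
  have e: "ev (scan_prog_step ?s) \<sigma> = ?\<tau>(rQ := [qsym q'])"
    unfolding scan_prog_step_def using s r(1) qa by simp
  have "regs_ok vB (ev (scan_prog_step ?s) \<sigma>)"
    using ev_regs_ok[OF wf_scan_prog_step[OF s(1,2)] _ ok] by (simp add: vB_def)
  moreover have "{r \<in> {20..28}. (?\<tau>(rQ := [qsym q'])) r \<noteq> []} = {r \<in> {20..28}. ?\<tau> r \<noteq> []}" by auto
  ultimately show ?thesis using act qa unfolding scan_rel_def scan_step_def S e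
    by (auto split: prod.splits)
qed

definition world_body :: com where
  "world_body = Clear rQ ;; Push rQ (qsym (Tag LAtoms True)) ;; Clear rName ;;
       For rXX scan_prog_step ;; Push rIdx 1"

lemma ev_world_body:
  assumes ok: "regs_ok vB \<sigma>" and x: "\<sigma> rXX = bit_word x" and i: "\<sigma> rIdx = replicate i 1"
  defines "\<tau> \<equiv> ev world_body \<sigma>"
  shows "\<tau> rQ = [qsym (dfa_run x (Tag LAtoms True))]"
    and "{r \<in> {20..28}. \<tau> r \<noteq> []} = world_scan (\<sigma> rW) x i {r \<in> {20..28}. \<sigma> r \<noteq> []}"
    and "\<tau> rIdx = replicate (Suc i) 1"
    and "\<forall>r \<in> {0..7} \<union> {30}. \<tau> r = \<sigma> r"
    and "regs_ok vB \<tau>"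
proof -
  let ?F = "{r \<in> {20..28}. \<sigma> r \<noteq> []}" and ?q = "Tag LAtoms True"
  let ?\<upsilon> = "\<sigma>(rQ := [qsym ?q], rName := [])"
  define \<phi> where "\<phi> = fold (\<lambda>b. ev (scan_prog_step (bsym b))) x ?\<upsilon>"
  have "scan_rel \<sigma> (?q, [], ?F) ?\<upsilon>"
    using ok qsym_less by (auto simp: scan_rel_def regs_ok_def)
  then have rel: "scan_rel \<sigma> (scan_bits (table_occ (\<sigma> rW) i) x (?q, [], ?F)) \<phi>"
    unfolding \<phi>_def scan_bits_def by (rule fold_rel[where R = "scan_rel \<sigma>"]) (erule scan_rel_step, rule i)
  have "bit_word x = map bsym x" by (simp add: bit_word_def bsym_def)
  then have "ev (For rXX scan_prog_step) ?\<upsilon> = \<phi>"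
    using x by (simp add: \<phi>_def fold_map o_def)
  then have \<tau>: "\<tau> = \<phi>(rIdx := 1 # \<phi> rIdx)" by (simp add: \<tau>_def world_body_def)
  obtain nm F where S: "scan_bits (table_occ (\<sigma> rW) i) x (?q, [], ?F) = (dfa_run x ?q, nm, F)"
    using fst_scan_bits[of "table_occ (\<sigma> rW) i" x "(?q, [], ?F)"]
    by (cases "scan_bits (table_occ (\<sigma> rW) i) x (?q, [], ?F)") auto
  have F: "F = world_scan (\<sigma> rW) x i ?F" unfolding world_scan_def S by simp
  note rel = rel[unfolded S scan_rel_def prod.case]
  show "\<tau> rQ = [qsym (dfa_run x (Tag LAtoms True))]" using rel by (simp add: \<tau>)
  have "{r \<in> {20..28}. \<tau> r \<noteq> []} = {r \<in> {20..28}. \<phi> r \<noteq> []}" by (auto simp: \<tau>)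
  then show "{r \<in> {20..28}. \<tau> r \<noteq> []} = world_scan (\<sigma> rW) x i ?F" using rel F by simp
  have "\<phi> rIdx = \<sigma> rIdx" using rel by simp
  then show "\<tau> rIdx = replicate (Suc i) 1" using i by (simp add: \<tau>)
  show "\<forall>r \<in> {0..7} \<union> {30}. \<tau> r = \<sigma> r" using rel by (simp add: \<tau>)
  have "1 < vB" by (simp add: vB_def)
  moreover have "regs_ok vB \<phi>" using rel by blast
  ultimately show "regs_ok vB \<tau>" by (auto simp: \<tau> regs_ok_def)
qed

lemma fold_world_body:
  assumes "regs_ok vB \<sigma>" "\<sigma> rXX = bit_word x" "\<sigma> rIdx = []"
    and "\<forall>r \<in> {20..28}. \<sigma> r = []"
  shows "let \<tau> = fold (\<lambda>_. ev world_body) zs \<sigma> in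
     (zs \<noteq> [] \<longrightarrow> \<tau> rQ = [qsym (dfa_run x (Tag LAtoms True))]) \<and>
     {r \<in> {20..28}. \<tau> r \<noteq> []} = fold (world_scan (\<sigma> rW) x) [0..<length zs] {} \<and>
     \<tau> rIdx = replicate (length zs) 1 \<and> (\<forall>r \<in> {0..7} \<union> {30}. \<tau> r = \<sigma> r) \<and> regs_ok vB \<tau>"
proof (induction zs rule: rev_induct)
  case Nil
  then show ?case using assms by auto
next
  case (snoc z zs)
  let ?\<tau> = "fold (\<lambda>_. ev world_body) zs \<sigma>"
  have IH: "{r \<in> {20..28}. ?\<tau> r \<noteq> []} = fold (world_scan (\<sigma> rW) x) [0..<length zs] {}"
     "?\<tau> rIdx = replicate (length zs) 1" "\<forall>r \<in> {0..7} \<union> {30}. ?\<tau> r = \<sigma> r" "regs_ok vB ?\<tau>"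
    using snoc unfolding Let_def by blast+
  have x: "?\<tau> rXX = bit_word x" "?\<tau> rW = \<sigma> rW" using IH(3) assms(2) by simp_all
  note b = ev_world_body[OF IH(4) x(1) IH(2), unfolded x(2) IH(1)]
  have "fold (world_scan (\<sigma> rW) x) [0..<length (zs @ [z])] {} =
      world_scan (\<sigma> rW) x (length zs) (fold (world_scan (\<sigma> rW) x) [0..<length zs] {})" by simp
  moreover have "fold (\<lambda>_. ev world_body) (zs @ [z]) \<sigma> = ev world_body ?\<tau>" by simp
  moreover have "\<forall>r \<in> {0..7} \<union> {30}. ev world_body ?\<tau> r = \<sigma> r" using b(4) IH(3) by simp
  ultimately show ?case unfolding Let_def using b by (simp only: length_append_singleton simp_thms)
qed

fun tok_fn :: "nat \<Rightarrow> nat list \<times> nat list \<Rightarrow> nat list \<times> nat list" where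
  "tok_fn s (h, w) = (if h = [] then ([s], w) else ([], tok s (hd h) # w))"

definition tokens :: "bool list \<Rightarrow> nat list" where
  "tokens w = snd (fold tok_fn (rev (bit_word w)) ([], []))"

lemma set_tokens: "set (tokens w) \<subseteq> {1..4}"
proof -
  have "set (snd (fold tok_fn xs (h, w))) \<subseteq> {1..4}" if "set w \<subseteq> {1..4}" for xs h w
    using that by (induction xs arbitrary: h w) (auto simp: tok_def)
  then show ?thesis by (simp add: tokens_def)
qed

fun tok_bits :: "nat \<Rightarrow> bool list" where
  "tok_bits t = [2 < t, even t]"

lemma tokens_tok_bits:
  assumes "set W \<subseteq> {1, 2, 3, 4}"
  shows "tokens (concat (map tok_bits W)) = W"
proof -
  have "fold tok_fn (rev (bit_word (concat (map tok_bits W)))) ([], V) = ([], W @ V)" for V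
    using assms by (induction W arbitrary: V) (auto simp: bit_word_def tok_def)
  then show ?thesis by (simp add: tokens_def)
qed

lemma ev_parse_prog:
  defines "\<tau> x w \<equiv> ev parse_prog (input_regs (verifier_input x w))"
  shows "\<tau> x w rXX = bit_word x" "\<tau> x w rW = tokens w" "\<tau> x w rW2 = replicate (length (tokens w) + 2) 1"
    and "7 < r \<Longrightarrow> \<tau> x w r = []"
proof -
  define f where "f = (\<lambda>s. ev (Case rFL (\<lambda>f. if f = 0 then (if s = 3 then Push rFL 1 else Push rXR s) else Push rWR s)))"
  define g where "g = (\<lambda>s. ev (Case rH (\<lambda>h. if h = 0 then Push rH s else Pop rH ;; Push rW (tok s h) ;; Push rW2 1)))"
  define \<sigma> where "\<sigma> = input_regs (verifier_input x w)"
  have f1: "fold f xs \<upsilon> = \<upsilon>(rXR := rev xs @ \<upsilon> rXR)" if "set xs \<subseteq> {1, 2}" "\<upsilon> rFL = []" for xs \<upsilon>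
    using that by (induction xs arbitrary: \<upsilon>) (auto simp: f_def)
  have f2: "fold f xs \<upsilon> = \<upsilon>(rWR := rev xs @ \<upsilon> rWR)" if "\<upsilon> rFL = [1]" for xs \<upsilon>
    using that by (induction xs arbitrary: \<upsilon>) (auto simp: f_def)
  have f3: "f 3 \<upsilon> = \<upsilon>(rFL := [1])" if "\<upsilon> rFL = []" for \<upsilon> using that by (simp add: f_def)
  define \<tau>1 where "\<tau>1 = \<sigma>(rXR := rev (bit_word x), rFL := [1], rWR := rev (bit_word w))"
  have 11: "fold f (bit_word x) \<sigma> = \<sigma>(rXR := rev (bit_word x))"
    using f1[OF set_bit_word, of \<sigma> x] by (simp add: \<sigma>_def)
  have 12: "f 3 (\<sigma>(rXR := rev (bit_word x))) = \<sigma>(rXR := rev (bit_word x), rFL := [1])"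
    by (rule f3) (simp add: \<sigma>_def)
  have 13: "fold f (bit_word w) (\<sigma>(rXR := rev (bit_word x), rFL := [1])) = \<tau>1"
    by (subst f2) (simp_all add: \<sigma>_def \<tau>1_def)
  have "\<sigma> 0 = bit_word x @ 3 # bit_word w" by (simp add: \<sigma>_def verifier_input_def)
  then have "fold f (\<sigma> 0) \<sigma> = \<tau>1" by (simp only: fold_append fold.simps o_apply 11 12 13)
  then have 1: "ev (For 0 (\<lambda>s. Case rFL (\<lambda>f. if f = 0 then (if s = 3 then Push rFL 1 else Push rXR s) else Push rWR s))) \<sigma> = \<tau>1"
    by (simp only: f_def ev.simps(7))
  define \<tau>2 where "\<tau>2 = \<tau>1(rXX := bit_word x)"
  have 2: "ev (For rXR (\<lambda>s. Push rXX s)) \<tau>1 = \<tau>2"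
    by (subst ev_copy) (simp_all add: \<tau>1_def \<tau>2_def \<sigma>_def)
  have g: "fold g xs (\<upsilon>(rH := h, rW := v, rW2 := replicate (length v) 1)) =
     \<upsilon>(rH := fst (fold tok_fn xs (h, v)), rW := snd (fold tok_fn xs (h, v)),
       rW2 := replicate (length (snd (fold tok_fn xs (h, v)))) 1)"
    if "0 \<notin> set xs" "0 \<notin> set h" "length h \<le> 1" for xs h v \<upsilon>
    using that
  proof (induction xs arbitrary: h v)
    case (Cons a xs)
    show ?case
    proof (cases h)
      case Nil
      have "g a (\<upsilon>(rH := h, rW := v, rW2 := replicate (length v) 1)) = \<upsilon>(rH := [a], rW := v, rW2 := replicate (length v) 1)"
        using Nil by (simp add: g_def fun_upd_twist)
      moreover have "tok_fn a (h, v) = ([a], v)" using Nil by simp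
      moreover have "0 \<notin> set xs" "0 \<notin> set [a]" "length [a] \<le> 1" using Cons.prems by simp_all
      ultimately show ?thesis using Cons.IH[of "[a]" v] by (simp only: fold.simps o_apply simp_thms)
    next
      case h: (Cons b h')
      have "h' = []" "b \<noteq> 0" using Cons.prems h by auto
      have "g a (\<upsilon>(rH := h, rW := v, rW2 := replicate (length v) 1)) =
          \<upsilon>(rH := [], rW := tok a b # v, rW2 := replicate (length (tok a b # v)) 1)"
        using h \<open>h' = []\<close> \<open>b \<noteq> 0\<close> by (simp add: g_def fun_upd_twist)
      moreover have "tok_fn a (h, v) = ([], tok a b # v)" using h by simp
      moreover have "0 \<notin> set xs" "0 \<notin> set ([] :: nat list)" "length ([] :: nat list) \<le> 1" using Cons.prems by simp_all
      ultimately show ?thesis using Cons.IH[of "[]" "tok a b # v"] by (simp only: fold.simps o_apply simp_thms)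
    qed
  qed simp
  define \<tau>3 where "\<tau>3 = \<tau>2(rH := fst (fold tok_fn (rev (bit_word w)) ([], [])), rW := tokens w, rW2 := replicate (length (tokens w)) 1)"
  have "\<tau>2 = \<tau>2(rH := [], rW := [], rW2 := replicate (length ([] :: nat list)) 1)"
    by (simp add: \<tau>2_def \<tau>1_def \<sigma>_def fun_eq_iff)
  moreover have "0 \<notin> set (rev (bit_word w))" using set_bit_word[of w] by auto
  ultimately have "fold g (rev (bit_word w)) \<tau>2 = \<tau>3"
    using g[of "rev (bit_word w)" "[]" \<tau>2 "[]"] by (simp only: \<tau>3_def tokens_def) simp
  moreover have "\<tau>2 rWR = rev (bit_word w)" by (simp add: \<tau>2_def \<tau>1_def)
  ultimately have 3: "ev (For rWR (\<lambda>s. Case rH (\<lambda>h. if h = 0 then Push rH s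
        else Pop rH ;; Push rW (tok s h) ;; Push rW2 1))) \<tau>2 = \<tau>3"
    by (simp only: g_def ev.simps(7))
  have \<tau>: "\<tau> x w = \<tau>3(rW2 := 1 # 1 # \<tau>3 rW2)"
    unfolding \<tau>_def \<sigma>_def[symmetric] parse_prog_def ev.simps(5) 1 2 3 by simp
  show "\<tau> x w rXX = bit_word x" "\<tau> x w rW = tokens w" "\<tau> x w rW2 = replicate (length (tokens w) + 2) 1"
    "7 < r \<Longrightarrow> \<tau> x w r = []"
    unfolding \<tau> by (simp_all add: \<tau>3_def \<tau>2_def \<tau>1_def \<sigma>_def)
qed

lemma ev_verifier_prog:
  "ev verifier_prog (input_regs (verifier_input x w)) rAcc \<noteq> [] \<longleftrightarrow> table_accepts (tokens w) x"
proof -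
  define \<sigma> where "\<sigma> = ev parse_prog (input_regs (verifier_input x w))"
  define \<tau> where "\<tau> = fold (\<lambda>_. ev world_body) (\<sigma> rW2) \<sigma>"
  define fin where "fin = Case rQ (\<lambda>q. Case rFail (\<lambda>f. Case rNelp (\<lambda>n. Case (rV True) (\<lambda>a. Case (rV False) (\<lambda>b. Case rDiff (\<lambda>d.
       if qof q \<noteq> Done \<or> f = 0 \<and> (n \<noteq> 0 \<or> (a \<noteq> 0) \<noteq> (b \<noteq> 0) \<or> d \<noteq> 0 \<and> a = 0) then Push rAcc 1 else Skip))))))"
  note p = ev_parse_prog[where x = x and w = w, folded \<sigma>_def]
  have "set (verifier_input x w) \<subseteq> {0<..<vB}" using set_verifier_input[of x w] by (auto simp: vB_def)
  then have "regs_ok vB (input_regs (verifier_input x w))" by (rule regs_ok_input_regs)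
  moreover have "wf_com 32 vB 31 {} parse_prog" using wf_verifier_prog by (simp add: verifier_prog_def)
  ultimately have ok: "regs_ok vB \<sigma>" unfolding \<sigma>_def by (intro ev_regs_ok[of 32 vB 31 "{}"]) (simp_all add: vB_def)
  have e0: "\<sigma> rIdx = []" "\<forall>r \<in> {20..28}. \<sigma> r = []" using p(4) by simp_all
  let ?F = "final_flags (tokens w) x" and ?q = "dfa_run x (Tag LAtoms True)"
  have l: "\<sigma> rW2 \<noteq> []" "length (\<sigma> rW2) = length (tokens w) + 2" using p(3) by simp_all
  have w: "\<tau> rQ = [qsym ?q]" "{r \<in> {20..28}. \<tau> r \<noteq> []} = ?F" "\<tau> rAcc = []" and ok': "regs_ok vB \<tau>"
    using fold_world_body[OF ok p(1) e0, of "\<sigma> rW2"] l(1) p(4)[of rAcc]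
    unfolding Let_def \<tau>_def[symmetric] final_flags_def l(2) p(2) by simp_all
  have z: "0 \<notin> set (\<tau> r)" for r using regs_okD[OF ok'] by blast
  have f: "first (\<tau> r) = 0 \<longleftrightarrow> r \<notin> ?F" if "r \<in> {20..28}" for r
    using that first_0_iff[OF z] w(2) by blast
  have "ev verifier_prog (input_regs (verifier_input x w)) = ev fin \<tau>"
    unfolding verifier_prog_def ev.simps(5)[of parse_prog] \<sigma>_def[symmetric] world_body_def[symmetric] fin_def[symmetric]
    by (simp only: ev.simps(5)[of "For _ _"] ev.simps(7) \<tau>_def)
  moreover have "qof (first (\<tau> rQ)) = ?q" using w(1) by simp
  ultimately have "ev verifier_prog (input_regs (verifier_input x w)) =
      ev (if accepting ?q ?F then Push rAcc 1 else Skip) \<tau>"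
    unfolding fin_def ev.simps(6) accepting_def
    by (simp only: f[OF rV_range] f[of rFail, simplified] f[of rNelp, simplified] f[of rDiff, simplified] not_not)
  then show ?thesis using w(3) by (simp add: table_accepts_def)
qed

theorem strong_equivalence_in_coNP: "strong_equivalence_problem \<in> coNP"
proof -
  have "5 < vB" by (simp add: vB_def)
  with verifierI[OF _ tiered_verifier_prog, of 31 vB rAcc] wf_verifier_prog obtain V a d where V: "wf_machine V"
      "\<forall>x w. halting V (fst (run V (pbound a d (length (verifier_input x w))) (verifier_input x w)))"
      "\<And>x w. accepts V (verifier_input x w) \<longleftrightarrow> table_accepts (tokens w) x"
    by (auto simp: ev_verifier_prog)
  have "x \<in> - strong_equivalence_problem \<longleftrightarrow>
      (\<exists>w. length w \<le> pbound 20 2 (length x) \<and> accepts V (verifier_input x w))" for x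
  proof
    assume "x \<in> - strong_equivalence_problem"
    then obtain W where W: "set W \<subseteq> {1, 2, 3, 4}" "table_accepts W x" "length W \<le> length x * (3 * length x + 7)"
      using table_accepts_complete[of x] by auto
    \<comment> \<open>With two bits per symbol and input length \<open>n\<close>, at most
      \<open>6 * n ^ 2 + 14 * n\<close> bits are needed, which is below
      \<open>20 * n ^ 2 + 20\<close>.\<close>
    let ?w = "concat (map tok_bits W)"
    have "length ?w = 2 * length W" by (induction W) auto
    also have "\<dots> \<le> 6 * (length x * length x) + 14 * length x" using W(3) by (simp add: algebra_simps)
    also have "\<dots> \<le> 20 * (length x * length x) + 20" by (cases "length x") auto
    finally have "length ?w \<le> pbound 20 2 (length x)" by (simp add: pbound_def power2_eq_square)
    then show "\<exists>w. length w \<le> pbound 20 2 (length x) \<and> accepts V (verifier_input x w)"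
      using V(3) W(2) tokens_tok_bits[OF W(1)] by metis
  next
    assume "\<exists>w. length w \<le> pbound 20 2 (length x) \<and> accepts V (verifier_input x w)"
    then obtain w where "table_accepts (tokens w) x" using V(3) by blast
    \<comment> \<open>Every bit word decodes to symbols from 1 to 4, so soundness applies to
      arbitrary certificates.\<close>
    moreover have "0 \<notin> set (tokens w)" using set_tokens[of w] by fastforce
    ultimately show "x \<in> - strong_equivalence_problem" using table_accepts_sound by blast
  qed
  then show ?thesis unfolding coNP_def NP_def using V(1,2) by blast
qed

theorem theorem5: "coNP_complete strong_equivalence_problem"
  unfolding coNP_complete_def
  using strong_equivalence_in_coNP strong_equivalence_coNP_hard by blast

end
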